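(* Let $X$ be a finite connected CW complex of dimension $d\ge 1$, and let $\mathcal{L}=\partial\partial^*\colon B_{d-1}(X;\mathbb{R})\to B_{d-1}(X;\mathbb{R})$ (an isomorphism). Then $$\det\mathcal{L}=\gamma_X\sum_T\theta_T^2,$$ where the sum is over all spanning trees $T$ of $X$, $\theta_T$ is the order of the torsion subgroup of $H_{d-1}(T;\mathbb{Z})$, and $\gamma_X=\mu_X/\theta_X^2$, with $\mu_X$ the square of the covolume of the lattice $B_{d-1}(X;\mathbb{Z})\subset B_{d-1}(X;\mathbb{R})$ with respect to the restriction of the standard inner product of $C_{d-1}(X;\mathbb{R})$, and $\theta_X$ the order of the torsion subgroup of $H_{d-1}(X;\mathbb{Z})$.
   Context: Notation. $X_k$ is the set of $k$-cells of $X$, $X^{(k)}$ its $k$-skeleton, $C_k(X;A)$ the cellular chain group (free $A$-module on $X_k$), $\partial\colon C_d(X;\mathbb{R})\to C_{d-1}(X;\mathbb{R})$ the cellular boundary, $B_k(X;A)$ the $k$-boundaries; all homology is cellular, and $\beta_k$ denotes the $k$-th Betti number. The standard inner product on $C_k(X;\mathbb{R})$ is the one for which $X_k$ is an orthonormal basis, and $\partial^*$ is the adjoint of $\partial$ with respect to the standard inner products. Spanning tree. A spanning tree for $X$ is a subcomplex $T\subset X$ such that $H_d(T;\mathbb{Z})=0$, $\beta_{d-1}(T)=\beta_{d-1}(X)$, and $X^{(d-1)}\subset T$. *)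

theory Defs
  imports "HOL-Analysis.Analysis" "HOL-Homology.Homology" "Jordan_Normal_Form.Determinant"
begin

no_notation Matrix.vec_index (infixl "$" 100)
no_notation Matrix.scalar_prod (infix "\<bullet>" 70)

section \<open>Finite CW complexes\<close>

definition disk :: "nat \<Rightarrow> (nat \<Rightarrow> real) topology" where
  "disk n = subtopology (Euclidean_space n) {x. (\<Sum>i<n. (x i)\<^sup>2) \<le> 1}"

text \<open>For \<open>n = 0\<close> the disk is a point, with empty boundary.\<close>

definition disk_boundary :: "nat \<Rightarrow> (nat \<Rightarrow> real) set" where
  "disk_boundary n = {x \<in> topspace (disk n). (\<Sum>i<n. (x i)\<^sup>2) = 1}"

definition disk_interior :: "nat \<Rightarrow> (nat \<Rightarrow> real) set" where
  "disk_interior n = {x \<in> topspace (disk n). (\<Sum>i<n. (x i)\<^sup>2) < 1}"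

text \<open>
  Cells are labelled by a set of elements of a type \<open>'c\<close>; the label \<open>e\<close> carries the dimension
  and the characteristic map \<open>disk (cw_dim X e) \<rightarrow> cw_space X\<close>.
\<close>

record ('a, 'c) cw_data =
  cw_space :: "'a topology"
  cw_cells :: "'c set"
  cw_dim :: "'c \<Rightarrow> nat"
  cw_map :: "'c \<Rightarrow> (nat \<Rightarrow> real) \<Rightarrow> 'a"

definition open_cell :: "('a, 'c) cw_data \<Rightarrow> 'c \<Rightarrow> 'a set" where
  "open_cell X e = cw_map X e ` disk_interior (cw_dim X e)"

text \<open>
  Skeleta and chain groups are indexed by integers, so that the \<open>(-1)\<close>-skeleton is empty and the
  chain group in degree \<open>-1\<close> is zero.
\<close>

definition skeleton :: "('a, 'c) cw_data \<Rightarrow> int \<Rightarrow> 'a set" where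
  "skeleton X k = (\<Union>e \<in> {e \<in> cw_cells X. int (cw_dim X e) \<le> k}. open_cell X e)"

text \<open>
  As there are only finitely many cells and the space is Hausdorff, closure finiteness and the weak
  topology are automatic.
\<close>

definition finite_CW_complex :: "('a, 'c) cw_data \<Rightarrow> bool" where
  "finite_CW_complex X \<longleftrightarrow>
     Hausdorff_space (cw_space X) \<and>
     finite (cw_cells X) \<and>
     (\<forall>e \<in> cw_cells X.
        continuous_map (disk (cw_dim X e)) (cw_space X) (cw_map X e) \<and>
        embedding_map (subtopology (disk (cw_dim X e)) (disk_interior (cw_dim X e)))
          (cw_space X) (cw_map X e) \<and>
        cw_map X e ` disk_boundary (cw_dim X e) \<subseteq> skeleton X (int (cw_dim X e) - 1)) \<and>
     disjoint_family_on (open_cell X) (cw_cells X) \<and>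
     (\<Union>e \<in> cw_cells X. open_cell X e) = topspace (cw_space X)"

definition has_dimension :: "('a, 'c) cw_data \<Rightarrow> nat \<Rightarrow> bool" where
  "has_dimension X d \<longleftrightarrow>
     (\<exists>e \<in> cw_cells X. cw_dim X e = d) \<and> (\<forall>e \<in> cw_cells X. cw_dim X e \<le> d)"

text \<open>
  A subcomplex is given by its set of cells: a union of open cells that contains the closure of
  each of its cells.
\<close>

definition subcomplex_cells :: "('a, 'c) cw_data \<Rightarrow> 'c set \<Rightarrow> bool" where
  "subcomplex_cells X S \<longleftrightarrow>
     S \<subseteq> cw_cells X \<and>
     (\<forall>e \<in> S. cw_map X e ` topspace (disk (cw_dim X e)) \<subseteq> (\<Union>e' \<in> S. open_cell X e'))"

definition subcomplex :: "('a, 'c) cw_data \<Rightarrow> 'c set \<Rightarrow> ('a, 'c) cw_data" where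
  "subcomplex X S =
     X\<lparr>cw_space := subtopology (cw_space X) (\<Union>e \<in> S. open_cell X e), cw_cells := S\<rparr>"


section \<open>The cellular chain complex\<close>

definition k_cells :: "('a, 'c) cw_data \<Rightarrow> int \<Rightarrow> 'c set" where
  "k_cells X k = {e \<in> cw_cells X. int (cw_dim X e) = k}"

definition skeleton_space :: "('a, 'c) cw_data \<Rightarrow> int \<Rightarrow> 'a topology" where
  "skeleton_space X k = subtopology (cw_space X) (skeleton X k)"

abbreviation cellular_group :: "('a, 'c) cw_data \<Rightarrow> int \<Rightarrow> 'a chain set monoid" where
  "cellular_group X k \<equiv> relative_homology_group k (skeleton_space X k) (skeleton X (k - 1))"

text \<open>
  One generator of the infinite cyclic group \<open>H\<^sub>n(D\<^sup>n, S\<^sup>n\<^sup>-\<^sup>1)\<close> is fixed for every \<open>n\<close>, so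
  that a cell is oriented by its characteristic map.
\<close>

definition disk_class :: "nat \<Rightarrow> (nat \<Rightarrow> real) chain set" where
  "disk_class n =
     (SOME g. g \<in> carrier (relative_homology_group (int n) (disk n) (disk_boundary n)) \<and>
        subgroup_generated (relative_homology_group (int n) (disk n) (disk_boundary n)) {g} =
        relative_homology_group (int n) (disk n) (disk_boundary n))"

definition cell_class :: "('a, 'c) cw_data \<Rightarrow> 'c \<Rightarrow> 'a chain set" where
  "cell_class X e =
     hom_induced (int (cw_dim X e)) (disk (cw_dim X e)) (disk_boundary (cw_dim X e))
       (skeleton_space X (int (cw_dim X e))) (skeleton X (int (cw_dim X e) - 1))
       (cw_map X e) (disk_class (cw_dim X e))"

text \<open>
  The classes of the \<open>k\<close>-cells form a basis of \<open>H\<^sub>k(X\<^sup>(\<^sup>k\<^sup>), X\<^sup>(\<^sup>k\<^sup>-\<^sup>1\<^sup>))\<close>, and the cellular boundary is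
  the boundary map of the triple \<open>(X\<^sup>(\<^sup>k\<^sup>), X\<^sup>(\<^sup>k\<^sup>-\<^sup>1\<^sup>), X\<^sup>(\<^sup>k\<^sup>-\<^sup>2\<^sup>))\<close>. The incidence numbers are
  the entries of its matrix in these bases (the groups of the homology library are written
  multiplicatively).
\<close>

definition incidence :: "('a, 'c) cw_data \<Rightarrow> 'c \<Rightarrow> 'c \<Rightarrow> int" where
  "incidence X e =
     (let k = int (cw_dim X e) in
      THE a. (\<forall>f. f \<notin> k_cells X (k - 1) \<longrightarrow> a f = 0) \<and>
        hom_relboundary k (skeleton_space X k) (skeleton X (k - 1)) (skeleton X (k - 2))
          (cell_class X e) =
        finprod (cellular_group X (k - 1))
          (\<lambda>f. cell_class X f [^]\<^bsub>cellular_group X (k - 1)\<^esub> a f) (k_cells X (k - 1)))"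

text \<open>
  \<open>C\<^sub>k(X; A)\<close> consists of the vectors in \<open>A ^ 'c\<close> supported on the \<open>k\<close>-cells. For \<open>A = \<real>\<close> the
  inner product of \<open>real ^ 'c\<close> thus restricts to the standard inner product.
\<close>

definition chains :: "('a, 'c::finite) cw_data \<Rightarrow> int \<Rightarrow> ('r::comm_ring_1 ^ 'c) set" where
  "chains X k = {x. \<forall>e. e \<notin> k_cells X k \<longrightarrow> x $ e = 0}"

text \<open>
  The boundary \<open>C\<^sub>k(X; A) \<rightarrow> C\<^sub>k\<^sub>-\<^sub>1(X; A)\<close> is extended by zero to all of \<open>A ^ 'c\<close>. For \<open>A = \<real>\<close>
  the adjoint of this extension takes values in \<open>C\<^sub>k\<close> and restricts on \<open>C\<^sub>k\<^sub>-\<^sub>1\<close> to the adjoint of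
  the boundary.
\<close>

definition bdry :: "('a, 'c::finite) cw_data \<Rightarrow> int \<Rightarrow> 'r::comm_ring_1 ^ 'c \<Rightarrow> 'r ^ 'c" where
  "bdry X k x =
     (\<chi> f. if f \<in> k_cells X (k - 1)
           then (\<Sum>e \<in> k_cells X k. of_int (incidence X e f) * x $ e) else 0)"

definition cycles :: "('a, 'c::finite) cw_data \<Rightarrow> int \<Rightarrow> ('r::comm_ring_1 ^ 'c) set" where
  "cycles X k = {x \<in> chains X k. bdry X k x = 0}"

definition boundaries :: "('a, 'c::finite) cw_data \<Rightarrow> int \<Rightarrow> ('r::comm_ring_1 ^ 'c) set" where
  "boundaries X k = bdry X (k + 1) ` chains X (k + 1)"

definition cellular_homology :: "('a, 'c::finite) cw_data \<Rightarrow> int \<Rightarrow> (int ^ 'c) set monoid" where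
  "cellular_homology X k = \<lparr>carrier = cycles X k, monoid.mult = (+), one = 0\<rparr> Mod boundaries X k"

text \<open>The rank of an abelian group: the maximal size of a linearly independent subset.\<close>

definition abelian_rank :: "'g monoid \<Rightarrow> nat" where
  "abelian_rank G =
     Sup {card S | S. finite S \<and> S \<subseteq> carrier G \<and>
       (\<forall>a :: 'g \<Rightarrow> int. finprod G (\<lambda>x. x [^]\<^bsub>G\<^esub> a x) S = \<one>\<^bsub>G\<^esub> \<longrightarrow> (\<forall>x \<in> S. a x = 0))}"

definition betti :: "('a, 'c::finite) cw_data \<Rightarrow> int \<Rightarrow> nat" where
  "betti X k = abelian_rank (cellular_homology X k)"

definition torsion_order :: "('a, 'c::finite) cw_data \<Rightarrow> int \<Rightarrow> nat" where
  "torsion_order X k =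
     (let H = cellular_homology X k in
      card {x \<in> carrier H. \<exists>n::nat. n > 0 \<and> x [^]\<^bsub>H\<^esub> n = \<one>\<^bsub>H\<^esub>})"

definition spanning_tree :: "('a, 'c::finite) cw_data \<Rightarrow> nat \<Rightarrow> 'c set \<Rightarrow> bool" where
  "spanning_tree X d S \<longleftrightarrow>
     subcomplex_cells X S \<and>
     trivial_group (cellular_homology (subcomplex X S) (int d)) \<and>
     betti (subcomplex X S) (int d - 1) = betti X (int d - 1) \<and>
     skeleton X (int d - 1) \<subseteq> topspace (cw_space (subcomplex X S))"


section \<open>Determinants and covolumes\<close>

definition subspace_basis :: "'v::euclidean_space set \<Rightarrow> 'v list \<Rightarrow> bool" where
  "subspace_basis V bs \<longleftrightarrow> distinct bs \<and> independent (set bs) \<and> span (set bs) = V"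

text \<open>The determinant of a linear endomorphism of the subspace \<open>V\<close>.\<close>

definition endo_det :: "'v::euclidean_space set \<Rightarrow> ('v \<Rightarrow> 'v) \<Rightarrow> real" where
  "endo_det V f =
     (let bs = SOME bs. subspace_basis V bs in
      Determinant.det (Matrix.mat (length bs) (length bs)
        (\<lambda>(i, j). representation (set bs) (f (bs ! j)) (bs ! i))))"

text \<open>
  Lebesgue measure on the subspace \<open>V\<close> with respect to the restricted inner product, transported
  from \<open>\<real>\<^sup>r\<close> by an orthonormal basis of \<open>V\<close>.
\<close>

definition subspace_volume :: "'v::euclidean_space set \<Rightarrow> 'v set \<Rightarrow> real" where
  "subspace_volume V P =
     (let us = SOME us. subspace_basis V us \<and> pairwise real_inner_class.orthogonal (set us) \<and>
                 (\<forall>u \<in> set us. norm u = 1) in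
      measure (\<Pi>\<^sub>M i \<in> {..<length us}. lborel)
        ((\<lambda>x. \<lambda>i \<in> {..<length us}. x \<bullet> us ! i) ` P))"

definition lattice_basis :: "'v::euclidean_space set \<Rightarrow> 'v set \<Rightarrow> 'v list \<Rightarrow> bool" where
  "lattice_basis V \<Lambda> bs \<longleftrightarrow>
     subspace_basis V bs \<and>
     \<Lambda> = {\<Sum>i<length bs. of_int (a i) *\<^sub>R bs ! i | a :: nat \<Rightarrow> int. True}"

text \<open>The covolume of the lattice \<open>\<Lambda>\<close> in \<open>V\<close> is the volume of a fundamental parallelotope.\<close>

definition covolume :: "'v::euclidean_space set \<Rightarrow> 'v set \<Rightarrow> real" where
  "covolume V \<Lambda> =
     (let bs = SOME bs. lattice_basis V \<Lambda> bs in
      subspace_volume V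
        {\<Sum>i<length bs. t i *\<^sub>R bs ! i | t :: nat \<Rightarrow> real. \<forall>i. 0 \<le> t i \<and> t i < 1})"


section \<open>The quantities attached to a complex\<close>

definition laplacian :: "('a, 'c::finite) cw_data \<Rightarrow> nat \<Rightarrow> real ^ 'c \<Rightarrow> real ^ 'c" where
  "laplacian X d x = bdry X (int d) (adjoint (bdry X (int d) :: real ^ 'c \<Rightarrow> real ^ 'c) x)"

definition boundary_lattice :: "('a, 'c::finite) cw_data \<Rightarrow> int \<Rightarrow> (real ^ 'c) set" where
  "boundary_lattice X k = (\<lambda>b :: int ^ 'c. \<chi> e. of_int (b $ e)) ` boundaries X k"

definition \<theta> :: "('a, 'c::finite) cw_data \<Rightarrow> nat \<Rightarrow> nat" where
  "\<theta> X d = torsion_order X (int d - 1)"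

definition \<mu> :: "('a, 'c::finite) cw_data \<Rightarrow> nat \<Rightarrow> real" where
  "\<mu> X d = (covolume (boundaries X (int d - 1)) (boundary_lattice X (int d - 1)))\<^sup>2"

definition \<gamma> :: "('a, 'c::finite) cw_data \<Rightarrow> nat \<Rightarrow> real" where
  "\<gamma> X d = \<mu> X d / (real (\<theta> X d))\<^sup>2"

end

theory Submission imports Defs
begin

text \<open>
  Why the formula holds. Let \<open>Z\<close> be the group of integral \<open>(d-1)\<close>-cycles of \<open>X\<close> and \<open>B\<close> its subgroup
  of boundaries, which is generated by the vectors \<open>\<partial>e\<close> for the \<open>d\<close>-cells \<open>e\<close>. The torsion of
  \<open>H\<^sub>d\<^sub>-\<^sub>1(X; \<int>) = Z / B\<close> is \<open>L / B\<close>, where \<open>L\<close> consists of the cycles that have a positive multiple in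
  \<open>B\<close>. The lattice \<open>L\<close> has a \<open>\<int>\<close>-basis \<open>c\<^sub>1, \<dots>, c\<^sub>r\<close>, which is at the same time a basis of the real
  vector space \<open>B\<^sub>d\<^sub>-\<^sub>1(X; \<real>)\<close>. Let \<open>C\<close> be the integer matrix whose column \<open>e\<close> holds the coordinates of
  \<open>\<partial>e\<close> in this basis, and \<open>G\<close> the Gram matrix of the basis.

  Since \<open>\<partial>\<partial>\<^sup>* x\<close> is the sum of the vectors \<open>\<langle>\<partial>e, x\<rangle> \<partial>e\<close>, the matrix of \<open>\<partial>\<partial>\<^sup>*\<close> in the basis \<open>c\<close> is
  \<open>C C\<^sup>T G\<close>. Hence \<open>det \<L> = det (C C\<^sup>T) det G\<close>, and the two factors are computed separately.

  The Cauchy--Binet formula gives \<open>det (C C\<^sup>T)\<close> as the sum of \<open>(det C\<^sub>E)\<^sup>2\<close> over the sets \<open>E\<close> of \<open>r\<close>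
  cells of dimension \<open>d\<close>. A subcomplex that contains the \<open>(d-1)\<close>-skeleton is given by its set \<open>E\<close> of
  \<open>d\<close>-cells; it has the same cycles \<open>Z\<close>, and its boundaries are generated by the \<open>\<partial>e\<close> with \<open>e\<close> in
  \<open>E\<close>. Its homology in degree \<open>d\<close> vanishes iff these vectors are independent, and its Betti number in
  degree \<open>d - 1\<close> is that of \<open>X\<close> iff they generate a subgroup of finite index in \<open>L\<close>. Together this means
  that \<open>E\<close> has \<open>r\<close> elements and \<open>det C\<^sub>E \<noteq> 0\<close> (\<open>basis_criterion_necessary\<close>,
  \<open>basis_criterion_sufficient\<close>, \<open>spanning_tree_iff_lattice\<close>). In that case the torsion is
  \<open>L\<close> modulo the \<open>\<partial>e\<close>, of order \<open>\<bar>det C\<^sub>E\<bar>\<close> (\<open>index_eq_abs_det\<close>). So the sum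
  is the sum of \<open>\<theta>\<^sub>T\<^sup>2\<close> over the spanning trees.

  For the other factor, a \<open>\<int>\<close>-basis of \<open>B\<close> has as coordinates in the basis \<open>c\<close> the columns of an
  integer matrix of determinant \<open>\<plusminus>[L : B] = \<plusminus>\<theta>\<^sub>X\<close>. The square of the volume of the parallelotope
  that it spans is its Gram determinant (\<open>subspace_volume_parallelotope\<close>), so
  \<open>\<mu>\<^sub>X = \<theta>\<^sub>X\<^sup>2 det G\<close>, that is, \<open>det G = \<gamma>\<^sub>X\<close>.

  The topology enters only through the incidence numbers. They are coordinates in
  \<open>H\<^sub>k(X\<^sup>(\<^sup>k\<^sup>), X\<^sup>(\<^sup>k\<^sup>-\<^sup>1\<^sup>))\<close> with respect to the classes of the \<open>k\<close>-cells, so these classes have to be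
  a basis (\<open>cell_classes_basis\<close>); this is deduced from the case of a single attached cell
  (\<open>cell_attachment_iso\<close>). Then the \<open>\<partial>e\<close> are cycles (\<open>incidence_square_zero\<close>), and a
  subcomplex that contains the \<open>(d-1)\<close>-skeleton has the incidence numbers of \<open>X\<close>
  (\<open>incidence_subcomplex\<close>).
\<close>

section \<open>Attaching a cell\<close>

lemma topspace_disk: "topspace (disk n) = {x. (\<forall>i\<ge>n. x i = 0) \<and> L2_set x {..<n} \<le> 1}"
  by (auto simp: disk_def topspace_Euclidean_space L2_set_def)

lemma disk_boundary_eq: "disk_boundary n = {x \<in> topspace (disk n). L2_set x {..<n} = 1}"
  by (auto simp: disk_boundary_def L2_set_def)

lemma disk_interior_eq: "disk_interior n = {x \<in> topspace (disk n). L2_set x {..<n} < 1}"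
  by (auto simp: disk_interior_def L2_set_def)

lemma disk_split: "topspace (disk n) = disk_interior n \<union> disk_boundary n"
  "disk_interior n \<inter> disk_boundary n = {}"
  by (auto simp: disk_interior_eq disk_boundary_eq topspace_disk)

lemma Hausdorff_disk: "Hausdorff_space (disk n)"
  unfolding disk_def by (intro Hausdorff_space_subtopology Hausdorff_Euclidean_space)

lemma continuous_map_disk_coordinate [continuous_intros]:
  "continuous_map (disk n) euclideanreal (\<lambda>x. x i)"
  unfolding disk_def Euclidean_space_def subtopology_subtopology
  by (intro continuous_map_from_subtopology continuous_map_product_projection) auto

lemma continuous_map_disk_radius [continuous_intros]:
  "continuous_map (disk n) euclideanreal (\<lambda>x. L2_set x {..<n})"
proof -
  have "continuous_map (disk n) euclideanreal (\<lambda>x. \<Sum>i<n. (x i)\<^sup>2)"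
    by (intro continuous_intros) auto
  then show ?thesis
    unfolding L2_set_def by (rule continuous_map_sqrt)
qed

lemma compact_space_disk: "compact_space (disk n)"
proof -
  let ?K = "{x :: nat \<Rightarrow> real. (\<forall>i\<ge>n. x i = 0) \<and> L2_set x {..<n} \<le> 1}"
  have eq: "disk n = subtopology (powertop_real UNIV) ?K"
    unfolding disk_def Euclidean_space_def subtopology_subtopology
    by (rule arg_cong[of _ _ "subtopology _"]) (auto simp: L2_set_def)
  have "compactin (powertop_real UNIV) (PiE UNIV (\<lambda>_::nat. {-1..1::real}))"
    by (simp add: compactin_PiE)
  moreover have "?K \<subseteq> PiE UNIV (\<lambda>_::nat. {-1..1::real})"
  proof
    fix x :: "nat \<Rightarrow> real" assume x: "x \<in> ?K"
    have *: "\<bar>x i\<bar> \<le> 1" for i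
    proof (cases "i < n")
      case True
      have "\<bar>x i\<bar> \<le> L2_set x {..<n}"
      proof -
        have "(x i)\<^sup>2 \<le> (\<Sum>i<n. (x i)\<^sup>2)"
          using True by (intro member_le_sum) auto
        then show ?thesis unfolding L2_set_def by (simp add: real_le_rsqrt)
      qed
      then show ?thesis using x by simp
    qed (use x in auto)
    have "- 1 \<le> x i \<and> x i \<le> 1" for i
      using *[of i] by auto
    then show "x \<in> PiE UNIV (\<lambda>_::nat. {-1..1::real})"
      by (simp add: PiE_iff)
  qed
  moreover have "closedin (powertop_real UNIV) ?K"
  proof -
    have c1: "continuous_map (powertop_real UNIV) euclideanreal (\<lambda>x. x i)" for i :: nat
      by (intro continuous_map_product_projection) auto
    have "continuous_map (powertop_real UNIV) euclideanreal (\<lambda>x. L2_set x {..<n})"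
      unfolding L2_set_def
      by (intro continuous_map_sqrt continuous_map_sum continuous_map_real_pow c1) auto
    then have c2: "closedin (powertop_real UNIV) {x \<in> topspace (powertop_real UNIV). L2_set x {..<n} \<in> {..1}}"
      by (rule closedin_continuous_map_preimage) auto
    have c3: "closedin (powertop_real UNIV) (topspace (Euclidean_space n))"
      by (rule closedin_Euclidean_space)
    have K: "?K = topspace (Euclidean_space n) \<inter> {x \<in> topspace (powertop_real UNIV). L2_set x {..<n} \<in> {..1}}"
      by (auto simp: topspace_Euclidean_space)
    show ?thesis unfolding K by (rule closedin_Int[OF c3 c2])
  qed
  ultimately have "compactin (powertop_real UNIV) ?K"
    by (rule closed_compactin)
  then show ?thesis
    by (simp add: eq compact_space_subtopology)
qed

text \<open>
  Radial stretching by the factor \<open>1 + t\<close>, stopped at the boundary sphere: the identity for \<open>t = 0\<close>,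
  and for \<open>t = 1\<close> it sends all points of radius above \<open>1/2\<close> to the sphere.
\<close>

definition stretch :: "nat \<Rightarrow> real \<Rightarrow> (nat \<Rightarrow> real) \<Rightarrow> nat \<Rightarrow> real" where
  "stretch n t x = (\<lambda>i. (1 + t) / max 1 ((1 + t) * L2_set x {..<n}) * x i)"

lemma L2_set_stretch:
  assumes "0 \<le> t"
  shows "L2_set (stretch n t x) {..<n} = min 1 ((1 + t) * L2_set x {..<n})"
proof -
  let ?c = "(1 + t) / max 1 ((1 + t) * L2_set x {..<n})"
  have "?c \<ge> 0" using assms by (intro divide_nonneg_nonneg) (auto simp: le_max_iff_disj)
  then have "L2_set (stretch n t x) {..<n} = ?c * L2_set x {..<n}"
    unfolding stretch_def by (rule L2_set_right_distrib[symmetric])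
  also have "\<dots> = min 1 ((1 + t) * L2_set x {..<n})"
    by (auto simp: max_def min_def)
  finally show ?thesis .
qed

lemma stretch_0: "x \<in> topspace (disk n) \<Longrightarrow> stretch n 0 x = x"
  by (auto simp: stretch_def topspace_disk max_def)

lemma stretch_boundary: "x \<in> disk_boundary n \<Longrightarrow> 0 \<le> t \<Longrightarrow> stretch n t x = x"
  by (auto simp: stretch_def disk_boundary_eq max_def)

lemma stretch_in_disk: "x \<in> topspace (disk n) \<Longrightarrow> 0 \<le> t \<Longrightarrow> stretch n t x \<in> topspace (disk n)"
  using L2_set_stretch[of t n x] by (auto simp: topspace_disk) (auto simp: stretch_def)

definition collar :: "nat \<Rightarrow> (nat \<Rightarrow> real) set" where
  "collar n = {x \<in> topspace (disk n). L2_set x {..<n} > 1/2}"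

lemma stretch_collar: 
  assumes "x \<in> collar n" "0 \<le> t" shows "stretch n t x \<in> collar n"
proof -
  have "1 / 2 < (1 + t) * L2_set x {..<n}"
    using assms mult_right_mono[of 1 "1+t" "L2_set x {..<n}"] unfolding collar_def mem_Collect_eq by linarith
  then show ?thesis
    using assms stretch_in_disk[of x n t] L2_set_stretch[of t n x] by (auto simp: collar_def)
qed

lemma stretch_1_collar: "x \<in> collar n \<Longrightarrow> stretch n 1 x \<in> disk_boundary n"
  using stretch_in_disk[of x n 1] L2_set_stretch[of 1 n x] by (auto simp: collar_def disk_boundary_eq)

lemma disk_boundary_subset_collar: "disk_boundary n \<subseteq> collar n"
  by (auto simp: disk_boundary_eq collar_def)

text \<open>The denominator in \<open>stretch\<close> is at least 1, so there is no exceptional point.\<close>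

lemma continuous_map_stretch:
  "continuous_map (prod_topology (top_of_set {0..1}) (disk n)) (disk n) (\<lambda>(t,x). stretch n t x)"
proof -
  let ?P = "prod_topology (top_of_set {0..1::real}) (disk n)"
  have t: "continuous_map ?P euclideanreal fst"
    using continuous_map_fst[of "top_of_set {0..1::real}" "disk n"] 
    by (metis continuous_map_into_fulltopology)
  have x: "continuous_map ?P euclideanreal (\<lambda>z. snd z i)" for i
    using continuous_map_compose[OF continuous_map_snd continuous_map_disk_coordinate[of n i]]
    by (simp add: o_def)
  have r: "continuous_map ?P euclideanreal (\<lambda>z. L2_set (snd z) {..<n})"
    using continuous_map_compose[OF continuous_map_snd continuous_map_disk_radius[of n]]
    by (simp add: o_def)
  have "continuous_map ?P euclideanreal (\<lambda>z. stretch n (fst z) (snd z) i)" for i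
    unfolding stretch_def
    by (intro continuous_map_real_mult continuous_map_real_divide continuous_map_real_max continuous_map_add t x r)
       (auto simp: max_def)
  then have "continuous_map ?P (powertop_real UNIV) (\<lambda>z. stretch n (fst z) (snd z))"
    by (simp add: continuous_map_componentwise_UNIV)
  moreover have "(\<lambda>z. stretch n (fst z) (snd z)) ` topspace ?P \<subseteq> topspace (disk n)"
    using stretch_in_disk by auto
  ultimately have "continuous_map ?P (subtopology (powertop_real UNIV) (topspace (disk n))) (\<lambda>z. stretch n (fst z) (snd z))"
    by (simp add: continuous_map_in_subtopology image_subset_iff_funcset)
  moreover have "subtopology (powertop_real UNIV) (topspace (disk n)) = disk n"
    unfolding disk_def Euclidean_space_def subtopology_subtopology
    by (rule arg_cong[of _ _ "subtopology _"]) auto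
  ultimately show ?thesis by (simp add: case_prod_unfold)
qed

lemma closedin_disk_image:
  assumes "Hausdorff_space Y" "continuous_map (disk n) Y f" "closedin (disk n) K"
  shows "closedin Y (f ` K)"
  by (rule compactin_imp_closedin[OF assms(1) image_compactin[OF closedin_compact_space[OF compact_space_disk assms(3)] assms(2)]])

text \<open>
  Stretching the disk fixes its boundary, so it descends to a homotopy of the space \<open>Y\<close> that arises
  from \<open>A\<close> by attaching the cell \<open>f\<close>, and this homotopy is constant on \<open>A\<close>. Continuity is the point:
  \<open>Y\<close> is the union of the closed sets \<open>A\<close> and \<open>f(D)\<close>, and \<open>[0,1] \<times> D \<rightarrow> [0,1] \<times> f(D)\<close> is a quotient map
  because it goes from a compact to a Hausdorff space.
\<close>

lemma stretch_homotopy: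
  assumes Y: "Hausdorff_space Y" and A: "closedin Y A"
    and f: "continuous_map (disk n) Y f" and inj: "inj_on f (disk_interior n)"
    and bd: "f ` disk_boundary n \<subseteq> A" and disj: "f ` disk_interior n \<inter> A = {}"
    and cover: "topspace Y = A \<union> f ` disk_interior n"
  obtains H where "continuous_map (prod_topology (top_of_set {0..1::real}) Y) Y H"
    "\<And>t y. y \<in> A \<Longrightarrow> H (t, y) = y"
    "\<And>t x. t \<in> {0..1} \<Longrightarrow> x \<in> topspace (disk n) \<Longrightarrow> H (t, f x) = f (stretch n t x)"
proof -
  let ?D = "topspace (disk n)" and ?I = "top_of_set {0..1::real}"
  let ?F = "f ` ?D"
  define H where "H = (\<lambda>(t::real, y). if y \<in> A then y else f (stretch n t (inv_into (disk_interior n) f y)))"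
  have HA: "H (t, y) = y" if "y \<in> A" for t y
    using that by (simp add: H_def)
  have Hf: "H (t, f x) = f (stretch n t x)" if "t \<in> {0..1}" "x \<in> ?D" for t x
  proof (cases "x \<in> disk_interior n")
    case True
    then have "f x \<notin> A" using disj by auto
    then show ?thesis using True inj by (simp add: H_def)
  next
    case False
    then have "x \<in> disk_boundary n" using that disk_split(1) by blast
    then show ?thesis using that bd HA[of "f x" t] by (auto simp: stretch_boundary)
  qed
  have F: "closedin Y ?F"
    by (rule closedin_disk_image[OF Y f]) auto
  \<comment> \<open>On the closed cell \<open>H\<close> is induced by the stretching of the disk via the quotient map \<open>q\<close>.\<close>
  have contF: "continuous_map (prod_topology ?I (subtopology Y ?F)) Y H"
  proof -
    define q where "q = (\<lambda>(t::real, x). (t, f x))"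
    have f': "continuous_map (disk n) (subtopology Y ?F) f"
      using f by (simp add: continuous_map_in_subtopology)
    have q: "continuous_map (prod_topology ?I (disk n)) (prod_topology ?I (subtopology Y ?F)) q"
    proof -
      have "continuous_map (prod_topology ?I (disk n)) (subtopology Y ?F) (\<lambda>z. f (snd z))"
        using continuous_map_compose[OF continuous_map_snd f'] by (simp add: o_def)
      then show ?thesis
        unfolding q_def by (simp add: case_prod_unfold continuous_map_pairwise o_def continuous_map_fst)
    qed
    have "closed_map (prod_topology ?I (disk n)) (prod_topology ?I (subtopology Y ?F)) q"
    proof (rule continuous_imp_closed_map_gen[OF _ _ q])
      show "compact_space (prod_topology ?I (disk n))"
        by (simp add: compact_space_prod_topology compact_space_disk compact_space_subtopology)
      show "kc_space (prod_topology ?I (subtopology Y ?F))"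
        by (intro Hausdorff_imp_kc_space)
           (simp add: Hausdorff_space_prod_topology Hausdorff_space_subtopology Y)
    qed
    moreover have "q ` topspace (prod_topology ?I (disk n)) = topspace (prod_topology ?I (subtopology Y ?F))"
      using continuous_map_image_subset_topspace[OF f] unfolding q_def by (auto simp: image_iff)
    ultimately have "quotient_map (prod_topology ?I (disk n)) (prod_topology ?I (subtopology Y ?F)) q"
      using q continuous_closed_quotient_map by blast
    moreover have "continuous_map (prod_topology ?I (disk n)) Y (H \<circ> q)"
    proof (rule continuous_map_eq)
      show "continuous_map (prod_topology ?I (disk n)) Y (f \<circ> (\<lambda>(t,x). stretch n t x))"
        by (rule continuous_map_compose[OF continuous_map_stretch f])
      show "(f \<circ> (\<lambda>(t,x). stretch n t x)) z = (H \<circ> q) z" if "z \<in> topspace (prod_topology ?I (disk n))" for z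
        using that Hf by (auto simp: q_def)
    qed
    ultimately show ?thesis by (rule continuous_compose_quotient_map)
  qed
  have "continuous_map (prod_topology ?I Y) Y H"
  proof (rule pasting_lemma_closed[where I = "UNIV :: bool set"])
    let ?T = "\<lambda>b. {0..1} \<times> (if b then A else ?F)"
    let ?g = "\<lambda>b. if b then snd else H"
    show "closedin (prod_topology ?I Y) (?T b)" for b
      using A F by (auto simp: closedin_prod_Times_iff)
    show "continuous_map (subtopology (prod_topology ?I Y) (?T b)) Y (?g b)" for b
    proof (cases b)
      case True
      then show ?thesis by (simp add: continuous_map_from_subtopology continuous_map_snd)
    next
      case False
      have "subtopology (prod_topology ?I Y) ({0..1} \<times> ?F) = prod_topology ?I (subtopology Y ?F)"
        by (simp add: subtopology_Times subtopology_subtopology)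
      then show ?thesis using False contF by simp
    qed
    show "?g i x = ?g j x" if "x \<in> topspace (prod_topology ?I Y) \<inter> ?T i \<inter> ?T j" for i j x
      using that HA by (cases i; cases j) auto
    show "\<exists>j. j \<in> UNIV \<and> x \<in> ?T j \<and> H x = ?g j x" if "x \<in> topspace (prod_topology ?I Y)" for x
    proof (cases "snd x \<in> A")
      case True
      then show ?thesis using that HA[of "snd x" "fst x"] by (intro exI[of _ True]) (auto simp: mem_Times_iff)
    next
      case False
      then show ?thesis using that cover disk_split(1) by (intro exI[of _ False]) auto
    qed
  qed auto
  then show ?thesis using HA Hf that by blast
qed

text \<open>
  The stretch homotopy deforms \<open>Y\<close> so that the collar of the cell ends in \<open>A\<close>, and it maps both \<open>A\<close>
  and \<open>A \<union> f(collar)\<close> to themselves throughout. Its final stage is therefore a homotopy inverse of the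
  inclusion of pairs \<open>(Y, A) \<rightarrow> (Y, A \<union> f(collar))\<close>. The enlarged set is a neighbourhood of \<open>A\<close>, which
  makes excision applicable.
\<close>

lemma enlarge_by_collar_iso:
  assumes Y: "Hausdorff_space Y" and A: "closedin Y A"
    and f: "continuous_map (disk n) Y f" and inj: "inj_on f (disk_interior n)"
    and bd: "f ` disk_boundary n \<subseteq> A" and disj: "f ` disk_interior n \<inter> A = {}"
    and cover: "topspace Y = A \<union> f ` disk_interior n"
  shows "hom_induced p Y A Y (A \<union> f ` collar n) id
     \<in> iso (relative_homology_group p Y A) (relative_homology_group p Y (A \<union> f ` collar n))"
proof -
  obtain H where H: "continuous_map (prod_topology (top_of_set {0..1::real}) Y) Y H"
    and HA: "\<And>t y. y \<in> A \<Longrightarrow> H (t, y) = y"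
    and Hf: "\<And>t x. t \<in> {0..1} \<Longrightarrow> x \<in> topspace (disk n) \<Longrightarrow> H (t, f x) = f (stretch n t x)"
    using stretch_homotopy[OF assms] by metis
  let ?B = "A \<union> f ` collar n"
  let ?g = "\<lambda>y. H (1, y)"
  have D: "x \<in> topspace (disk n)" if "x \<in> collar n" for x
    using that by (simp add: collar_def)
  have g: "continuous_map Y Y ?g"
    using continuous_map_compose[OF _ H, of Y "\<lambda>y. (1, y)"]
    by (simp add: o_def continuous_map_pairwise)
  have H0: "H (0, y) = y" if y: "y \<in> topspace Y" for y
  proof (cases "y \<in> A")
    case False
    then obtain x where "x \<in> disk_interior n" "y = f x" using y cover by auto
    then show ?thesis using Hf[of 0 x] stretch_0[of x n] disk_split(1) by auto
  qed (use HA in auto)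
  have HB: "H (t, y) \<in> ?B" if "t \<in> {0..1}" "y \<in> ?B" for t y
    using that HA Hf D stretch_collar by auto
  have "?B \<subseteq> topspace Y"
    using cover continuous_map_image_subset_topspace[OF f] D by blast
  then have ext: "topspace Y \<inter> ?B = ?B" "topspace Y \<inter> A = A" using cover by auto
  have hom: "homotopic_with (\<lambda>h. h \<in> S \<rightarrow> S) Y Y ?g id"
    if S: "S \<subseteq> topspace Y" and P: "\<And>t y. t \<in> {0..1} \<Longrightarrow> y \<in> S \<Longrightarrow> H (t, y) \<in> S" for S
  proof (rule homotopic_with_symD)
    show "homotopic_with (\<lambda>h. h \<in> S \<rightarrow> S) Y Y id ?g"
    proof (subst homotopic_with, goal_cases)
      case (1 h k)
      then have "\<forall>x\<in>S. h x = k x" using S by blast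
      then show ?case by (simp add: Pi_iff)
    next
      case 2
      then show ?case using H H0 P by (intro exI[of _ H]) auto
    qed
  qed
  have "hom_induced p Y A Y ?B id \<in> iso (relative_homology_group p Y A) (relative_homology_group p Y ?B)"
  proof (rule homotopy_equivalence_relative_homology_group_isomorphism)
    show "continuous_map Y Y ?g" by (rule g)
    show "?g \<in> ?B \<rightarrow> A"
      using HA Hf[of 1] D stretch_1_collar bd by auto
    show "homotopic_with (\<lambda>h. h \<in> A \<rightarrow> A) Y Y (?g \<circ> id) id"
      using hom[of A] HA cover by auto
    show "homotopic_with (\<lambda>h. h \<in> ?B \<rightarrow> ?B) Y Y (id \<circ> ?g) id"
      using hom[of ?B] HB \<open>?B \<subseteq> topspace Y\<close> by (auto simp: o_def)
  qed auto
  then show ?thesis .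
qed

text \<open>
  The set \<open>A\<close> is excised from the pair \<open>(Y, A \<union> f(collar))\<close>. This is allowed because
  \<open>A \<union> f(collar)\<close> is the complement of the image of the compact disk of radius \<open>1/2\<close>, hence open.
  What remains lies in the open cell, where \<open>f\<close> is a homeomorphism.
\<close>

lemma excise_closed_part_iso:
  assumes Y: "Hausdorff_space Y" and A: "closedin Y A"
    and f: "continuous_map (disk n) Y f" and inj: "inj_on f (disk_interior n)"
    and bd: "f ` disk_boundary n \<subseteq> A" and disj: "f ` disk_interior n \<inter> A = {}"
    and cover: "topspace Y = A \<union> f ` disk_interior n"
  shows "hom_induced p (subtopology Y (f ` disk_interior n)) (f ` (collar n \<inter> disk_interior n)) Y (A \<union> f ` collar n) id
     \<in> iso (relative_homology_group p (subtopology Y (f ` disk_interior n)) (f ` (collar n \<inter> disk_interior n)))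
           (relative_homology_group p Y (A \<union> f ` collar n))"
proof -
  let ?B = "A \<union> f ` collar n"
  let ?K = "{x \<in> topspace (disk n). L2_set x {..<n} \<in> {..1/2}}"
  have "closedin (disk n) ?K"
    by (rule closedin_continuous_map_preimage[OF continuous_map_disk_radius]) auto
  then have K: "closedin Y (f ` ?K)"
    by (rule closedin_disk_image[OF Y f])
  have Ki: "?K \<subseteq> disk_interior n" by (auto simp: disk_interior_eq)
  have c: "collar n - disk_interior n \<subseteq> disk_boundary n" "collar n \<subseteq> topspace (disk n)"
    using disk_split(1) by (auto simp: collar_def)
  have ic: "disk_interior n = (collar n \<inter> disk_interior n) \<union> ?K"
    by (auto simp: collar_def disk_interior_eq)
  have "?B = topspace Y - f ` ?K"
  proof
    show "?B \<subseteq> topspace Y - f ` ?K"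
    proof
      fix y assume y: "y \<in> ?B"
      show "y \<in> topspace Y - f ` ?K"
      proof (cases "y \<in> A")
        case True
        then show ?thesis using cover Ki disj by blast
      next
        case False
        then obtain x where x: "x \<in> collar n" "y = f x" using y by auto
        then have xi: "x \<in> disk_interior n" using False bd c by blast
        have "x \<notin> ?K" using x by (simp add: collar_def)
        then have "f x \<notin> f ` ?K" using xi Ki inj by (meson inj_on_image_mem_iff)
        moreover have "f x \<in> topspace Y" using xi cover by simp
        ultimately show ?thesis using x(2) by simp
      qed
    qed
    show "topspace Y - f ` ?K \<subseteq> ?B" using cover ic by blast
  qed
  then have B: "openin Y ?B" using K by auto
  have "hom_induced p (subtopology Y (topspace Y - A)) (?B - A) (subtopology Y (topspace Y)) ?B id
      \<in> iso (relative_homology_group p (subtopology Y (topspace Y - A)) (?B - A))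
          (relative_homology_group p (subtopology Y (topspace Y)) ?B)"
  proof (rule homology_excision_axiom)
    show "Y closure_of A \<subseteq> Y interior_of ?B"
      using A B by (simp add: closure_of_closedin interior_of_openin)
    show "?B \<subseteq> topspace Y" using B openin_subset by blast
  qed
  moreover have "topspace Y - A = f ` disk_interior n" using cover disj by auto
  moreover have "?B - A = f ` (collar n \<inter> disk_interior n)"
    using bd disj c by blast
  ultimately show ?thesis by simp
qed

text \<open>
  Both the pair \<open>(D, S)\<close> of the disk and its boundary and the pair \<open>(Y, A)\<close> are compared with the open
  disk relative to its collar: enlarge the subspace by the collar, then excise the original subspace.
  For \<open>(D, S)\<close> this is the case of the identity map of \<open>D\<close>, as \<open>D\<close> arises from \<open>S\<close> by attaching a cell.
  On the open disk \<open>f\<close> is a homeomorphism, so the two comparisons prove the claim by diagram chase.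
\<close>

lemma cell_attachment_iso:
  assumes Y: "Hausdorff_space Y" and A: "closedin Y A"
    and f: "continuous_map (disk n) Y f" 
    and emb: "embedding_map (subtopology (disk n) (disk_interior n)) Y f"
    and bd: "f ` disk_boundary n \<subseteq> A" and disj: "f ` disk_interior n \<inter> A = {}"
    and cover: "topspace Y = A \<union> f ` disk_interior n"
  shows "hom_induced p (disk n) (disk_boundary n) Y A f
     \<in> iso (relative_homology_group p (disk n) (disk_boundary n)) (relative_homology_group p Y A)"
proof -
  let ?D = "disk n" and ?S = "disk_boundary n" and ?i = "disk_interior n" and ?c = "collar n"
  let ?Di = "subtopology ?D ?i" and ?ci = "collar n \<inter> disk_interior n"
  let ?Yi = "subtopology Y (f ` ?i)"
  have iD: "?i \<subseteq> topspace ?D" using disk_split by blast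
  have inj: "inj_on f ?i"
    using emb iD by (auto simp: embedding_map_def homeomorphic_map_def injective_quotient_map homeomorphic_eq_everything_map Int_absorb1)
  have S: "closedin ?D ?S"
  proof -
    have "?S = {x \<in> topspace ?D. L2_set x {..<n} \<in> {1}}" by (auto simp: disk_boundary_eq)
    moreover have "closedin ?D \<dots>"
      by (rule closedin_continuous_map_preimage[OF continuous_map_disk_radius]) auto
    ultimately show ?thesis by simp
  qed
  have cS: "?S \<union> id ` collar n = collar n" using disk_boundary_subset_collar by auto
  have D1: "hom_induced p ?D ?S ?D ?c id \<in> iso (relative_homology_group p ?D ?S) (relative_homology_group p ?D ?c)"
    using enlarge_by_collar_iso[OF Hausdorff_disk S, of n id p] disk_split[of n] cS by auto
  have D2: "hom_induced p ?Di ?ci ?D ?c id \<in> iso (relative_homology_group p ?Di ?ci) (relative_homology_group p ?D ?c)"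
    using excise_closed_part_iso[OF Hausdorff_disk S, of n id p] disk_split[of n] cS by auto
  have Y1: "hom_induced p Y A Y (A \<union> f ` ?c) id \<in> iso (relative_homology_group p Y A) (relative_homology_group p Y (A \<union> f ` ?c))"
    by (rule enlarge_by_collar_iso[OF Y A f inj bd disj cover])
  have Y2: "hom_induced p ?Yi (f ` ?ci) Y (A \<union> f ` ?c) id \<in> iso (relative_homology_group p ?Yi (f ` ?ci)) (relative_homology_group p Y (A \<union> f ` ?c))"
    by (rule excise_closed_part_iso[OF Y A f inj bd disj cover])
  have fi: "homeomorphic_map ?Di ?Yi f"
    using emb iD by (simp add: embedding_map_def Int_absorb1)
  have f2: "hom_induced p ?Di ?ci ?Yi (f ` ?ci) f \<in> iso (relative_homology_group p ?Di ?ci) (relative_homology_group p ?Yi (f ` ?ci))"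
    by (rule homeomorphic_map_relative_homology_iso[OF fi]) (use iD in auto)
  \<comment> \<open>The map induced by \<open>f\<close> on the enlarged pairs fits into two commutative squares, one with the
    excision isomorphisms and one with the enlargement isomorphisms.\<close>
  let ?m = "hom_induced p ?D ?c Y (A \<union> f ` ?c) f"
  have sq2: "?m \<circ> hom_induced p ?Di ?ci ?D ?c id = hom_induced p ?Yi (f ` ?ci) Y (A \<union> f ` ?c) id \<circ> hom_induced p ?Di ?ci ?Yi (f ` ?ci) f"
  proof -
    have "?m \<circ> hom_induced p ?Di ?ci ?D ?c id = hom_induced p ?Di ?ci Y (A \<union> f ` ?c) (f \<circ> id)"
      by (rule hom_induced_compose[symmetric]) (use f in auto)
    moreover have "hom_induced p ?Yi (f ` ?ci) Y (A \<union> f ` ?c) id \<circ> hom_induced p ?Di ?ci ?Yi (f ` ?ci) f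
      = hom_induced p ?Di ?ci Y (A \<union> f ` ?c) (id \<circ> f)"
      by (rule hom_induced_compose[symmetric]) (use homeomorphic_imp_continuous_map[OF fi] in auto)
    ultimately show ?thesis by simp
  qed
  have sq1: "?m \<circ> hom_induced p ?D ?S ?D ?c id = hom_induced p Y A Y (A \<union> f ` ?c) id \<circ> hom_induced p ?D ?S Y A f"
  proof -
    have "?m \<circ> hom_induced p ?D ?S ?D ?c id = hom_induced p ?D ?S Y (A \<union> f ` ?c) (f \<circ> id)"
      by (rule hom_induced_compose[symmetric]) (use f disk_boundary_subset_collar[of n] in auto)
    moreover have "hom_induced p Y A Y (A \<union> f ` ?c) id \<circ> hom_induced p ?D ?S Y A f
      = hom_induced p ?D ?S Y (A \<union> f ` ?c) (id \<circ> f)"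
      by (rule hom_induced_compose[symmetric]) (use f bd in auto)
    ultimately show ?thesis by simp
  qed
  have m: "bij_betw ?m (carrier (relative_homology_group p ?D ?c)) (carrier (relative_homology_group p Y (A \<union> f ` ?c)))"
  proof -
    have "bij_betw (?m \<circ> hom_induced p ?Di ?ci ?D ?c id) (carrier (relative_homology_group p ?Di ?ci)) (carrier (relative_homology_group p Y (A \<union> f ` ?c)))"
      unfolding sq2
      by (rule bij_betw_trans[where B = "carrier (relative_homology_group p ?Yi (f ` ?ci))"])
         (use f2 Y2 in \<open>simp_all add: iso_def\<close>)
    then show ?thesis
      using D2 by (subst bij_betw_comp_iff[of "hom_induced p ?Di ?ci ?D ?c id"]) (simp_all add: iso_def)
  qed
  have "bij_betw (hom_induced p Y A Y (A \<union> f ` ?c) id \<circ> hom_induced p ?D ?S Y A f) 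
     (carrier (relative_homology_group p ?D ?S)) (carrier (relative_homology_group p Y (A \<union> f ` ?c)))"
    unfolding sq1[symmetric] by (rule bij_betw_trans[OF _ m]) (use D1 in \<open>simp add: iso_def\<close>)
  then have "bij_betw (hom_induced p ?D ?S Y A f) (carrier (relative_homology_group p ?D ?S)) (carrier (relative_homology_group p Y A))"
    by (subst bij_betw_comp_iff2[where f' = "hom_induced p Y A Y (A \<union> f ` ?c) id"])
       (use Y1 in \<open>auto simp add: iso_def hom_induced_carrier\<close>)
  then show ?thesis by (simp add: iso_def hom_induced_hom)
qed

section \<open>The homology of a disk relative to its boundary\<close>

lemma contractible_disk: "contractible_space (disk n)"
proof -
  let ?P = "prod_topology (top_of_set {0..1::real}) (disk n)"
  let ?h = "\<lambda>(t::real, x). (\<lambda>i::nat. (1 - t) * x i)"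
  have t: "continuous_map ?P euclideanreal fst"
    using continuous_map_fst[of "top_of_set {0..1::real}" "disk n"] 
    by (metis continuous_map_into_fulltopology)
  have x: "continuous_map ?P euclideanreal (\<lambda>z. snd z i)" for i
    using continuous_map_compose[OF continuous_map_snd continuous_map_disk_coordinate[of n i]]
    by (simp add: o_def)
  have "continuous_map ?P euclideanreal (\<lambda>z. (1 - fst z) * snd z i)" for i
    by (intro continuous_map_real_mult continuous_map_diff t x) auto
  then have 1: "continuous_map ?P (powertop_real UNIV) ?h"
    by (simp add: continuous_map_componentwise_UNIV case_prod_unfold)
  have 2: "?h z \<in> topspace (disk n)" if z: "z \<in> topspace ?P" for z
  proof -
    obtain t x where tx: "z = (t, x)" "0 \<le> t" "t \<le> 1" "x \<in> topspace (disk n)" using z by auto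
    have "L2_set (\<lambda>i. (1 - t) * x i) {..<n} = (1 - t) * L2_set x {..<n}"
      using tx by (simp add: L2_set_right_distrib)
    also have "\<dots> \<le> 1" using tx by (intro mult_le_one) (auto simp: topspace_disk)
    finally show ?thesis using tx by (auto simp: topspace_disk)
  qed
  have "continuous_map ?P (subtopology (powertop_real UNIV) (topspace (disk n))) ?h"
    using 1 2 by (simp add: continuous_map_in_subtopology image_subset_iff Pi_iff)
  moreover have "subtopology (powertop_real UNIV) (topspace (disk n)) = disk n"
    unfolding disk_def Euclidean_space_def subtopology_subtopology
    by (rule arg_cong[of _ _ "subtopology _"]) auto
  ultimately have "continuous_map ?P (disk n) ?h" by simp
  then show ?thesis
    unfolding contractible_space_def homotopic_with_def
    by (intro exI[of _ "\<lambda>_. 0"] exI[of _ ?h]) auto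
qed

text \<open>
  The disk is contractible, so the boundary map to the reduced homology of the sphere is an
  isomorphism. In dimension 0 there is no sphere; there the disk is a point with empty boundary.
\<close>

lemma relative_homology_disk: "relative_homology_group (int n) (disk n) (disk_boundary n) \<cong> integer_group"
proof (cases n)
  case 0
  have "topspace (disk 0) = {\<lambda>_. 0}" by (auto simp: topspace_disk)
  moreover have "disk_boundary 0 = {}" by (auto simp: disk_boundary_def)
  ultimately show ?thesis using 0 homology_coefficients by auto
next
  case (Suc m)
  have sph: "subtopology (disk n) (disk_boundary n) = nsphere m"
    unfolding disk_def nsphere_def disk_boundary_def Euclidean_space_def subtopology_subtopology Suc
    by (rule arg_cong[of _ _ "subtopology _"]) (auto simp: topspace_Euclidean_space lessThan_Suc_atMost)
  have "(\<lambda>i. if i = 0 then 1 else 0) \<in> topspace (nsphere m)"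
    using in_topspace_nsphere by simp
  then have "topspace (disk n) \<inter> disk_boundary n \<noteq> {}"
    unfolding sph[symmetric] topspace_subtopology by blast
  then have "relative_homology_group (int n) (disk n) (disk_boundary n) \<cong> reduced_homology_group (int n - 1) (nsphere m)"
    using isomorphic_group_relative_homology_of_contractible[OF contractible_disk] sph by metis
  moreover have "reduced_homology_group (int n - 1) (nsphere m) \<cong> integer_group"
    using reduced_homology_group_nsphere(1)[of m] Suc by simp
  ultimately show ?thesis by (rule iso_trans)
qed

text \<open>
  The class chosen by \<open>disk_class\<close> exists because the group is infinite cyclic, and it has infinite
  order because its image in \<open>\<int>\<close> generates \<open>\<int>\<close>.
\<close>

lemma disk_class:
  defines "G \<equiv> \<lambda>n. relative_homology_group (int n) (disk n) (disk_boundary n)"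
  shows disk_class_closed: "disk_class n \<in> carrier (G n)"
    and disk_class_generates: "x \<in> carrier (G n) \<Longrightarrow> \<exists>k::int. x = disk_class n [^]\<^bsub>G n\<^esub> k"
    and disk_class_infinite_order: "disk_class n [^]\<^bsub>G n\<^esub> (k::int) = \<one>\<^bsub>G n\<^esub> \<Longrightarrow> k = 0"
proof -
  interpret G: group "G n" by (simp add: G_def)
  have iso: "G n \<cong> integer_group" unfolding G_def by (rule relative_homology_disk)
  then have "cyclic_group (G n)"
    using isomorphic_group_cyclicity[OF iso] by simp
  then have ex: "\<exists>g. g \<in> carrier (G n) \<and> subgroup_generated (G n) {g} = G n"
    by (auto simp: cyclic_group_def)
  have dc: "disk_class n \<in> carrier (G n)" "subgroup_generated (G n) {disk_class n} = G n"
    using someI_ex[OF ex] unfolding disk_class_def G_def by auto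
  show "disk_class n \<in> carrier (G n)" by (rule dc)
  have rng: "carrier (G n) = range (\<lambda>k::int. disk_class n [^]\<^bsub>G n\<^esub> k)"
    using G.carrier_subgroup_generated_by_singleton[OF dc(1)] dc(2) by simp
  show "x \<in> carrier (G n) \<Longrightarrow> \<exists>k::int. x = disk_class n [^]\<^bsub>G n\<^esub> k"
    using rng by auto
  obtain h where h: "h \<in> iso (G n) integer_group" using iso by (auto simp: is_iso_def)
  then have hh: "h \<in> hom (G n) integer_group" and surj: "h ` carrier (G n) = UNIV"
    by (auto simp: iso_def bij_betw_def)
  have pw: "h (disk_class n [^]\<^bsub>G n\<^esub> k) = k * h (disk_class n)" for k :: int
    using hom_int_pow[OF hh dc(1)] by simp
  obtain x where "x \<in> carrier (G n)" "h x = 1" using surj by (metis UNIV_I imageE)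
  then obtain j where "j * h (disk_class n) = 1" using rng pw by auto
  then have nz: "h (disk_class n) \<noteq> 0" by auto
  assume k: "disk_class n [^]\<^bsub>G n\<^esub> (k::int) = \<one>\<^bsub>G n\<^esub>"
  have "k * h (disk_class n) = 0"
    using pw[of k] k hom_one[OF hh] by simp
  then show "k = 0" using nz by simp
qed

section \<open>Integer combinations in an abelian group\<close>

text \<open>
  The homology groups are written multiplicatively, so the combination of the elements \<open>c f\<close> with
  the coefficients \<open>a f\<close> is a product of powers.
\<close>

definition int_comb :: "('g, 'm) monoid_scheme \<Rightarrow> ('i \<Rightarrow> 'g) \<Rightarrow> ('i \<Rightarrow> int) \<Rightarrow> 'i set \<Rightarrow> 'g" where
  "int_comb G c a S = finprod G (\<lambda>f. c f [^]\<^bsub>G\<^esub> a f) S"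

context comm_group begin

lemma int_comb_closed: "c \<in> S \<rightarrow> carrier G \<Longrightarrow> int_comb G c a S \<in> carrier G"
  unfolding int_comb_def by (rule finprod_closed) auto

lemma int_comb_empty [simp]: "int_comb G c a {} = \<one>"
  by (simp add: int_comb_def)

lemma int_comb_insert:
  "finite S \<Longrightarrow> f \<notin> S \<Longrightarrow> c \<in> insert f S \<rightarrow> carrier G \<Longrightarrow> 
    int_comb G c a (insert f S) = c f [^] a f \<otimes> int_comb G c a S"
  unfolding int_comb_def by (rule finprod_insert) auto

lemma int_comb_add:
  "c \<in> S \<rightarrow> carrier G \<Longrightarrow> int_comb G c (\<lambda>f. a f + b f) S = int_comb G c a S \<otimes> int_comb G c b S"
proof -
  assume c: "c \<in> S \<rightarrow> carrier G"
  then have "int_comb G c (\<lambda>f. a f + b f) S = finprod G (\<lambda>f. c f [^] a f \<otimes> c f [^] b f) S"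
    unfolding int_comb_def by (intro finprod_cong') (auto simp: Pi_iff int_pow_mult)
  also have "\<dots> = int_comb G c a S \<otimes> int_comb G c b S"
    unfolding int_comb_def using c by (intro finprod_multf) auto
  finally show ?thesis .
qed

lemma int_comb_pow:
  assumes "finite S" "c \<in> S \<rightarrow> carrier G"
  shows "int_comb G c a S [^] (k::int) = int_comb G c (\<lambda>f. a f * k) S"
  using assms
proof (induction S)
  case (insert f S)
  then have "c f \<in> carrier G" "int_comb G c a S \<in> carrier G" by (auto intro: int_comb_closed)
  then show ?case using insert by (simp add: int_comb_insert int_pow_distrib int_pow_pow)
qed simp

lemma int_comb_0: "c \<in> S \<rightarrow> carrier G \<Longrightarrow> int_comb G c (\<lambda>_. 0) S = \<one>"
  by (simp add: int_comb_def)

lemma int_comb_cong: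
  "c' \<in> S \<rightarrow> carrier G \<Longrightarrow> (\<And>f. f \<in> S \<Longrightarrow> c f = c' f) \<Longrightarrow> (\<And>f. f \<in> S \<Longrightarrow> a f = b f) 
    \<Longrightarrow> int_comb G c a S = int_comb G c' b S"
  unfolding int_comb_def by (rule finprod_cong') auto

lemma int_comb_int_comb:
  assumes "finite S" "finite T" "c \<in> T \<rightarrow> carrier G"
  shows "int_comb G (\<lambda>f. int_comb G c (m f) T) a S = int_comb G c (\<lambda>g. \<Sum>f\<in>S. m f g * a f) T"
  using assms(1)
proof (induction S)
  case empty
  then show ?case using assms by (simp add: int_comb_0)
next
  case (insert f S)
  have "int_comb G (\<lambda>f. int_comb G c (m f) T) a (insert f S) 
      = int_comb G c (m f) T [^] a f \<otimes> int_comb G (\<lambda>f. int_comb G c (m f) T) a S"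
    using insert assms by (intro int_comb_insert) (auto intro: int_comb_closed)
  also have "\<dots> = int_comb G c (\<lambda>g. m f g * a f) T \<otimes> int_comb G c (\<lambda>g. \<Sum>f\<in>S. m f g * a f) T"
    using insert assms by (simp add: int_comb_pow)
  also have "\<dots> = int_comb G c (\<lambda>g. \<Sum>f\<in>insert f S. m f g * a f) T"
    using insert assms by (simp add: int_comb_add[symmetric])
  finally show ?case .
qed

end

lemma hom_int_comb:
  assumes h: "h \<in> hom G H" and G: "comm_group G" and H: "comm_group H"
    and "finite S" "c \<in> S \<rightarrow> carrier G"
  shows "h (int_comb G c a S) = int_comb H (h \<circ> c) a S"
  using assms(4,5)
proof (induction S)
  case empty
  then show ?case using h G H by (simp add: comm_group.int_comb_empty hom_one comm_group.axioms)
next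
  case (insert f S)
  interpret G: comm_group G by fact
  interpret H: comm_group H by fact
  have c: "c f \<in> carrier G" "c \<in> S \<rightarrow> carrier G" using insert by auto
  have "h (int_comb G c a (insert f S)) = h (c f [^]\<^bsub>G\<^esub> a f) \<otimes>\<^bsub>H\<^esub> h (int_comb G c a S)"
    using insert c h by (simp add: G.int_comb_insert hom_mult G.int_comb_closed)
  also have "\<dots> = h (c f) [^]\<^bsub>H\<^esub> a f \<otimes>\<^bsub>H\<^esub> int_comb H (h \<circ> c) a S"
    using insert c h by (simp add: hom_int_pow o_def)
  also have "\<dots> = int_comb H (h \<circ> c) a (insert f S)"
    using insert h by (subst H.int_comb_insert) (auto simp: hom_def)
  finally show ?case .
qed

section \<open>The cellular groups and the incidence numbers\<close>

locale finite_CW =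
  fixes X :: "('a, 'c) cw_data"
  assumes CW: "finite_CW_complex X"
begin

lemma finite_cells: "finite (cw_cells X)"
  and Hausdorff: "Hausdorff_space (cw_space X)"
  and cw_map_continuous: "e \<in> cw_cells X \<Longrightarrow> continuous_map (disk (cw_dim X e)) (cw_space X) (cw_map X e)"
  and cw_map_embedding: "e \<in> cw_cells X \<Longrightarrow> 
    embedding_map (subtopology (disk (cw_dim X e)) (disk_interior (cw_dim X e))) (cw_space X) (cw_map X e)"
  and cw_map_boundary: "e \<in> cw_cells X \<Longrightarrow> 
    cw_map X e ` disk_boundary (cw_dim X e) \<subseteq> skeleton X (int (cw_dim X e) - 1)"
  and open_cells_disjoint: "e \<in> cw_cells X \<Longrightarrow> e' \<in> cw_cells X \<Longrightarrow> e \<noteq> e' \<Longrightarrow> open_cell X e \<inter> open_cell X e' = {}"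
  and open_cells_cover: "(\<Union>e \<in> cw_cells X. open_cell X e) = topspace (cw_space X)"
  using CW unfolding finite_CW_complex_def disjoint_family_on_def by auto

lemma finite_k_cells: "finite (k_cells X k)"
  using finite_cells by (auto simp: k_cells_def)

lemma skeleton_Suc: "skeleton X k = skeleton X (k - 1) \<union> (\<Union>e\<in>k_cells X k. open_cell X e)"
  unfolding skeleton_def k_cells_def by force

lemma skeleton_mono: "j \<le> k \<Longrightarrow> skeleton X j \<subseteq> skeleton X k"
  unfolding skeleton_def by force

lemma skeleton_subset: "skeleton X k \<subseteq> topspace (cw_space X)"
  using open_cells_cover unfolding skeleton_def by blast

lemma closed_cell:
  assumes "e \<in> cw_cells X"
  shows "cw_map X e ` topspace (disk (cw_dim X e)) \<subseteq> skeleton X (int (cw_dim X e) - 1) \<union> open_cell X e"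
    "open_cell X e \<subseteq> cw_map X e ` topspace (disk (cw_dim X e))"
    "closedin (cw_space X) (cw_map X e ` topspace (disk (cw_dim X e)))"
  subgoal
    using cw_map_boundary[OF assms] unfolding open_cell_def disk_split(1) by blast
  subgoal
    unfolding open_cell_def disk_split(1) by blast
  subgoal
    by (rule closedin_disk_image[OF Hausdorff cw_map_continuous[OF assms]]) auto
  done

text \<open>
  The \<open>(k-1)\<close>-skeleton together with a set \<open>J\<close> of \<open>k\<close>-cells. These spaces interpolate between two
  successive skeleta, so that the \<open>k\<close>-cells can be attached one at a time.
\<close>

definition part :: "int \<Rightarrow> 'c set \<Rightarrow> 'a set" where
  "part k J = skeleton X (k - 1) \<union> (\<Union>e\<in>J. open_cell X e)"

lemma part_all: "part k (k_cells X k) = skeleton X k"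
  unfolding part_def skeleton_Suc[of k] ..

lemma part_empty [simp]: "part k {} = skeleton X (k - 1)"
  by (simp add: part_def)

lemma part_insert: "part k (insert e J) = part k J \<union> open_cell X e"
  by (auto simp: part_def)

lemma part_subset: "J \<subseteq> k_cells X k \<Longrightarrow> part k J \<subseteq> topspace (cw_space X)"
  using open_cells_cover skeleton_subset unfolding part_def k_cells_def by blast

lemma closed_cells_closed:
  assumes "finite J" "J \<subseteq> cw_cells X"
  shows "closedin (cw_space X) (\<Union>e\<in>J. cw_map X e ` topspace (disk (cw_dim X e)))"
proof (rule closedin_Union)
  show "finite ((\<lambda>e. cw_map X e ` topspace (disk (cw_dim X e))) ` J)" using assms by simp
  fix S assume "S \<in> (\<lambda>e. cw_map X e ` topspace (disk (cw_dim X e))) ` J"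
  then obtain e where "e \<in> J" "S = cw_map X e ` topspace (disk (cw_dim X e))" by (rule imageE)
  then show "closedin (cw_space X) S" using closed_cell(3)[of e] assms(2) by auto
qed

text \<open>
  The union of the open cells is also the union of their closures, which are finitely many compact
  images of disks.
\<close>

lemma closed_skeleton: "closedin (cw_space X) (skeleton X k)"
proof -
  let ?C = "{e \<in> cw_cells X. int (cw_dim X e) \<le> k}"
  have "skeleton X k = (\<Union>e\<in>?C. cw_map X e ` topspace (disk (cw_dim X e)))"
  proof
    show "skeleton X k \<subseteq> (\<Union>e\<in>?C. cw_map X e ` topspace (disk (cw_dim X e)))"
      unfolding skeleton_def using closed_cell(2) by blast
    have "cw_map X e ` topspace (disk (cw_dim X e)) \<subseteq> skeleton X k" if "e \<in> ?C" for e
      using that closed_cell(1)[of e] skeleton_mono[of "int (cw_dim X e) - 1" k] unfolding skeleton_def by auto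
    then show "(\<Union>e\<in>?C. cw_map X e ` topspace (disk (cw_dim X e))) \<subseteq> skeleton X k" by blast
  qed
  moreover have "closedin (cw_space X) \<dots>"
    using finite_cells by (intro closed_cells_closed) auto
  ultimately show ?thesis by simp
qed

lemma cell_in_part:
  assumes "J \<subseteq> k_cells X k" "e \<in> J"
  shows "cw_map X e ` topspace (disk (cw_dim X e)) \<subseteq> part k J"
  using assms closed_cell(1)[of e] unfolding part_def k_cells_def by auto

lemma closed_part:
  assumes "J \<subseteq> k_cells X k"
  shows "closedin (cw_space X) (part k J)"
proof -
  have J: "J \<subseteq> cw_cells X" "finite J" using assms finite_k_cells finite_subset by (auto simp: k_cells_def)
  have "part k J = skeleton X (k - 1) \<union> (\<Union>e\<in>J. cw_map X e ` topspace (disk (cw_dim X e)))"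
  proof
    have "open_cell X e \<subseteq> cw_map X e ` topspace (disk (cw_dim X e))" if "e \<in> J" for e
      using closed_cell(2) that J by blast
    then show "part k J \<subseteq> skeleton X (k - 1) \<union> (\<Union>e\<in>J. cw_map X e ` topspace (disk (cw_dim X e)))"
      unfolding part_def by fast
    show "skeleton X (k - 1) \<union> (\<Union>e\<in>J. cw_map X e ` topspace (disk (cw_dim X e))) \<subseteq> part k J"
      using cell_in_part[OF assms] by (intro Un_least UN_least) (auto simp: part_def)
  qed
  moreover have "closedin (cw_space X) \<dots>"
    by (rule closedin_Un[OF closed_skeleton closed_cells_closed[OF J(2,1)]])
  ultimately show ?thesis by simp
qed

lemma open_cell_disjoint_part:
  assumes "e \<in> k_cells X k" "J \<subseteq> k_cells X k" "e \<notin> J"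
  shows "open_cell X e \<inter> part k J = {}"
proof -
  have "open_cell X e \<inter> open_cell X e' = {}" if "e' \<in> J" for e'
    using that assms open_cells_disjoint[of e e'] by (auto simp: k_cells_def)
  moreover have "open_cell X e \<inter> skeleton X (k - 1) = {}"
    using assms open_cells_disjoint[of e] unfolding skeleton_def k_cells_def by fastforce
  ultimately show ?thesis unfolding part_def by blast
qed

lemma attach_cell_iso:
  assumes e: "e \<in> k_cells X k" and J: "J \<subseteq> k_cells X k" "e \<notin> J"
  shows "hom_induced p (disk (cw_dim X e)) (disk_boundary (cw_dim X e)) 
      (subtopology (cw_space X) (part k (insert e J))) (part k J) (cw_map X e)
    \<in> iso (relative_homology_group p (disk (cw_dim X e)) (disk_boundary (cw_dim X e)))
        (relative_homology_group p (subtopology (cw_space X) (part k (insert e J))) (part k J))"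
proof (rule cell_attachment_iso)
  let ?n = "cw_dim X e" and ?Y = "subtopology (cw_space X) (part k (insert e J))"
  have ec: "e \<in> cw_cells X" and k: "k = int ?n" using e by (auto simp: k_cells_def)
  have eJ: "insert e J \<subseteq> k_cells X k" using e J by simp
  have im: "cw_map X e ` topspace (disk ?n) \<subseteq> part k (insert e J)"
    by (rule cell_in_part[OF eJ]) simp
  show "Hausdorff_space ?Y" by (rule Hausdorff_space_subtopology[OF Hausdorff])
  show "closedin ?Y (part k J)"
    by (rule closedin_subset_topspace[OF closed_part[OF J(1)]]) (auto simp: part_insert)
  show "continuous_map (disk ?n) ?Y (cw_map X e)"
    using cw_map_continuous[OF ec] im by (auto simp: continuous_map_in_subtopology)
  show "embedding_map (subtopology (disk ?n) (disk_interior ?n)) ?Y (cw_map X e)"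
    unfolding embedding_map_in_subtopology using cw_map_embedding[OF ec] im by auto
  show "cw_map X e ` disk_boundary ?n \<subseteq> part k J"
    using cw_map_boundary[OF ec] k by (auto simp: part_def)
  show "cw_map X e ` disk_interior ?n \<inter> part k J = {}"
    using open_cell_disjoint_part[OF e J] by (simp add: open_cell_def)
  show "topspace ?Y = part k J \<union> cw_map X e ` disk_interior ?n"
    using part_subset[OF eJ] part_insert[of k e J] by (auto simp: open_cell_def)
qed

definition part_class :: "int \<Rightarrow> 'c set \<Rightarrow> 'c \<Rightarrow> 'a chain set" where
  "part_class k J e = hom_induced k (disk (cw_dim X e)) (disk_boundary (cw_dim X e))
     (subtopology (cw_space X) (part k J)) (skeleton X (k - 1)) (cw_map X e) (disk_class (cw_dim X e))"

lemma cw_map_part: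
  assumes "J \<subseteq> k_cells X k" "e \<in> J"
  shows "continuous_map (disk (cw_dim X e)) (subtopology (cw_space X) (part k J)) (cw_map X e)"
    "cw_map X e \<in> disk_boundary (cw_dim X e) \<rightarrow> skeleton X (k - 1)"
proof -
  have e: "e \<in> cw_cells X" "k = int (cw_dim X e)" using assms by (auto simp: k_cells_def)
  show "continuous_map (disk (cw_dim X e)) (subtopology (cw_space X) (part k J)) (cw_map X e)"
    using cw_map_continuous e cell_in_part[OF assms] by (auto simp: continuous_map_in_subtopology)
  show "cw_map X e \<in> disk_boundary (cw_dim X e) \<rightarrow> skeleton X (k - 1)"
    using cw_map_boundary[of e] e by auto
qed

text \<open>
  A map of pairs on \<open>part k J\<close> is evaluated on the class of a cell by composing it with the
  characteristic map; in particular inclusions of parts and of pairs preserve cell classes.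
\<close>

lemma hom_induced_part_class:
  assumes "J \<subseteq> J'" "J' \<subseteq> k_cells X k" "e \<in> J"
    "f \<in> skeleton X (k - 1) \<rightarrow> B" "continuous_map (subtopology (cw_space X) (part k J)) Y f"
  shows "hom_induced k (subtopology (cw_space X) (part k J)) (skeleton X (k - 1)) Y B f (part_class k J e)
    = hom_induced k (disk (cw_dim X e)) (disk_boundary (cw_dim X e)) Y B (f \<circ> cw_map X e) (disk_class (cw_dim X e))"
  unfolding part_class_def using assms by (intro hom_induced_compose' cw_map_part) auto

text \<open>
  Induction on the number of cells. When the cell \<open>e\<close> is added to \<open>J\<close>, the group of the pair
  \<open>(part (J \<union> {e}), part J)\<close> is infinite cyclic and generated by the image of the class of \<open>e\<close>. So
  every element becomes trivial there after a multiple of this class has been subtracted, and by the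
  exact sequence of the triple it then comes from the group of \<open>J\<close>.
\<close>

lemma part_classes_generate:
  assumes "finite J" "J \<subseteq> k_cells X k"
    "x \<in> carrier (relative_homology_group k (subtopology (cw_space X) (part k J)) (skeleton X (k - 1)))"
  shows "\<exists>a. x = int_comb (relative_homology_group k (subtopology (cw_space X) (part k J)) (skeleton X (k - 1))) (part_class k J) a J"
  using assms
proof (induction J arbitrary: x)
  case empty
  let ?G = "relative_homology_group k (subtopology (cw_space X) (part k {})) (skeleton X (k - 1))"
  have "trivial_group ?G"
    using trivial_relative_homology_group_topspace[of k "subtopology (cw_space X) (part k {})"]
      skeleton_subset[of "k - 1"] by (simp add: Int_absorb1)
  then have "x = \<one>\<^bsub>?G\<^esub>" using empty by (simp add: trivial_group_def)
  then show ?case by (simp add: comm_group.int_comb_empty)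
next
  case (insert e J)
  let ?A = "skeleton X (k - 1)" and ?B = "part k J"
  let ?Y = "subtopology (cw_space X) (part k (insert e J))" and ?Z = "subtopology (cw_space X) (part k J)"
  let ?GA = "relative_homology_group k ?Y ?A" and ?GB = "relative_homology_group k ?Y ?B"
  let ?GZ = "relative_homology_group k ?Z ?A"
  let ?q = "hom_induced k ?Y ?A ?Y ?B id" and ?i = "hom_induced k ?Z ?A ?Y ?A id"
  let ?c = "part_class k (insert e J)"
  interpret GA: comm_group ?GA by simp
  interpret GB: comm_group ?GB by simp
  interpret GZ: comm_group ?GZ by simp
  have e: "e \<in> k_cells X k" and J: "J \<subseteq> k_cells X k" and k: "k = int (cw_dim X e)" 
    using insert by (auto simp: k_cells_def)
  have ZY: "subtopology ?Y ?B = ?Z"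
    by (simp add: subtopology_subtopology part_insert Int_absorb1)
  have AB: "?A \<subseteq> ?B" by (auto simp: part_def)
  have c: "?c f \<in> carrier ?GA" for f
    by (simp add: part_class_def hom_induced_carrier)
  have cZ: "part_class k J f \<in> carrier ?GZ" for f
    by (simp add: part_class_def hom_induced_carrier)
  have qc: "?q (?c e) = hom_induced k (disk (cw_dim X e)) (disk_boundary (cw_dim X e)) ?Y ?B (cw_map X e) (disk_class (cw_dim X e))"
  proof -
    have "id \<in> ?A \<rightarrow> ?B" using AB by (simp add: id_def subset_iff)
    then have "?q (?c e) = hom_induced k (disk (cw_dim X e)) (disk_boundary (cw_dim X e)) ?Y ?B (id \<circ> cw_map X e) (disk_class (cw_dim X e))"
      using insert.prems(1) by (intro hom_induced_part_class[OF order_refl]) simp_all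
    then show ?thesis by simp
  qed
  have hq: "?q \<in> hom ?GA ?GB" and hi: "?i \<in> hom ?GZ ?GA"
    by (simp_all add: hom_induced_hom)
  have iso: "hom_induced k (disk (cw_dim X e)) (disk_boundary (cw_dim X e)) ?Y ?B (cw_map X e)
      \<in> iso (relative_homology_group k (disk (cw_dim X e)) (disk_boundary (cw_dim X e))) ?GB"
    by (rule attach_cell_iso[OF e J insert.hyps(2)])
  let ?C = "carrier (relative_homology_group k (disk (cw_dim X e)) (disk_boundary (cw_dim X e)))"
  have "?q x \<in> hom_induced k (disk (cw_dim X e)) (disk_boundary (cw_dim X e)) ?Y ?B (cw_map X e) ` ?C"
    using iso by (simp add: iso_def bij_betw_def hom_induced_carrier)
  then obtain w where "?q x = hom_induced k (disk (cw_dim X e)) (disk_boundary (cw_dim X e)) ?Y ?B (cw_map X e) w" "w \<in> ?C"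
    by (rule imageE)
  note w = this(2) this(1)[symmetric]
  obtain m :: int where m: "w = disk_class (cw_dim X e) [^]\<^bsub>relative_homology_group k (disk (cw_dim X e)) (disk_boundary (cw_dim X e))\<^esub> m"
    using disk_class_generates[of w "cw_dim X e"] w(1) unfolding k by fast
  have "?q x = ?q (?c e) [^]\<^bsub>?GB\<^esub> m"
    unfolding w(2)[symmetric] m qc using hom_int_pow[OF hom_induced_hom] disk_class_closed[of "cw_dim X e"] k by simp
  then have qx: "?q x = ?q (?c e [^]\<^bsub>?GA\<^esub> m)"
    using hom_int_pow[OF hq c] by simp
  \<comment> \<open>What is left of \<open>x\<close> after its component along \<open>e\<close> has been split off.\<close>
  let ?y = "x \<otimes>\<^bsub>?GA\<^esub> inv\<^bsub>?GA\<^esub> (?c e [^]\<^bsub>?GA\<^esub> m)"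
  have x: "x \<in> carrier ?GA" by fact
  have y: "?y \<in> carrier ?GA" using x c by simp
  have "?q ?y = \<one>\<^bsub>?GB\<^esub>"
    using hom_mult[OF hq x] group_hom.hom_inv[of ?GA ?GB ?q "?c e [^]\<^bsub>?GA\<^esub> m"] hq c qx hom_in_carrier[OF hq x]
    by (simp add: group_hom_def group_hom_axioms_def)
  then have "?y \<in> kernel ?GA ?GB ?q" using y by (simp add: kernel_def)
  also have "\<dots> = ?i ` carrier ?GZ"
    using homology_exactness_triple_3[OF AB, of k ?Y] unfolding ZY by simp
  finally obtain z where z: "z \<in> carrier ?GZ" "?y = ?i z" by blast
  obtain a where a: "z = int_comb ?GZ (part_class k J) a J"
    using insert.IH[OF J z(1)] by blast
  have "?i z = int_comb ?GA (?i \<circ> part_class k J) a J"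
    unfolding a by (rule hom_int_comb[OF hi]) (use cZ insert in auto)
  also have "\<dots> = int_comb ?GA ?c a J"
  proof (rule GA.int_comb_cong)
    fix f assume f: "f \<in> J"
    have "?i (part_class k J f) = hom_induced k (disk (cw_dim X f)) (disk_boundary (cw_dim X f)) ?Y ?A (id \<circ> cw_map X f) (disk_class (cw_dim X f))"
      using J f insert by (intro hom_induced_part_class[of J "insert e J"]) (auto simp: continuous_map_in_subtopology continuous_map_from_subtopology part_insert)
    then show "(?i \<circ> part_class k J) f = ?c f" by (simp add: part_class_def)
  qed (use c in auto)
  finally have iz: "?y = int_comb ?GA ?c a J" using z by simp
  have "x = ?c e [^]\<^bsub>?GA\<^esub> m \<otimes>\<^bsub>?GA\<^esub> ?y"
    using x c[of e] by (simp add: GA.m_comm[of _ ?y] GA.m_assoc)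
  also have "?y = int_comb ?GA ?c (a(e := m)) J"
    unfolding iz by (rule GA.int_comb_cong) (use c insert in auto)
  also have "?c e [^]\<^bsub>?GA\<^esub> m \<otimes>\<^bsub>?GA\<^esub> int_comb ?GA ?c (a(e := m)) J = int_comb ?GA ?c (a(e := m)) (insert e J)"
    using GA.int_comb_insert[OF insert.hyps(1,2), of ?c "a(e := m)"] c by (simp add: Pi_iff)
  finally show ?case by blast
qed

lemma cellular_group_part: "cellular_group X k = relative_homology_group k (subtopology (cw_space X) (part k (k_cells X k))) (skeleton X (k - 1))"
  by (simp add: part_all skeleton_space_def)

lemma cell_class_part: "e \<in> k_cells X k \<Longrightarrow> cell_class X e = part_class k (k_cells X k) e"
proof -
  assume "e \<in> k_cells X k"
  then have k: "int (cw_dim X e) = k" by (simp add: k_cells_def)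
  show ?thesis unfolding cell_class_def part_class_def part_all skeleton_space_def k ..
qed

lemma cell_class_closed: "e \<in> k_cells X k \<Longrightarrow> cell_class X e \<in> carrier (cellular_group X k)"
  unfolding cell_class_part cellular_group_part by (simp add: part_class_def hom_induced_carrier)

text \<open>
  Passing to homology relative to the complement of the open cell \<open>e\<close> in the \<open>k\<close>-skeleton kills the classes of all other
  \<open>k\<close>-cells, as these lie in that complement, and is injective on the multiples of the class of \<open>e\<close>.
  A relation thus becomes the statement that the multiple \<open>a e\<close> of a generator of an infinite
  cyclic group is trivial.
\<close>

lemma cell_classes_independent:
  assumes 1: "int_comb (cellular_group X k) (cell_class X) a (k_cells X k) = \<one>\<^bsub>cellular_group X k\<^esub>"
    and e: "e \<in> k_cells X k"
  shows "a e = 0"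
proof -
  let ?K = "k_cells X k" and ?A = "skeleton X (k - 1)"
  let ?J = "?K - {e}"
  let ?B = "part k ?J"
  let ?Y = "subtopology (cw_space X) (part k ?K)"
  let ?GA = "relative_homology_group k ?Y ?A" and ?GB = "relative_homology_group k ?Y ?B"
  let ?q = "hom_induced k ?Y ?A ?Y ?B id"
  let ?H = "relative_homology_group k (disk (cw_dim X e)) (disk_boundary (cw_dim X e))"
  let ?h = "hom_induced k (disk (cw_dim X e)) (disk_boundary (cw_dim X e)) ?Y ?B (cw_map X e)"
  let ?c = "part_class k ?K"
  interpret GA: comm_group ?GA by simp
  interpret GB: comm_group ?GB by simp
  have k: "k = int (cw_dim X e)" using e by (simp add: k_cells_def)
  have c: "?c f \<in> carrier ?GA" for f
    by (simp add: part_class_def hom_induced_carrier)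
  have hq: "?q \<in> hom ?GA ?GB" by (simp add: hom_induced_hom)
  have AB: "id \<in> ?A \<rightarrow> ?B" by (simp add: part_def)
  have "part k (insert e ?J) = part k ?K" using e by (simp add: insert_absorb)
  then have iso: "?h \<in> iso ?H ?GB"
    using attach_cell_iso[OF e, of ?J k] by simp
  have qf: "?q (?c f) = hom_induced k (disk (cw_dim X f)) (disk_boundary (cw_dim X f)) ?Y ?B (cw_map X f) (disk_class (cw_dim X f))"
    if "f \<in> ?K" for f
    using hom_induced_part_class[OF order_refl order_refl that AB, of ?Y] by simp
  \<comment> \<open>The class of such an \<open>f\<close> factors through the trivial group \<open>H\<^sub>k(B, B)\<close>.\<close>
  have trivial: "?q (?c f) = \<one>\<^bsub>?GB\<^esub>" if f: "f \<in> ?J" for f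
  proof -
    let ?Z = "subtopology (cw_space X) ?B"
    let ?n = "cw_dim X f"
    have sub: "part k ?J \<subseteq> part k ?K" by (auto simp: part_def)
    let ?u = "hom_induced k (disk ?n) (disk_boundary ?n) ?Z ?B (cw_map X f) (disk_class ?n)"
    have cm: "continuous_map (disk ?n) ?Z (cw_map X f)" "cw_map X f \<in> disk_boundary ?n \<rightarrow> ?B"
      using cw_map_part[of ?J k f] f AB by (auto simp: Pi_iff)
    have "hom_induced k (disk ?n) (disk_boundary ?n) ?Y ?B (id \<circ> cw_map X f) (disk_class ?n)
      = hom_induced k ?Z ?B ?Y ?B id ?u"
      by (rule hom_induced_compose'[symmetric])
         (use cm sub in \<open>auto simp: continuous_map_in_subtopology\<close>)
    moreover have "trivial_group (relative_homology_group k ?Z ?B)"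
      using trivial_relative_homology_group_topspace[of k ?Z] part_subset[of ?J k] by (simp add: Int_absorb1)
    then have "?u = \<one>\<^bsub>relative_homology_group k ?Z ?B\<^esub>"
      using hom_induced_carrier by (fastforce simp: trivial_group_def)
    ultimately show ?thesis
      using qf[of f] f hom_one[OF hom_induced_hom[of k ?Z ?B ?Y ?B id]] by simp
  qed
  have 1: "int_comb ?GA ?c a ?K = \<one>\<^bsub>?GA\<^esub>"
  proof -
    have "int_comb ?GA (cell_class X) a ?K = int_comb ?GA ?c a ?K"
      by (rule GA.int_comb_cong) (use c cell_class_part in auto)
    then show ?thesis using 1 by (simp add: cellular_group_part)
  qed
  have "\<one>\<^bsub>?GB\<^esub> = ?q (int_comb ?GA ?c a ?K)"
    unfolding 1 by (rule hom_one[OF hq, symmetric]) simp_all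
  also have "\<dots> = int_comb ?GB (?q \<circ> ?c) a ?K"
    by (rule hom_int_comb[OF hq]) (use c finite_k_cells in auto)
  also have "\<dots> = int_comb ?GB (?q \<circ> ?c) a (insert e ?J)"
    using e by (simp add: insert_absorb)
  also have "\<dots> = (?q \<circ> ?c) e [^]\<^bsub>?GB\<^esub> a e \<otimes>\<^bsub>?GB\<^esub> int_comb ?GB (?q \<circ> ?c) a ?J"
    by (rule GB.int_comb_insert) (use finite_k_cells hom_induced_carrier in auto)
  also have "int_comb ?GB (?q \<circ> ?c) a ?J = int_comb ?GB (\<lambda>_. \<one>\<^bsub>?GB\<^esub>) (\<lambda>_. 0) ?J"
    unfolding int_comb_def by (rule GB.finprod_cong') (use trivial in auto)
  also have "\<dots> = \<one>\<^bsub>?GB\<^esub>" by (rule GB.int_comb_0) auto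
  also have "(?q \<circ> ?c) e [^]\<^bsub>?GB\<^esub> a e \<otimes>\<^bsub>?GB\<^esub> \<one>\<^bsub>?GB\<^esub> = ?q (?c e) [^]\<^bsub>?GB\<^esub> a e"
    unfolding o_def by (intro GB.r_one GB.int_pow_closed hom_induced_carrier)
  also have "\<dots> = ?h (disk_class (cw_dim X e) [^]\<^bsub>?H\<^esub> a e)"
    unfolding qf[OF e] using disk_class_closed[of "cw_dim X e"] k
    by (subst hom_int_pow[OF hom_induced_hom]) simp_all
  finally have *: "?h (disk_class (cw_dim X e) [^]\<^bsub>?H\<^esub> a e) = \<one>\<^bsub>?GB\<^esub>" by simp
  moreover have "?h \<one>\<^bsub>?H\<^esub> = \<one>\<^bsub>?GB\<^esub>" by (rule hom_one[OF hom_induced_hom]) simp_all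
  moreover have "disk_class (cw_dim X e) [^]\<^bsub>?H\<^esub> a e \<in> carrier ?H"
    using disk_class_closed[of "cw_dim X e"] k by (intro group.int_pow_closed) simp_all
  moreover have "\<one>\<^bsub>?H\<^esub> \<in> carrier ?H" by (rule monoid.one_closed) (simp add: group.is_monoid)
  ultimately have "disk_class (cw_dim X e) [^]\<^bsub>?H\<^esub> a e = \<one>\<^bsub>?H\<^esub>"
    using iso by (metis (no_types, lifting) bij_betw_imp_inj_on inj_onD iso_def mem_Collect_eq)
  then show ?thesis
    using disk_class_infinite_order[of "cw_dim X e" "a e"] k by simp
qed

text \<open>
  This is the fact that turns the definite description in the definition of the incidence numbers
  into a usable characterisation.
\<close>

lemma cell_classes_basis:
  assumes "x \<in> carrier (cellular_group X k)"
  shows "\<exists>!a. (\<forall>f. f \<notin> k_cells X k \<longrightarrow> a f = 0) \<and> x = int_comb (cellular_group X k) (cell_class X) a (k_cells X k)"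
proof -
  let ?K = "k_cells X k" and ?G = "cellular_group X k"
  interpret G: comm_group ?G by simp
  have c: "cell_class X \<in> ?K \<rightarrow> carrier ?G" using cell_class_closed by auto
  obtain a where a: "x = int_comb ?G (part_class k ?K) a ?K"
    using part_classes_generate[OF finite_k_cells order_refl] assms unfolding cellular_group_part by blast
  let ?a = "\<lambda>f. if f \<in> ?K then a f else 0"
  have x: "x = int_comb ?G (cell_class X) ?a ?K"
    unfolding a by (rule G.int_comb_cong) (use c cell_class_part in auto)
  have "b = b'" if b: "\<forall>f. f \<notin> ?K \<longrightarrow> b f = 0" "x = int_comb ?G (cell_class X) b ?K"
    and b': "\<forall>f. f \<notin> ?K \<longrightarrow> b' f = 0" "x = int_comb ?G (cell_class X) b' ?K" for b b'
  proof -
    have "int_comb ?G (cell_class X) (\<lambda>f. (b f - b' f) + b' f) ?K = int_comb ?G (cell_class X) b ?K"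
      by simp
    then have "int_comb ?G (cell_class X) (\<lambda>f. b f - b' f) ?K \<otimes>\<^bsub>?G\<^esub> x = x"
      unfolding G.int_comb_add[OF c] using b b' by simp
    then have 1: "int_comb ?G (cell_class X) (\<lambda>f. b f - b' f) ?K = \<one>\<^bsub>?G\<^esub>"
      using G.right_cancel[OF assms G.int_comb_closed[OF c] G.one_closed] assms by simp
    have "b f = b' f" for f
      using cell_classes_independent[OF 1, of f] b b' by (cases "f \<in> ?K") auto
    then show ?thesis by auto
  qed
  then show ?thesis using x by (intro ex1I[of _ ?a]) auto
qed

lemma incidence:
  assumes e: "e \<in> k_cells X k"
  shows "hom_relboundary k (skeleton_space X k) (skeleton X (k - 1)) (skeleton X (k - 2)) (cell_class X e) =
     int_comb (cellular_group X (k - 1)) (cell_class X) (incidence X e) (k_cells X (k - 1))"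
    and incidence_outside: "f \<notin> k_cells X (k - 1) \<Longrightarrow> incidence X e f = 0"
proof -
  have k: "int (cw_dim X e) = k" using e by (simp add: k_cells_def)
  let ?x = "hom_relboundary k (skeleton_space X k) (skeleton X (k - 1)) (skeleton X (k - 2)) (cell_class X e)"
  have "subtopology (skeleton_space X k) (skeleton X (k - 1)) = skeleton_space X (k - 1)"
    using skeleton_mono[of "k - 1" k] by (simp add: skeleton_space_def subtopology_subtopology Int_absorb1)
  then have "?x \<in> carrier (cellular_group X (k - 1))"
    using hom_relboundary[of k "skeleton_space X k" "skeleton X (k - 1)" "skeleton X (k - 2)"] by simp
  from theI'[OF cell_classes_basis[OF this]]
  have "(\<forall>f. f \<notin> k_cells X (k - 1) \<longrightarrow> incidence X e f = 0) \<and>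
     ?x = int_comb (cellular_group X (k - 1)) (cell_class X) (incidence X e) (k_cells X (k - 1))"
    unfolding incidence_def Let_def k int_comb_def by simp
  then show "?x = int_comb (cellular_group X (k - 1)) (cell_class X) (incidence X e) (k_cells X (k - 1))"
    and "f \<notin> k_cells X (k - 1) \<Longrightarrow> incidence X e f = 0" by auto
qed

text \<open>
  The boundary map of a triple is the boundary map of a pair followed by the passage to relative
  homology. In the composite of two of them the middle two maps are consecutive in the exact sequence
  of the pair \<open>(Z, T)\<close>.
\<close>

lemma hom_relboundary_twice:
  assumes "c \<in> carrier (relative_homology_group k Y S)" "subtopology Y S = Z"
  shows "hom_relboundary (k - 1) Z T U (hom_relboundary k Y S T c) 
    = \<one>\<^bsub>relative_homology_group (k - 2) (subtopology Z T) U\<^esub>"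
proof -
  let ?b = "hom_boundary k Y S c"
  have b: "?b \<in> carrier (homology_group (k - 1) Z)"
    using hom_boundary_carrier[of k Y S c] assms by simp
  have "hom_boundary (k - 1) Z T (hom_induced (k - 1) Z {} Z T id ?b) = \<one>\<^bsub>homology_group (k - 1 - 1) (subtopology Z T)\<^esub>"
  proof -
    have "hom_induced (k - 1) Z {} Z T id ?b \<in> hom_induced (k - 1) Z {} Z T id ` carrier (homology_group (k - 1) Z)"
      using b by blast
    also have "\<dots> = kernel (relative_homology_group (k - 1) Z T) (homology_group (k - 1 - 1) (subtopology Z T)) (hom_boundary (k - 1) Z T)"
      using homology_exactness_axiom_1[of "k - 1" Z T] by simp
    finally show ?thesis unfolding kernel_def by blast
  qed
  then show ?thesis
    unfolding hom_relboundary_def using assms(2)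
    by (simp add: hom_one[OF hom_induced_hom] diff_diff_eq)
qed

text \<open>
  The matrix of a composite is the product of the matrices, and the composite of two cellular
  boundaries vanishes; the coefficients of a combination of cell classes are unique.
\<close>

lemma incidence_square_zero:
  assumes e: "e \<in> k_cells X k" and g: "g \<in> k_cells X (k - 2)"
  shows "(\<Sum>f\<in>k_cells X (k - 1). incidence X f g * incidence X e f) = 0"
proof -
  let ?d = "hom_relboundary (k - 1) (skeleton_space X (k - 1)) (skeleton X (k - 2)) (skeleton X (k - 3))"
  let ?F = "k_cells X (k - 1)" and ?G1 = "cellular_group X (k - 1)" and ?G2 = "cellular_group X (k - 2)"
  interpret G2: comm_group ?G2 by simp
  have sub: "subtopology (skeleton_space X j) (skeleton X (j - 1)) = skeleton_space X (j - 1)" for j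
    using skeleton_mono[of "j - 1" j] by (simp add: skeleton_space_def subtopology_subtopology Int_absorb1)
  have d: "?d \<in> hom ?G1 ?G2"
    using group_homomorphism_hom_relboundary[of "k - 1" "skeleton_space X (k - 1)" "skeleton X (k - 2)" "skeleton X (k - 3)"]
      sub[of "k - 1"] by simp
  have c2: "cell_class X \<in> k_cells X (k - 2) \<rightarrow> carrier ?G2"
    by (rule Pi_I) (rule cell_class_closed)
  have df: "?d (cell_class X f) = int_comb ?G2 (cell_class X) (incidence X f) (k_cells X (k - 2))" if "f \<in> ?F" for f
    using incidence(1)[OF that] by simp
  have "\<one>\<^bsub>?G2\<^esub> = ?d (hom_relboundary k (skeleton_space X k) (skeleton X (k - 1)) (skeleton X (k - 2)) (cell_class X e))"
    using hom_relboundary_twice[OF cell_class_closed[OF e] sub, of "skeleton X (k - 2)" "skeleton X (k - 3)"] sub[of "k - 1"]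
    by simp
  also have "\<dots> = ?d (int_comb ?G1 (cell_class X) (incidence X e) ?F)"
    unfolding incidence(1)[OF e] ..
  also have "\<dots> = int_comb ?G2 (?d \<circ> cell_class X) (incidence X e) ?F"
    by (rule hom_int_comb[OF d _ _ finite_k_cells]) (simp, simp, rule Pi_I, rule cell_class_closed)
  also have "\<dots> = int_comb ?G2 (\<lambda>f. int_comb ?G2 (cell_class X) (incidence X f) (k_cells X (k - 2))) (incidence X e) ?F"
    by (rule G2.int_comb_cong) (use df G2.int_comb_closed[OF c2] in auto)
  also have "\<dots> = int_comb ?G2 (cell_class X) (\<lambda>g. \<Sum>f\<in>?F. incidence X f g * incidence X e f) (k_cells X (k - 2))"
    by (rule G2.int_comb_int_comb[OF finite_k_cells finite_k_cells c2])
  finally have "\<one>\<^bsub>?G2\<^esub> = int_comb ?G2 (cell_class X) (\<lambda>g. \<Sum>f\<in>?F. incidence X f g * incidence X e f) (k_cells X (k - 2))" .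
  from cell_classes_independent[OF this[symmetric] g] show ?thesis .
qed

end

section \<open>Subcomplexes that contain the \<open>(d-1)\<close>-skeleton\<close>

lemma subcomplex_simps [simp]:
  "cw_cells (subcomplex X S) = S" "cw_dim (subcomplex X S) = cw_dim X" "cw_map (subcomplex X S) = cw_map X"
  "cw_space (subcomplex X S) = subtopology (cw_space X) (\<Union>e \<in> S. open_cell X e)"
  "open_cell (subcomplex X S) = open_cell X"
  by (simp_all add: subcomplex_def open_cell_def fun_eq_iff)

text \<open>
  A subcomplex that differs from \<open>X\<close> only in its set of \<open>d\<close>-cells. Below dimension \<open>d\<close> the two
  complexes have the same skeleta, as sets and as spaces.
\<close>

locale top_cells_removed = finite_CW X for X :: "('a, 'c) cw_data" +
  fixes d :: nat and S :: "'c set"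
  assumes dim_le: "e \<in> cw_cells X \<Longrightarrow> cw_dim X e \<le> d"
    and S_subset: "S \<subseteq> cw_cells X"
    and lower_cells: "e \<in> cw_cells X \<Longrightarrow> cw_dim X e < d \<Longrightarrow> e \<in> S"
begin

abbreviation "T \<equiv> subcomplex X S"

lemma k_cells_lower: "k < int d \<Longrightarrow> k_cells T k = k_cells X k"
  using S_subset lower_cells by (auto simp: k_cells_def)

lemma k_cells_top: "k_cells T (int d) = S \<inter> k_cells X (int d)"
  using S_subset by (auto simp: k_cells_def)

lemma skeleton_lower: "k < int d \<Longrightarrow> skeleton T k = skeleton X k"
proof -
  assume "k < int d"
  then have "{e \<in> S. int (cw_dim X e) \<le> k} = {e \<in> cw_cells X. int (cw_dim X e) \<le> k}"
    using S_subset lower_cells by auto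
  then show ?thesis by (simp add: skeleton_def)
qed

lemma skeleton_subcomplex_subset: "skeleton T k \<subseteq> (\<Union>e\<in>S. open_cell X e)" "skeleton T k \<subseteq> skeleton X k"
  using S_subset by (auto simp: skeleton_def)

lemma skeleton_space_subcomplex: "skeleton_space T k = subtopology (cw_space X) (skeleton T k)"
  using skeleton_subcomplex_subset(1)[of k] by (simp add: skeleton_space_def subtopology_subtopology Int_absorb1)

lemma skeleton_space_lower: "k < int d \<Longrightarrow> skeleton_space T k = skeleton_space X k"
  unfolding skeleton_space_subcomplex by (simp add: skeleton_lower skeleton_space_def)

lemma cell_class_lower: "e \<in> S \<Longrightarrow> cw_dim X e < d \<Longrightarrow> cell_class T e = cell_class X e"
  by (simp add: cell_class_def skeleton_lower skeleton_space_lower)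

text \<open>
  The boundary of the class of a cell is computed in the lower skeleta, which are shared, except that
  the class itself lives in the \<open>k\<close>-skeleton. The two classes correspond under the inclusion of
  \<open>k\<close>-skeleta, and the boundary map of the triple is natural.
\<close>

lemma incidence_subcomplex:
  assumes e: "e \<in> S"
  shows "incidence T e = incidence X e"
proof -
  have dim: "cw_dim X e \<le> d" using e S_subset dim_le by auto
  define k where "k = int (cw_dim X e)"
  have eX: "e \<in> k_cells X k" using e S_subset by (auto simp: k_cells_def k_def)
  have kd: "k - 1 < int d" "k - 2 < int d" "k - 1 - 1 < int d" using dim by (auto simp: k_def)
  let ?Y = "skeleton_space X k" and ?W = "skeleton_space T k"
  let ?A = "skeleton X (k - 1)" and ?B = "skeleton X (k - 2)"
  have AX: "?A \<subseteq> skeleton X k" by (rule skeleton_mono) simp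
  have AT: "?A \<subseteq> skeleton T k"
    unfolding skeleton_lower[OF kd(1), symmetric] by (auto simp: skeleton_def)
  have sub: "subtopology ?Y ?A = skeleton_space X (k - 1)" "subtopology ?W ?A = skeleton_space X (k - 1)"
    using AX AT unfolding skeleton_space_subcomplex
    by (simp_all add: skeleton_space_def subtopology_subtopology Int_absorb1)
  have WY: "continuous_map ?W ?Y id"
    unfolding skeleton_space_subcomplex skeleton_space_def
    using skeleton_subcomplex_subset(2)[of k]
    by (auto simp: continuous_map_in_subtopology continuous_map_from_subtopology)
  have image: "cw_map X e ` topspace (disk (cw_dim X e)) \<subseteq> skeleton T k"
  proof -
    have "cw_map X e ` topspace (disk (cw_dim X e)) \<subseteq> ?A \<union> open_cell X e"
      using closed_cell(1)[of e] e S_subset by (simp add: k_def subset_iff)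
    also have "\<dots> \<subseteq> skeleton T k"
      using AT e by (auto simp: skeleton_def k_def)
    finally show ?thesis .
  qed
  have cm: "continuous_map (disk (cw_dim X e)) ?W (cw_map X e)"
    unfolding skeleton_space_subcomplex using cw_map_continuous[of e] e S_subset image
    by (auto simp: continuous_map_in_subtopology)
  have bd: "cw_map X e \<in> disk_boundary (cw_dim X e) \<rightarrow> ?A"
    using cw_map_boundary[of e] e S_subset by (auto simp: k_def)
  have c: "cell_class X e = hom_induced k ?W ?A ?Y ?A id (cell_class T e)"
  proof -
    have "cell_class T e = hom_induced k (disk (cw_dim X e)) (disk_boundary (cw_dim X e)) ?W ?A (cw_map X e) (disk_class (cw_dim X e))"
      using kd by (simp add: cell_class_def k_def[symmetric] skeleton_lower)
    then have "hom_induced k ?W ?A ?Y ?A id (cell_class T e) = 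
      hom_induced k (disk (cw_dim X e)) (disk_boundary (cw_dim X e)) ?Y ?A (id \<circ> cw_map X e) (disk_class (cw_dim X e))"
      by (simp only:) (rule hom_induced_compose'[OF cm bd WY], simp)
    then show ?thesis by (simp add: cell_class_def k_def)
  qed
  have "hom_relboundary k ?Y ?A ?B \<circ> hom_induced k ?W ?A ?Y ?A id =
      hom_induced (k - 1) (subtopology ?W ?A) ?B (subtopology ?Y ?A) ?B id \<circ> hom_relboundary k ?W ?A ?B"
    by (rule naturality_hom_induced_relboundary[OF WY]) auto
  then have "hom_relboundary k ?Y ?A ?B (cell_class X e) 
      = hom_induced (k - 1) (subtopology ?W ?A) ?B (subtopology ?Y ?A) ?B id (hom_relboundary k ?W ?A ?B (cell_class T e))"
    unfolding c by (metis comp_apply)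
  also have "\<dots> = hom_relboundary k ?W ?A ?B (cell_class T e)"
    using hom_relboundary[of k ?W ?A ?B "cell_class T e"] unfolding sub by (rule hom_induced_id)
  finally have rb: "hom_relboundary k ?W ?A ?B (cell_class T e) = hom_relboundary k ?Y ?A ?B (cell_class X e)" ..
  have fp: "finprod (cellular_group T (k - 1)) (\<lambda>f. cell_class T f [^]\<^bsub>cellular_group T (k - 1)\<^esub> a f) (k_cells T (k - 1))
     = finprod (cellular_group X (k - 1)) (\<lambda>f. cell_class X f [^]\<^bsub>cellular_group X (k - 1)\<^esub> a f) (k_cells X (k - 1))" for a :: "'c \<Rightarrow> int"
  proof -
    interpret G: comm_group "cellular_group X (k - 1)" by simp
    have "cellular_group T (k - 1) = cellular_group X (k - 1)"
      using kd by (simp add: skeleton_lower skeleton_space_lower)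
    moreover have "k_cells T (k - 1) = k_cells X (k - 1)" using kd by (simp add: k_cells_lower)
    moreover have "cell_class T f = cell_class X f" if "f \<in> k_cells X (k - 1)" for f
      using that kd lower_cells by (intro cell_class_lower) (auto simp: k_cells_def)
    ultimately show ?thesis
      by (simp only:) (rule G.finprod_cong'[OF refl], rule Pi_I, rule G.int_pow_closed, rule cell_class_closed, simp_all)
  qed
  show ?thesis
    unfolding incidence_def Let_def subcomplex_simps k_def[symmetric]
    unfolding fp using kd rb by (simp only: skeleton_lower k_cells_lower)
qed

end

context finite_CW begin

lemma open_cell_nonempty: "open_cell X e \<noteq> {}"
proof -
  have "(\<lambda>_. 0) \<in> disk_interior n" for n by (simp add: disk_interior_def topspace_disk L2_set_def)
  then show ?thesis by (auto simp: open_cell_def)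
qed

text \<open>
  If all lower cells are present, then the closures of cells cause no further condition, since the
  boundary of a cell of dimension at most \<open>d\<close> lies in the \<open>(d-1)\<close>-skeleton. Conversely, disjoint
  nonempty open cells are covered only by themselves.
\<close>

lemma subcomplex_contains_skeleton_iff:
  assumes dim_le: "\<And>e. e \<in> cw_cells X \<Longrightarrow> cw_dim X e \<le> d"
  shows "subcomplex_cells X S \<and> skeleton X (int d - 1) \<subseteq> topspace (cw_space (subcomplex X S))
     \<longleftrightarrow> S \<subseteq> cw_cells X \<and> (\<forall>e\<in>cw_cells X. cw_dim X e < d \<longrightarrow> e \<in> S)"
    (is "?l \<longleftrightarrow> ?r")
proof
  assume l: ?l
  have S: "S \<subseteq> cw_cells X" using l by (simp add: subcomplex_cells_def)
  have "e \<in> S" if e: "e \<in> cw_cells X" "cw_dim X e < d" for e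
  proof (rule ccontr)
    assume "e \<notin> S"
    have "open_cell X e \<subseteq> skeleton X (int d - 1)" using e by (auto simp: skeleton_def)
    then have "open_cell X e \<subseteq> (\<Union>e\<in>S. open_cell X e)" using l by auto
    moreover have "open_cell X e \<inter> (\<Union>e\<in>S. open_cell X e) = {}"
      using open_cells_disjoint[OF e(1)] S \<open>e \<notin> S\<close> by (auto simp: disjoint_iff)
    ultimately show False using open_cell_nonempty[of e] by blast
  qed
  then show ?r using S by blast
next
  assume r: ?r
  have low: "skeleton X k \<subseteq> (\<Union>e\<in>S. open_cell X e)" if "k < int d" for k
    using r that by (fastforce simp: skeleton_def)
  have "cw_map X e ` topspace (disk (cw_dim X e)) \<subseteq> (\<Union>e\<in>S. open_cell X e)" if "e \<in> S" for e
  proof -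
    have e: "e \<in> cw_cells X" using that r by blast
    have "skeleton X (int (cw_dim X e) - 1) \<union> open_cell X e \<subseteq> (\<Union>e\<in>S. open_cell X e)"
      using low[of "int (cw_dim X e) - 1"] dim_le[OF e] that by (intro Un_least UN_upper) auto
    then show ?thesis using closed_cell(1)[OF e] by (rule subset_trans[rotated])
  qed
  then have "subcomplex_cells X S" using r by (auto simp: subcomplex_cells_def)
  moreover have "skeleton X (int d - 1) \<subseteq> topspace (cw_space (subcomplex X S))"
    using low[of "int d - 1"] skeleton_subset by auto
  ultimately show ?l ..
qed

end

section \<open>Bases of groups of integer vectors\<close>

interpretation zmod: Modules.module "(*s) :: int \<Rightarrow> int ^ 'c::finite \<Rightarrow> int ^ 'c"
  by unfold_locales (auto simp: vector_add_ldistrib vector_sadd_rdistrib vector_smult_assoc)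

text \<open>
  Integer vectors are reduced to triangular form twice: with respect to the standard coordinates of
  \<open>\<int>\<^sup>n\<close>, to construct a basis, and with respect to the coordinates in such a basis, to compute an
  index. The locale abstracts the two coordinate systems.
\<close>

locale coordinates =
  fixes n :: nat and \<kappa> :: "nat \<Rightarrow> int ^ 'c::finite \<Rightarrow> int" and L :: "(int ^ 'c) set"
  assumes L: "zmod.subspace L"
    and add: "x \<in> L \<Longrightarrow> y \<in> L \<Longrightarrow> \<kappa> i (x + y) = \<kappa> i x + \<kappa> i y"
    and scale: "x \<in> L \<Longrightarrow> \<kappa> i (a *s x) = a * \<kappa> i x"
    and eq_0: "x \<in> L \<Longrightarrow> (\<And>i. i < n \<Longrightarrow> \<kappa> i x = 0) \<Longrightarrow> x = 0"
begin

lemma diff_scale: "x \<in> L \<Longrightarrow> y \<in> L \<Longrightarrow> \<kappa> i (x - a *s y) = \<kappa> i x - a * \<kappa> i y"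
  using add[of x "(- a) *s y" i] scale[of y i "- a"] L
  by (simp add: zmod.subspace_scale zmod.subspace_neg)

lemma zero: "\<kappa> i 0 = 0"
  using scale[of 0 i 0] L by (simp add: zmod.subspace_0)

lemma sum:
  assumes "finite I" "\<And>i. i \<in> I \<Longrightarrow> f i \<in> L"
  shows "\<kappa> k (\<Sum>i\<in>I. c i *s f i) = (\<Sum>i\<in>I. c i * \<kappa> k (f i))"
  using assms
proof (induction I)
  case (insert i I)
  then have "(\<Sum>i\<in>I. c i *s f i) \<in> L" using L by (auto intro!: zmod.subspace_sum zmod.subspace_scale)
  then show ?case using insert L by (simp add: add scale zmod.subspace_scale)
qed (simp add: zero)

text \<open>
  The row of index \<open>i\<close> in a Hermite normal form of \<open>G\<close>: among the elements of \<open>G\<close> whose coordinates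
  above \<open>i\<close> vanish, one whose \<open>i\<close>-th coordinate generates the ideal of all \<open>i\<close>-th coordinates. If
  this ideal is zero, the row is zero, so that zero rows can be discarded.
\<close>

definition leading_multiple :: "(int ^ 'c) set \<Rightarrow> nat \<Rightarrow> int ^ 'c \<Rightarrow> bool" where
  "leading_multiple G i g \<longleftrightarrow> g \<in> G \<and> (\<forall>j. i < j \<and> j < n \<longrightarrow> \<kappa> j g = 0) \<and> 0 \<le> \<kappa> i g \<and> (\<kappa> i g = 0 \<longrightarrow> g = 0) \<and>
     (\<forall>x\<in>G. (\<forall>j. i < j \<and> j < n \<longrightarrow> \<kappa> j x = 0) \<longrightarrow> \<kappa> i g dvd \<kappa> i x)"

text \<open>The least positive \<open>i\<close>-th coordinate divides the others, by division with remainder.\<close>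

lemma leading_multiple_exists:
  assumes G: "zmod.subspace G" "G \<subseteq> L"
  shows "\<exists>g. leading_multiple G i g"
proof -
  define H where "H = {x \<in> G. \<forall>j. i < j \<and> j < n \<longrightarrow> \<kappa> j x = 0}"
  show ?thesis
  proof (cases "\<exists>x\<in>H. \<kappa> i x \<noteq> 0")
    case False
    then show ?thesis
      using G by (intro exI[of _ 0]) (auto simp: leading_multiple_def H_def zmod.subspace_0 zero)
  next
    case True
    then obtain x where x: "x \<in> H" "\<kappa> i x \<noteq> 0" by blast
    have "\<exists>m>0. \<exists>y\<in>H. \<kappa> i y = int m"
    proof (cases "\<kappa> i x > 0")
      case True
      then show ?thesis using x(1) by (intro exI[of _ "nat (\<kappa> i x)"]) auto
    next
      case False
      have "(- 1) *s x \<in> H" 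
        using x(1) G scale[of x _ "- 1"] by (auto simp: H_def intro: zmod.subspace_scale zmod.subspace_neg)
      moreover have "\<kappa> i ((- 1) *s x) = - \<kappa> i x" using x(1) G by (subst scale) (auto simp: H_def)
      ultimately show ?thesis using False x(2) by (intro exI[of _ "nat (- \<kappa> i x)"]) auto
    qed
    then have ex: "\<exists>m. 0 < m \<and> (\<exists>y\<in>H. \<kappa> i y = int m)" by blast
    define m where "m = (LEAST m. 0 < m \<and> (\<exists>y\<in>H. \<kappa> i y = int m))"
    have m: "0 < m" "\<exists>y\<in>H. \<kappa> i y = int m" using LeastI_ex[OF ex] by (auto simp: m_def)
    have least: "m \<le> k" if "0 < k" "y \<in> H" "\<kappa> i y = int k" for k y
      unfolding m_def by (rule Least_le) (use that in blast)
    obtain g where g: "g \<in> H" "\<kappa> i g = int m" using m by blast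
    have "int m dvd \<kappa> i y" if y: "y \<in> H" for y
    proof (rule ccontr)
      assume nd: "\<not> int m dvd \<kappa> i y"
      let ?z = "y - (\<kappa> i y div int m) *s g"
      have yg: "y \<in> L" "g \<in> L" using y g(1) G by (auto simp: H_def)
      have "?z \<in> G" using y g(1) G(1) by (auto simp: H_def intro: zmod.subspace_diff zmod.subspace_scale)
      then have "?z \<in> H" using y g(1) yg by (auto simp: H_def diff_scale)
      moreover have "\<kappa> i ?z = \<kappa> i y mod int m" using yg g(2) by (simp add: diff_scale minus_div_mult_eq_mod)
      moreover have pos: "0 < \<kappa> i y mod int m"
        using nd m(1) pos_mod_sign[of "int m" "\<kappa> i y"] unfolding dvd_eq_mod_eq_0 by linarith
      ultimately have "m \<le> nat (\<kappa> i y mod int m)" by (intro least[of _ ?z]) simp_all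
      then show False using m(1) pos_mod_bound[of "int m" "\<kappa> i y"] pos by linarith
    qed
    then show ?thesis using g m(1)
      by (intro exI[of _ g]) (auto simp: leading_multiple_def H_def)
  qed
qed

text \<open>The coordinates of \<open>x\<close> are cleared from the highest index downwards.\<close>

lemma triangular_generation:
  assumes G: "zmod.subspace G" "G \<subseteq> L" and g: "\<And>i. i < n \<Longrightarrow> leading_multiple G i (g i)"
    and x: "x \<in> G" and m: "m \<le> n" "\<And>j. m \<le> j \<Longrightarrow> j < n \<Longrightarrow> \<kappa> j x = 0"
  shows "\<exists>c. x = (\<Sum>i<m. c i *s g i)"
  using x m
proof (induction m arbitrary: x)
  case 0
  then show ?case using G eq_0[of x] by auto
next
  case (Suc m)
  have gm: "leading_multiple G m (g m)" using g Suc by simp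
  then have "\<kappa> m (g m) dvd \<kappa> m x" using Suc unfolding leading_multiple_def by auto
  then obtain q where q: "\<kappa> m x = \<kappa> m (g m) * q" by (rule dvdE)
  let ?y = "x - q *s g m"
  have gG: "g m \<in> G" using gm by (simp add: leading_multiple_def)
  have in_L: "x \<in> L" "g m \<in> L" using gG Suc.prems(1) G by auto
  have y: "?y \<in> G" using Suc.prems(1) gG G(1) by (intro zmod.subspace_diff zmod.subspace_scale)
  have "\<kappa> j ?y = 0" if "m \<le> j" "j < n" for j
  proof (cases "j = m")
    case True
    then show ?thesis using in_L q by (simp add: diff_scale mult.commute)
  next
    case False
    then show ?thesis using in_L gm Suc.prems(3)[of j] that by (simp add: diff_scale leading_multiple_def)
  qed
  then obtain c where "?y = (\<Sum>i<m. c i *s g i)" using Suc.IH[OF y] Suc.prems(2) by auto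
  then have "x = (\<Sum>i<m. c i *s g i) + q *s g m" by (simp add: algebra_simps)
  also have "\<dots> = (\<Sum>i<Suc m. (c(m := q)) i *s g i)" by simp
  finally show ?case by blast
qed

end

definition real_vec :: "int ^ 'c::finite \<Rightarrow> real ^ 'c" where
  "real_vec b = (\<chi> e. of_int (b $ e))"

lemma real_vec_simps [simp]:
  "real_vec b $ e = of_int (b $ e)" "real_vec 0 = 0" "real_vec (x + y) = real_vec x + real_vec y"
  "real_vec (a *s x) = of_int a *\<^sub>R real_vec x" "real_vec x = real_vec y \<longleftrightarrow> x = y"
  by (auto simp: real_vec_def Finite_Cartesian_Product.vec_eq_iff)

lemma real_vec_sum: "real_vec (\<Sum>i\<in>I. f i) = (\<Sum>i\<in>I. real_vec (f i))"
  by (induction I rule: infinite_finite_induct) auto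

text \<open>
  A \<open>\<int>\<close>-basis of \<open>G\<close>, with linear independence demanded over the reals. For integer vectors this is
  no restriction, and it makes a \<open>\<int>\<close>-basis of a lattice a basis of the real subspace that it spans.
\<close>

definition zbasis :: "nat \<Rightarrow> (nat \<Rightarrow> int ^ 'c::finite) \<Rightarrow> (int ^ 'c) set \<Rightarrow> bool" where
  "zbasis r b G \<longleftrightarrow> (\<forall>i<r. b i \<in> G) \<and> (\<forall>x\<in>G. \<exists>a. x = (\<Sum>i<r. a i *s b i)) \<and>
     (\<forall>t :: nat \<Rightarrow> real. (\<Sum>i<r. t i *\<^sub>R real_vec (b i)) = 0 \<longrightarrow> (\<forall>i<r. t i = 0))"

text \<open>
  The nonzero rows of the Hermite normal form are a basis. They are independent over the reals because
  in a nontrivial relation the row of highest index contributes a nonzero coordinate that nothing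
  else can cancel.
\<close>

lemma zbasis_exists:
  fixes G :: "(int ^ 'c::finite) set"
  assumes G: "zmod.subspace G"
  obtains r b where "zbasis r b G"
proof -
  let ?n = "CARD('c)"
  obtain h :: "nat \<Rightarrow> 'c" where h: "bij_betw h {0..<?n} UNIV"
    using ex_bij_betw_nat_finite[of "UNIV :: 'c set"] by auto
  interpret coordinates ?n "\<lambda>i x. x $ h i" UNIV
  proof
    fix x :: "int ^ 'c" assume 0: "\<And>i. i < ?n \<Longrightarrow> x $ h i = 0"
    have "x $ c = 0" for c
    proof -
      have "c \<in> h ` {0..<?n}" using h by (simp add: bij_betw_def)
      then show ?thesis using 0 by auto
    qed
    then show "x = 0" by (simp add: Finite_Cartesian_Product.vec_eq_iff)
  qed (auto simp: zmod.subspace_UNIV)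
  have "\<forall>i. \<exists>g. leading_multiple G i g" using leading_multiple_exists[OF G] by simp
  then obtain g where g: "\<And>i. leading_multiple G i (g i)" by metis
  define I where "I = {i. i < ?n \<and> g i \<noteq> 0}"
  have fin: "finite I" by (simp add: I_def)
  obtain e where e: "bij_betw e {0..<card I} I" using ex_bij_betw_nat_finite[OF fin] by blast
  have indep: "s i = 0" if s: "(\<Sum>i\<in>I. s i *\<^sub>R real_vec (g i)) = (0 :: real ^ 'c)" and i: "i \<in> I" for s i
  proof (rule ccontr)
    assume "s i \<noteq> 0"
    \<comment> \<open>The highest index in the relation: at that coordinate the rows of lower index vanish.\<close>
    let ?J = "{i \<in> I. s i \<noteq> 0}"
    define m where "m = Max ?J"
    have J: "finite ?J" "?J \<noteq> {}" using fin i \<open>s i \<noteq> 0\<close> by auto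
    have m: "m \<in> ?J" unfolding m_def by (rule Max_in[OF J])
    have "0 = (\<Sum>i\<in>I. s i *\<^sub>R real_vec (g i)) $ h m" by (simp add: s)
    also have "\<dots> = (\<Sum>i\<in>I. s i * of_int (g i $ h m))" by simp
    also have "\<dots> = (\<Sum>i\<in>I. if i = m then s m * of_int (g m $ h m) else 0)"
    proof (rule sum.cong[OF refl])
      fix i assume i: "i \<in> I"
      show "s i * of_int (g i $ h m) = (if i = m then s m * of_int (g m $ h m) else 0)"
      proof (cases "i < m")
        case True
        then show ?thesis using g[of i] m by (auto simp: leading_multiple_def I_def)
      next
        case False
        moreover have "s i = 0" if "m < i"
          using Max_ge[OF J(1), of i] that i unfolding m_def by (cases "s i = 0") auto
        ultimately show ?thesis by (cases "i = m") auto
      qed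
    qed
    also have "\<dots> = s m * of_int (g m $ h m)" using m fin by simp
    finally have "g m $ h m = 0" using m by simp
    then show False using g[of m] m by (auto simp: leading_multiple_def I_def)
  qed
  have "zbasis (card I) (g \<circ> e) G"
    unfolding zbasis_def
  proof (intro conjI allI impI ballI)
    show "(g \<circ> e) i \<in> G" for i using g by (simp add: leading_multiple_def)
    show "\<exists>a. x = (\<Sum>i<card I. a i *s (g \<circ> e) i)" if x: "x \<in> G" for x
    proof -
      obtain c where "x = (\<Sum>i<?n. c i *s g i)"
        using triangular_generation[OF G _ _ x, of g ?n] g by auto
      also have "\<dots> = (\<Sum>i\<in>I. c i *s g i)"
        by (rule sum.mono_neutral_right) (auto simp: I_def)
      also have "\<dots> = (\<Sum>i<card I. c (e i) *s g (e i))"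
        using sum.reindex_bij_betw[OF e, of "\<lambda>i. c i *s g i"] by (simp add: lessThan_atLeast0)
      finally show ?thesis by (intro exI[of _ "c \<circ> e"]) simp
    qed
    fix t :: "nat \<Rightarrow> real" and i
    assume t: "(\<Sum>i<card I. t i *\<^sub>R real_vec ((g \<circ> e) i)) = 0" and i: "i < card I"
    define s where "s j = t (inv_into {0..<card I} e j)" for j
    have se: "s (e k) = t k" if "k < card I" for k
      using e that unfolding s_def by (subst inv_into_f_f) (auto simp: bij_betw_def)
    have "(\<Sum>j\<in>I. s j *\<^sub>R real_vec (g j)) = (\<Sum>k = 0..<card I. s (e k) *\<^sub>R real_vec (g (e k)))"
      by (rule sum.reindex_bij_betw[OF e, symmetric])
    also have "\<dots> = (\<Sum>k<card I. t k *\<^sub>R real_vec (g (e k)))" by (rule sum.cong) (auto simp: se)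
    finally have "s (e i) = 0" using t i e by (intro indep) (auto simp: bij_betw_def)
    then show "t i = 0" using se i by simp
  qed
  then show ?thesis by (rule that)
qed

lemma zbasis_unique:
  assumes b: "zbasis r b G" and eq: "(\<Sum>i<r. a i *s b i) = (\<Sum>i<r. a' i *s b i)" and i: "i < r"
  shows "a i = a' i"
proof -
  have "(\<Sum>i<r. of_int (a i - a' i) *\<^sub>R real_vec (b i)) = real_vec (\<Sum>i<r. a i *s b i) - real_vec (\<Sum>i<r. a' i *s b i)"
    by (simp add: real_vec_sum scaleR_diff_left sum_subtractf)
  also have "\<dots> = 0" using eq by simp
  finally have "real_of_int (a i - a' i) = 0"
    using b[unfolded zbasis_def, THEN conjunct2, THEN conjunct2, THEN spec[of _ "\<lambda>i. real_of_int (a i - a' i)"]] i by simp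
  then show ?thesis by simp
qed

text \<open>The value outside of the range is 0, so that additivity and homogeneity hold for every index.\<close>

definition zcoord :: "nat \<Rightarrow> (nat \<Rightarrow> int ^ 'c::finite) \<Rightarrow> nat \<Rightarrow> int ^ 'c \<Rightarrow> int" where
  "zcoord r b i x = (if i < r then (SOME a. x = (\<Sum>i<r. a i *s b i)) i else 0)"

lemma zcoord_sum:
  assumes b: "zbasis r b G" and i: "i < r"
  shows "zcoord r b i (\<Sum>i<r. a i *s b i) = a i"
proof -
  have "(\<Sum>i<r. a i *s b i) = (\<Sum>j<r. (SOME a'. (\<Sum>i<r. a i *s b i) = (\<Sum>i<r. a' i *s b i)) j *s b j)"
    by (rule someI[where P = "\<lambda>a'. (\<Sum>i<r. a i *s b i) = (\<Sum>i<r. a' i *s b i)"]) simp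
  from zbasis_unique[OF b this i] show ?thesis using i by (simp add: zcoord_def)
qed

lemma zcoord_expand:
  assumes b: "zbasis r b G" and x: "x \<in> G"
  shows "(\<Sum>i<r. zcoord r b i x *s b i) = x"
proof -
  obtain a where a: "x = (\<Sum>i<r. a i *s b i)" using b x by (auto simp: zbasis_def)
  have "(\<Sum>i<r. zcoord r b i x *s b i) = (\<Sum>i<r. a i *s b i)"
    unfolding a by (intro sum.cong refl) (simp add: zcoord_sum[OF b])
  then show ?thesis using a by simp
qed

lemma zcoord_basis:
  assumes b: "zbasis r b G" and "i < r" "j < r"
  shows "zcoord r b i (b j) = (if i = j then 1 else 0)"
proof -
  have "b j = (\<Sum>k<r. (if k = j then 1 else 0) *s b k)"
    using assms by (simp add: if_distrib[of "\<lambda>c. c *s _"] cong: if_cong)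
  then show ?thesis using zcoord_sum[OF b assms(2), of "\<lambda>k. if k = j then 1 else 0"] by simp
qed

lemma zbasis_coordinates:
  assumes b: "zbasis r b G" and G: "zmod.subspace G"
  shows "coordinates r (zcoord r b) G"
proof
  show "zmod.subspace G" by fact
  show "zcoord r b i (x + y) = zcoord r b i x + zcoord r b i y" if xy: "x \<in> G" "y \<in> G" for i x y
  proof (cases "i < r")
    case True
    have "x + y = (\<Sum>i<r. (zcoord r b i x + zcoord r b i y) *s b i)"
      using zcoord_expand[OF b xy(1)] zcoord_expand[OF b xy(2)]
      by (simp add: vector_sadd_rdistrib sum.distrib)
    then show ?thesis using zcoord_sum[OF b True, of "\<lambda>i. zcoord r b i x + zcoord r b i y"] by (simp only:)
  qed (simp add: zcoord_def)
  show "zcoord r b i (a *s x) = a * zcoord r b i x" if x: "x \<in> G" for i x a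
  proof (cases "i < r")
    case True
    have "a *s (\<Sum>i<r. zcoord r b i x *s b i) = (\<Sum>i<r. (a * zcoord r b i x) *s b i)"
      by (simp add: zmod.scale_sum_right vector_smult_assoc)
    then show ?thesis using zcoord_sum[OF b True, of "\<lambda>i. a * zcoord r b i x"] zcoord_expand[OF b x] by simp
  qed (simp add: zcoord_def)
  show "x = 0" if "x \<in> G" "\<And>i. i < r \<Longrightarrow> zcoord r b i x = 0" for x
    using zcoord_expand[OF b that(1)] that(2) by simp
qed

section \<open>The index of a sublattice\<close>

definition int_span :: "'i set \<Rightarrow> ('i \<Rightarrow> int ^ 'c::finite) \<Rightarrow> (int ^ 'c) set" where
  "int_span E w = {\<Sum>e\<in>E. a e *s w e | a. True}"

lemma int_spanI: "(\<Sum>e\<in>E. a e *s w e) \<in> int_span E w"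
  unfolding int_span_def by (rule CollectI) (rule exI[of _ a], simp)

lemma int_span_subspace: "zmod.subspace (int_span E w)"
  unfolding zmod.subspace_def
proof (intro conjI ballI allI)
  show "0 \<in> int_span E w" unfolding int_span_def by (auto intro!: exI[of _ "\<lambda>_. 0"])
  show "x + y \<in> int_span E w" if xy: "x \<in> int_span E w" "y \<in> int_span E w" for x y
  proof -
    obtain a a' where "x = (\<Sum>e\<in>E. a e *s w e)" "y = (\<Sum>e\<in>E. a' e *s w e)"
      using xy by (auto simp: int_span_def)
    then have "x + y = (\<Sum>e\<in>E. (a e + a' e) *s w e)" by (simp add: sum.distrib vector_sadd_rdistrib)
    then show ?thesis by (simp only: int_spanI)
  qed
  show "c *s x \<in> int_span E w" if x: "x \<in> int_span E w" for c x
  proof -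
    obtain a where "x = (\<Sum>e\<in>E. a e *s w e)" using x by (auto simp: int_span_def)
    then have "c *s x = (\<Sum>e\<in>E. (c * a e) *s w e)" by (simp add: zmod.scale_sum_right vector_smult_assoc)
    then show ?thesis by (simp only: int_spanI)
  qed
qed

lemma int_span_base:
  assumes "finite E" "e \<in> E"
  shows "w e \<in> int_span E w"
proof -
  have "(\<Sum>e'\<in>E. (if e' = e then 1 else 0) *s w e') = (\<Sum>e'\<in>E. if e' = e then w e' else 0)"
    by (rule sum.cong) auto
  also have "\<dots> = w e" using assms by simp
  finally show ?thesis using int_spanI[of "\<lambda>e'. if e' = e then 1 else 0" w E] by (simp only:)
qed

lemma int_span_minimal:
  assumes "zmod.subspace G" "\<And>e. e \<in> E \<Longrightarrow> w e \<in> G"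
  shows "int_span E w \<subseteq> G"
proof
  fix x assume "x \<in> int_span E w"
  then obtain a where x: "x = (\<Sum>e\<in>E. a e *s w e)" by (auto simp: int_span_def)
  show "x \<in> G" unfolding x using assms by (intro zmod.subspace_sum zmod.subspace_scale)
qed

definition int_det :: "nat \<Rightarrow> (nat \<Rightarrow> nat \<Rightarrow> int) \<Rightarrow> int" where
  "int_det r C = Determinant.det (Matrix.mat r r (\<lambda>(i, j). C i j))"

lemma int_det_mult:
  assumes "\<And>i j. i < r \<Longrightarrow> j < r \<Longrightarrow> A i j = (\<Sum>k<r. B i k * C k j)"
  shows "int_det r A = int_det r B * int_det r C"
proof -
  have "Matrix.mat r r (\<lambda>(i, j). A i j) = Matrix.mat r r (\<lambda>(i, j). B i j) * Matrix.mat r r (\<lambda>(i, j). C i j)"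
    by (rule eq_matI) (auto simp: assms scalar_prod_def lessThan_atLeast0)
  then show ?thesis unfolding int_det_def by (simp only:) (rule Determinant.det_mult[of _ r], auto)
qed

text \<open>
  Multiplying the relation between \<open>w\<close> and \<open>b\<close> by the adjugate of the coordinate matrix: the
  determinant annihilates the quotient of the lattice by the span of \<open>w\<close>.
\<close>

lemma det_scale_in_span:
  assumes w: "\<And>j. j < r \<Longrightarrow> w j = (\<Sum>i<r. C i j *s b i)" and i: "i < r"
  shows "int_det r C *s b i \<in> int_span {..<r} w"
proof -
  let ?C = "Matrix.mat r r (\<lambda>(i, j). C i j)"
  note adj = adj_mat[of ?C r]
  have A: "(\<Sum>j<r. C k j * adj_mat ?C $$ (j, i)) = (if k = i then int_det r C else 0)" if "k < r" for k
    using arg_cong[OF adj(2), of "\<lambda>m. m $$ (k, i)"] that i adj(1)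
    by (simp add: scalar_prod_def lessThan_atLeast0 int_det_def)
  have "(\<Sum>j<r. adj_mat ?C $$ (j, i) *s w j) = (\<Sum>k<r. (\<Sum>j<r. C k j * adj_mat ?C $$ (j, i)) *s b k)"
    by (simp add: w zmod.scale_sum_right zmod.scale_sum_left vector_smult_assoc mult.commute) (rule sum.swap)
  also have "\<dots> = (\<Sum>k<r. (if k = i then int_det r C *s b k else 0))"
    by (intro sum.cong refl) (simp add: A)
  also have "\<dots> = int_det r C *s b i" using i by simp
  finally show ?thesis using int_spanI[of "\<lambda>j. adj_mat ?C $$ (j, i)" w "{..<r}"] by (simp only:)
qed

lemma coset_eq_iff:
  assumes "zmod.subspace G"
  shows "(\<lambda>g. g + x) ` G = (\<lambda>g. g + y) ` G \<longleftrightarrow> x - y \<in> G"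
proof
  assume "(\<lambda>g. g + x) ` G = (\<lambda>g. g + y) ` G"
  moreover have "0 + x \<in> (\<lambda>g. g + x) ` G" using zmod.subspace_0[OF assms] by (rule imageI)
  ultimately have "x \<in> (\<lambda>g. g + y) ` G" by simp
  then show "x - y \<in> G" by auto
next
  assume xy: "x - y \<in> G"
  have "g + x = (g + (x - y)) + y" "g + y = (g - (x - y)) + x" for g by simp_all
  then show "(\<lambda>g. g + x) ` G = (\<lambda>g. g + y) ` G"
    using xy zmod.subspace_add[OF assms _ xy] zmod.subspace_diff[OF assms _ xy]
    by (intro equalityI image_subsetI) (metis imageI)+
qed

text \<open>
  The sublattice \<open>G\<close> spanned by \<open>w\<close> has a triangular basis \<open>g\<close> in the coordinates with respect to
  \<open>b\<close>. Its determinant is the product of the positive diagonal entries \<open>h i\<close>, and up to sign it is the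
  determinant of \<open>w\<close>, since \<open>g\<close> and \<open>w\<close> are integer combinations of each other. Division with
  remainder from the highest coordinate downwards shows that every coset of \<open>G\<close> has exactly one
  representative whose coordinates lie in the box \<open>0 \<le> y i < h i\<close>, and the box has \<open>\<Prod>i. h i\<close>
  elements.
\<close>

lemma index_eq_abs_det:
  assumes b: "zbasis r b L" and L: "zmod.subspace L"
    and w: "\<And>j. j < r \<Longrightarrow> w j = (\<Sum>i<r. C i j *s b i)" and det: "int_det r C \<noteq> 0"
  shows "card ((\<lambda>x. (\<lambda>g. g + x) ` int_span {..<r} w) ` L) = nat \<bar>int_det r C\<bar>"
proof -
  let ?G = "int_span {..<r} w" and ?\<kappa> = "zcoord r b"
  interpret coordinates r ?\<kappa> L by (rule zbasis_coordinates[OF b L])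
  have G: "zmod.subspace ?G" by (rule int_span_subspace)
  have bL: "b i \<in> L" if "i < r" for i using b that by (simp add: zbasis_def)
  have wL: "w j \<in> L" if "j < r" for j
    unfolding w[OF that] using L bL by (auto intro!: zmod.subspace_sum zmod.subspace_scale)
  have GL: "?G \<subseteq> L" using wL by (intro int_span_minimal[OF L]) auto
  note \<kappa>b = zcoord_basis[OF b]
  have \<kappa>w: "?\<kappa> i (w j) = C i j" if "i < r" "j < r" for i j
    unfolding w[OF that(2)] by (rule zcoord_sum[OF b that(1)])
  have "\<forall>i. \<exists>g. leading_multiple ?G i g" using leading_multiple_exists[OF G GL] by simp
  then obtain g where g: "\<And>i. leading_multiple ?G i (g i)" by metis
  let ?h = "\<lambda>i. ?\<kappa> i (g i)"
  have gG: "g i \<in> ?G" and gL: "g i \<in> L" for i using g[of i] GL by (auto simp: leading_multiple_def)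
  have h_pos: "?h i > 0" if i: "i < r" for i
  proof -
    have "int_det r C *s b i \<in> ?G" by (rule det_scale_in_span[OF w i])
    moreover have "?\<kappa> j (int_det r C *s b i) = 0" if "i < j" "j < r" for j
      using that i by (simp add: scale bL \<kappa>b)
    ultimately have "?h i dvd ?\<kappa> i (int_det r C *s b i)"
      using g[of i] unfolding leading_multiple_def by blast
    then have "?h i \<noteq> 0" using det i by (auto simp: scale bL \<kappa>b)
    then show ?thesis using g[of i] by (simp add: leading_multiple_def)
  qed
  have upper: "?\<kappa> j (g i) = 0" if "i < j" "j < r" for i j
    using g[of i] that by (simp add: leading_multiple_def)
  \<comment> \<open>The two transition matrices make the determinants of \<open>g\<close> and \<open>w\<close> divide each other, so they agree
    up to sign.\<close>
  have "\<exists>U. \<forall>j<r. g j = (\<Sum>k<r. U k j *s w k)"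
  proof -
    have "\<forall>j. \<exists>u. g j = (\<Sum>k<r. u k *s w k)" using gG by (auto simp: int_span_def)
    then obtain u where "\<forall>j. g j = (\<Sum>k<r. u j k *s w k)" by metis
    then show ?thesis by (intro exI[of _ "\<lambda>k j. u j k"]) simp
  qed
  then obtain U where U: "\<And>j. j < r \<Longrightarrow> g j = (\<Sum>k<r. U k j *s w k)" by blast
  have "\<exists>W. \<forall>j<r. w j = (\<Sum>k<r. W k j *s g k)"
  proof -
    have "\<exists>u. w j = (\<Sum>k<r. u k *s g k)" if "j < r" for j
      using that g by (intro triangular_generation[OF G GL _ int_span_base]) auto
    then obtain u where "\<forall>j<r. w j = (\<Sum>k<r. u j k *s g k)" by metis
    then show ?thesis by (intro exI[of _ "\<lambda>k j. u j k"]) simp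
  qed
  then obtain W where W: "\<And>j. j < r \<Longrightarrow> w j = (\<Sum>k<r. W k j *s g k)" by blast
  let ?H = "\<lambda>i j. ?\<kappa> i (g j)"
  have HU: "int_det r ?H = int_det r C * int_det r U"
  proof (rule int_det_mult)
    fix i j assume ij: "i < r" "j < r"
    have "?\<kappa> i (g j) = (\<Sum>k<r. U k j * ?\<kappa> i (w k))"
      unfolding U[OF ij(2)] using wL by (intro sum) auto
    then show "?\<kappa> i (g j) = (\<Sum>k<r. C i k * U k j)" using ij \<kappa>w by (simp add: mult.commute)
  qed
  have CW: "int_det r C = int_det r ?H * int_det r W"
  proof (rule int_det_mult)
    fix i j assume ij: "i < r" "j < r"
    have "?\<kappa> i (w j) = (\<Sum>k<r. W k j * ?\<kappa> i (g k))"
      unfolding W[OF ij(2)] using gL by (intro sum) auto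
    then show "C i j = (\<Sum>k<r. ?\<kappa> i (g k) * W k j)" using ij \<kappa>w by (simp add: mult.commute)
  qed
  have "int_det r ?H dvd int_det r C" "int_det r C dvd int_det r ?H"
    using HU CW by (metis dvd_triv_left)+
  then have abs: "\<bar>int_det r ?H\<bar> = \<bar>int_det r C\<bar>" by (metis zdvd_antisym_abs)
  have "int_det r ?H = prod_list (diag_mat (Matrix.mat r r (\<lambda>(i, j). ?H i j)))"
    unfolding int_det_def by (rule det_upper_triangular) (auto simp: upper_triangular_def upper)
  also have "\<dots> = (\<Prod>i<r. ?h i)"
    by (simp add: prod_list_diag_prod lessThan_atLeast0)
  finally have detH: "int_det r ?H = (\<Prod>i<r. ?h i)" .
  \<comment> \<open>Injectivity: at the highest coordinate where two points of the box differ, the difference would be a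
    multiple of \<open>h\<close>. Surjectivity: reduce the coordinates modulo \<open>h\<close> from the highest one downwards.\<close>
  let ?box = "PiE {..<r} (\<lambda>i. {0..<?h i})"
  let ?rep = "\<lambda>y. \<Sum>i<r. y i *s b i"
  have repL: "?rep y \<in> L" for y using L bL by (auto intro!: zmod.subspace_sum zmod.subspace_scale)
  have \<kappa>rep: "?\<kappa> i (?rep y) = y i" if "i < r" for i y by (rule zcoord_sum[OF b that])
  have "bij_betw (\<lambda>y. (\<lambda>g. g + ?rep y) ` ?G) ?box ((\<lambda>x. (\<lambda>g. g + x) ` ?G) ` L)"
  proof (rule bij_betw_imageI)
    show "inj_on (\<lambda>y. (\<lambda>g. g + ?rep y) ` ?G) ?box"
    proof (rule inj_onI)
      fix y z assume y: "y \<in> ?box" and z: "z \<in> ?box" and eq: "(\<lambda>g. g + ?rep y) ` ?G = (\<lambda>g. g + ?rep z) ` ?G"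
      have D: "?rep y - ?rep z \<in> ?G" using eq unfolding coset_eq_iff[OF G] .
      have \<kappa>D: "?\<kappa> i (?rep y - ?rep z) = y i - z i" if "i < r" for i
        using diff_scale[OF repL repL, of i y 1 z] that by (simp add: \<kappa>rep)
      show "y = z"
      proof (rule ccontr)
        assume "y \<noteq> z"
        let ?J = "{i. i < r \<and> y i \<noteq> z i}"
        have "?J \<noteq> {}"
        proof
          assume "?J = {}"
          then have "y = z" using y z by (intro PiE_ext) auto
          then show False using \<open>y \<noteq> z\<close> by simp
        qed
        define m where "m = Max ?J"
        have m: "m \<in> ?J" unfolding m_def using \<open>?J \<noteq> {}\<close> by (intro Max_in) auto
        have "y j = z j" if "m < j" "j < r" for j
        proof (rule ccontr)
          assume "y j \<noteq> z j"
          then have "j \<le> m" unfolding m_def using that by (intro Max_ge) auto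
          then show False using that by simp
        qed
        then have "\<forall>j. m < j \<and> j < r \<longrightarrow> ?\<kappa> j (?rep y - ?rep z) = 0" using \<kappa>D by simp
        then have "?h m dvd y m - z m" using g[of m] D m \<kappa>D unfolding leading_multiple_def by fastforce
        moreover have "y m - z m \<noteq> 0" using m by simp
        ultimately have "\<bar>?h m\<bar> \<le> \<bar>y m - z m\<bar>" by (intro dvd_imp_le_int)
        moreover have "y m \<in> {0..<?h m}" "z m \<in> {0..<?h m}" using PiE_mem[OF y] PiE_mem[OF z] m by auto
        ultimately show False by auto
      qed
    qed
    show "(\<lambda>y. (\<lambda>g. g + ?rep y) ` ?G) ` ?box = (\<lambda>x. (\<lambda>g. g + x) ` ?G) ` L"
    proof
      show "(\<lambda>y. (\<lambda>g. g + ?rep y) ` ?G) ` ?box \<subseteq> (\<lambda>x. (\<lambda>g. g + x) ` ?G) ` L" using repL by blast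
      show "(\<lambda>x. (\<lambda>g. g + x) ` ?G) ` L \<subseteq> (\<lambda>y. (\<lambda>g. g + ?rep y) ` ?G) ` ?box"
      proof (rule image_subsetI)
        fix x assume x: "x \<in> L"
        \<comment> \<open>The \<open>m\<close> highest coordinates of \<open>x\<close> have been reduced; subtracting a multiple of the row
          \<open>g l\<close> does not change them.\<close>
        have "\<exists>u\<in>?G. \<forall>i. r - m \<le> i \<and> i < r \<longrightarrow> 0 \<le> ?\<kappa> i (x - u) \<and> ?\<kappa> i (x - u) < ?h i" if "m \<le> r" for m
          using that
        proof (induction m)
          case 0
          then show ?case using zmod.subspace_0[OF G] by auto
        next
          case (Suc m)
          then obtain u where u: "u \<in> ?G" "\<forall>i. r - m \<le> i \<and> i < r \<longrightarrow> 0 \<le> ?\<kappa> i (x - u) \<and> ?\<kappa> i (x - u) < ?h i" by auto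
          define l where "l = r - Suc m"
          have l: "l < r" "Suc l = r - m" using Suc.prems by (auto simp: l_def)
          define q where "q = ?\<kappa> l (x - u) div ?h l"
          have xu: "x - u \<in> L" using x u GL L by (auto intro: zmod.subspace_diff)
          have \<kappa>': "?\<kappa> i (x - (u + q *s g l)) = ?\<kappa> i (x - u) - q * ?\<kappa> i (g l)" for i
            using diff_scale[OF xu gL, of i q l] by (simp add: algebra_simps)
          have "u + q *s g l \<in> ?G" using u gG G by (intro zmod.subspace_add zmod.subspace_scale) auto
          moreover have "0 \<le> ?\<kappa> i (x - (u + q *s g l)) \<and> ?\<kappa> i (x - (u + q *s g l)) < ?h i" if i: "l \<le> i" "i < r" for i
          proof (cases "i = l")
            case True
            have "?\<kappa> l (x - u) - q * ?h l = ?\<kappa> l (x - u) mod ?h l"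
              unfolding q_def by (simp add: minus_div_mult_eq_mod)
            then show ?thesis using True h_pos[OF l(1)] by (simp add: \<kappa>')
          next
            case False
            then show ?thesis using u(2) upper[of l i] i l by (simp add: \<kappa>')
          qed
          ultimately show ?case unfolding l_def[symmetric] by blast
        qed
        from this[of r] obtain u where u: "u \<in> ?G" "\<forall>i<r. 0 \<le> ?\<kappa> i (x - u) \<and> ?\<kappa> i (x - u) < ?h i" by auto
        let ?y = "\<lambda>i\<in>{..<r}. ?\<kappa> i (x - u)"
        have xu: "x - u \<in> L" using x u GL L by (auto intro: zmod.subspace_diff)
        have "?rep ?y = (\<Sum>i<r. ?\<kappa> i (x - u) *s b i)" by (rule sum.cong) auto
        also have "\<dots> = x - u" by (rule zcoord_expand[OF b xu])
        finally have "x - ?rep ?y = u" by simp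
        then have "x - ?rep ?y \<in> ?G" using u(1) by (simp only:)
        then have "(\<lambda>g. g + x) ` ?G = (\<lambda>g. g + ?rep ?y) ` ?G" unfolding coset_eq_iff[OF G] .
        moreover have "?y \<in> ?box" using u(2) by auto
        ultimately show "(\<lambda>g. g + x) ` ?G \<in> (\<lambda>y. (\<lambda>g. g + ?rep y) ` ?G) ` ?box" by (rule image_eqI)
      qed
    qed
  qed
  then have "card ((\<lambda>x. (\<lambda>g. g + x) ` ?G) ` L) = card ?box" by (rule bij_betw_same_card[symmetric])
  also have "\<dots> = (\<Prod>i<r. nat (?h i))" by (simp add: card_PiE)
  also have "\<dots> = nat (\<Prod>i<r. ?h i)"
  proof -
    have "int (\<Prod>i<r. nat (?h i)) = (\<Prod>i<r. ?h i)"
      unfolding of_nat_prod using h_pos by (intro prod.cong refl) (simp add: less_imp_le)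
    then have "nat (int (\<Prod>i<r. nat (?h i))) = nat (\<Prod>i<r. ?h i)" by (rule arg_cong)
    then show ?thesis by (simp only: nat_int)
  qed
  also have "\<dots> = nat \<bar>int_det r C\<bar>"
  proof -
    have "0 \<le> (\<Prod>i<r. ?h i)" using h_pos by (intro prod_nonneg) (simp add: less_imp_le)
    then show ?thesis unfolding abs[symmetric] detH by (simp only: abs_of_nonneg)
  qed
  finally show ?thesis .
qed

section \<open>Families that generate a subgroup of finite index\<close>

text \<open>The saturation of \<open>B\<close> in \<open>Z\<close>. Its quotient by \<open>B\<close> is the torsion subgroup of \<open>Z / B\<close>.\<close>

definition sat :: "(int ^ 'c::finite) set \<Rightarrow> (int ^ 'c) set \<Rightarrow> (int ^ 'c) set" where
  "sat Z B = {z \<in> Z. \<exists>N>0. N *s z \<in> B}"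

lemma sat_subspace:
  assumes Z: "zmod.subspace Z" and B: "zmod.subspace B"
  shows "zmod.subspace (sat Z B)"
  unfolding zmod.subspace_def
proof (intro conjI ballI allI)
  show "0 \<in> sat Z B"
    using zmod.subspace_0[OF Z] zmod.subspace_0[OF B] by (auto simp: sat_def intro!: exI[of _ 1])
  fix x assume "x \<in> sat Z B"
  then obtain N where x: "x \<in> Z" "N > 0" "N *s x \<in> B" by (auto simp: sat_def)
  show "x + y \<in> sat Z B" if yB: "y \<in> sat Z B" for y
  proof -
    obtain M where y: "y \<in> Z" "M > 0" "M *s y \<in> B" using yB by (auto simp: sat_def)
    have "(N * M) *s (x + y) = M *s (N *s x) + N *s (M *s y)"
      by (simp add: vector_add_ldistrib vector_smult_assoc mult.commute)
    also have "\<dots> \<in> B" by (rule zmod.subspace_add[OF B zmod.subspace_scale[OF B x(3)] zmod.subspace_scale[OF B y(3)]])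
    finally show ?thesis using x y Z by (auto simp: sat_def zmod.subspace_add intro!: exI[of _ "N * M"])
  qed
  show "c *s x \<in> sat Z B" for c
  proof -
    have "N *s (c *s x) = c *s (N *s x)" by (simp add: vector_smult_assoc mult.commute)
    also have "\<dots> \<in> B" by (rule zmod.subspace_scale[OF B x(3)])
    finally show ?thesis using x Z by (auto simp: sat_def zmod.subspace_scale intro!: exI[of _ N])
  qed
qed

lemma abs_scale_in:
  assumes B: "zmod.subspace B" and "c *s x \<in> B" shows "\<bar>c\<bar> *s x \<in> B"
proof (cases "0 \<le> c")
  case False
  then have "\<bar>c\<bar> *s x = (- 1) *s (c *s x)" by (simp add: vector_smult_assoc)
  also have "\<dots> \<in> B" using assms by (rule zmod.subspace_scale)
  finally show ?thesis .
qed (use assms in simp)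

text \<open>
  Independence over the integers, for families: two equal vectors with different indices are
  dependent, as they have to be when two cells with the same boundary form a cycle.
\<close>

definition zindep :: "'i set \<Rightarrow> ('i \<Rightarrow> int ^ 'c::finite) \<Rightarrow> bool" where
  "zindep E v \<longleftrightarrow> (\<forall>a. (\<Sum>e\<in>E. a e *s v e) = 0 \<longrightarrow> (\<forall>e\<in>E. a e = 0))"

lemma int_span_reindex:
  assumes "bij_betw s {..<r} E" shows "int_span {..<r} (v \<circ> s) = int_span E v"
proof -
  have eq: "(\<Sum>e\<in>E. a e *s v e) = (\<Sum>i<r. a (s i) *s (v \<circ> s) i)" for a
    using sum.reindex_bij_betw[OF assms, of "\<lambda>e. a e *s v e"] by simp
  show ?thesis
  proof
    show "int_span E v \<subseteq> int_span {..<r} (v \<circ> s)"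
    proof
      fix x assume "x \<in> int_span E v"
      then obtain a where x: "x = (\<Sum>e\<in>E. a e *s v e)" by (auto simp: int_span_def)
      show "x \<in> int_span {..<r} (v \<circ> s)" unfolding x eq by (rule int_spanI[of "\<lambda>i. a (s i)"])
    qed
    show "int_span {..<r} (v \<circ> s) \<subseteq> int_span E v"
    proof
      fix x assume "x \<in> int_span {..<r} (v \<circ> s)"
      then obtain a where x: "x = (\<Sum>i<r. a i *s (v \<circ> s) i)" by (auto simp: int_span_def)
      have "x = (\<Sum>e\<in>E. a (inv_into {..<r} s e) *s v e)"
        unfolding eq x using assms by (intro sum.cong refl) (simp add: bij_betw_def)
      then show "x \<in> int_span E v" by (simp only: int_spanI)
    qed
  qed
qed

text \<open>The product of the multipliers works for finitely many elements simultaneously.\<close>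

lemma common_multiple:
  fixes m :: nat
  assumes B: "zmod.subspace B" and ex: "\<And>i. i < m \<Longrightarrow> \<exists>N>0. N *s b i \<in> B"
  shows "\<exists>N>0. \<forall>i<m. N *s (b i :: int ^ 'c::finite) \<in> B"
  using ex
proof (induction m)
  case 0
  show ?case by (intro exI[of _ 1]) simp
next
  case (Suc m)
  then obtain N where N: "N > 0" "\<forall>i<m. N *s b i \<in> B" by auto
  obtain M where M: "M > 0" "M *s b m \<in> B" using Suc by blast
  have "(N * M) *s b i \<in> B" if "i < Suc m" for i
  proof (cases "i = m")
    case True
    then have "(N * M) *s b i = N *s (M *s b m)" by (simp add: vector_smult_assoc)
    also have "\<dots> \<in> B" by (rule zmod.subspace_scale[OF B M(2)])
    finally show ?thesis .
  next
    case False
    have "(N * M) *s b i = M *s (N *s b i)" by (simp add: vector_smult_assoc mult.commute)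
    also have "\<dots> \<in> B" using N(2) that False by - (rule zmod.subspace_scale[OF B], simp)
    finally show ?thesis .
  qed
  then show ?case using N M by (intro exI[of _ "N * M"]) simp
qed

text \<open>
  Some \<open>N > 0\<close> satisfies \<open>N L \<subseteq>\<close> span of \<open>v\<close>. Writing the vectors \<open>N b i\<close> in terms of \<open>v\<close> gives an
  integer matrix \<open>Y\<close> with \<open>C Y = N\<close> (as \<open>b\<close> is a basis) and \<open>Y C = N\<close> (as \<open>v\<close> is independent), where
  \<open>C\<close> holds the coordinates of \<open>v\<close>. Comparing traces shows that \<open>C\<close> is a square matrix, and then
  \<open>det C \<noteq> 0\<close> since \<open>det C det Y\<close> is a power of \<open>N\<close>.
\<close>

lemma basis_criterion_necessary:
  assumes b: "zbasis r b L" and L: "zmod.subspace L" and E: "finite E" and v: "\<And>e. e \<in> E \<Longrightarrow> v e \<in> L"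
    and s: "bij_betw s {0..<card E} E"
    and indep: "zindep E v" and fin: "\<And>x. x \<in> L \<Longrightarrow> \<exists>N>0. N *s x \<in> int_span E v"
  shows "card E = r" "int_det r (\<lambda>i j. zcoord r b i (v (s j))) \<noteq> 0"
proof -
  let ?\<kappa> = "zcoord r b"
  interpret coordinates r ?\<kappa> L by (rule zbasis_coordinates[OF b L])
  have bL: "b i \<in> L" if "i < r" for i using b that by (simp add: zbasis_def)
  note \<kappa>b = zcoord_basis[OF b]
  obtain N where N: "N > 0" "\<forall>i<r. N *s b i \<in> int_span E v"
    using common_multiple[OF int_span_subspace, of r b E v] fin bL by blast
  have "\<exists>Y. \<forall>i<r. N *s b i = (\<Sum>e\<in>E. Y e i *s v e)"
  proof -
    have "\<forall>i. \<exists>y. i < r \<longrightarrow> N *s b i = (\<Sum>e\<in>E. y e *s v e)" using N(2) by (auto simp: int_span_def)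
    then obtain y where "\<forall>i<r. N *s b i = (\<Sum>e\<in>E. y i e *s v e)" by metis
    then show ?thesis by (intro exI[of _ "\<lambda>e i. y i e"]) simp
  qed
  then obtain Y where Y: "\<And>i. i < r \<Longrightarrow> N *s b i = (\<Sum>e\<in>E. Y e i *s v e)" by blast
  have CY: "(\<Sum>e\<in>E. ?\<kappa> k (v e) * Y e i) = (if k = i then N else 0)" if "k < r" "i < r" for k i
  proof -
    have "?\<kappa> k (N *s b i) = (\<Sum>e\<in>E. Y e i * ?\<kappa> k (v e))"
      unfolding Y[OF that(2)] using E v by (rule sum)
    then show ?thesis using that by (cases "k = i") (simp_all add: scale bL \<kappa>b mult.commute)
  qed
  have YC: "(\<Sum>i<r. Y e i * ?\<kappa> i (v e')) = (if e = e' then N else 0)" if "e \<in> E" "e' \<in> E" for e e'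
  proof -
    have "N *s v e' = N *s (\<Sum>i<r. ?\<kappa> i (v e') *s b i)" using zcoord_expand[OF b v[OF that(2)]] by simp
    also have "\<dots> = (\<Sum>i<r. ?\<kappa> i (v e') *s (N *s b i))"
      by (simp add: zmod.scale_sum_right vector_smult_assoc mult.commute)
    also have "\<dots> = (\<Sum>i<r. \<Sum>e\<in>E. (Y e i * ?\<kappa> i (v e')) *s v e)"
      by (simp add: Y zmod.scale_sum_right vector_smult_assoc mult.commute)
    also have "\<dots> = (\<Sum>e\<in>E. (\<Sum>i<r. Y e i * ?\<kappa> i (v e')) *s v e)"
      by (subst sum.swap) (simp add: zmod.scale_sum_left)
    finally have 1: "N *s v e' = (\<Sum>e\<in>E. (\<Sum>i<r. Y e i * ?\<kappa> i (v e')) *s v e)" .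
    have "(\<Sum>e\<in>E. (if e = e' then N else 0) *s v e) = (\<Sum>e\<in>E. if e = e' then N *s v e else 0)"
      by (rule sum.cong) auto
    also have "\<dots> = N *s v e'" using E that by simp
    finally have 2: "(\<Sum>e\<in>E. (if e = e' then N else 0) *s v e) = N *s v e'" .
    have "(\<Sum>e\<in>E. ((\<Sum>i<r. Y e i * ?\<kappa> i (v e')) - (if e = e' then N else 0)) *s v e) = 0"
      unfolding vector_sub_rdistrib sum_subtractf 2 1[symmetric] by simp
    then have "(\<Sum>i<r. Y e i * ?\<kappa> i (v e')) - (if e = e' then N else 0) = 0"
      using indep[unfolded zindep_def, THEN spec[of _ "\<lambda>e. (\<Sum>i<r. Y e i * ?\<kappa> i (v e')) - (if e = e' then N else 0)"]] that(1)
      by simp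
    then show ?thesis by simp
  qed
  \<comment> \<open>The trace of \<open>C Y\<close> is \<open>N r\<close>, that of \<open>Y C\<close> is \<open>N\<close> times the number of elements of \<open>E\<close>.\<close>
  have "N * int r = (\<Sum>k<r. \<Sum>e\<in>E. ?\<kappa> k (v e) * Y e k)" using CY by simp
  also have "\<dots> = (\<Sum>e\<in>E. \<Sum>k<r. Y e k * ?\<kappa> k (v e))"
    by (subst sum.swap) (simp add: mult.commute)
  also have "\<dots> = N * int (card E)" using YC by simp
  finally show card: "card E = r" using N(1) by simp
  have s: "bij_betw s {..<r} E" using s card by (simp add: lessThan_atLeast0)
  have "int_det r (\<lambda>i j. if i = j then N else 0) = int_det r (\<lambda>i j. ?\<kappa> i (v (s j))) * int_det r (\<lambda>j k. Y (s j) k)"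
  proof (rule int_det_mult)
    fix k i assume "k < r" "i < r"
    then show "(if k = i then N else 0) = (\<Sum>j<r. ?\<kappa> k (v (s j)) * Y (s j) i)"
      using CY[of k i] sum.reindex_bij_betw[OF s, of "\<lambda>e. ?\<kappa> k (v e) * Y e i"] by simp
  qed
  moreover have "int_det r (\<lambda>i j. if i = j then N else 0) = N ^ r"
  proof -
    have "Matrix.mat r r (\<lambda>(i, j). if i = j then N else 0) = N \<cdot>\<^sub>m 1\<^sub>m r" by (rule eq_matI) auto
    then show ?thesis by (simp add: int_det_def)
  qed
  ultimately show "int_det r (\<lambda>i j. ?\<kappa> i (v (s j))) \<noteq> 0" using N(1) by auto
qed

text \<open>
  Both statements come from the adjugate of the matrix of coordinates of \<open>v\<close>: it shows that \<open>det\<close>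
  times \<open>L\<close> lies in the span of \<open>v\<close>, and that the coefficients of a relation are annihilated by \<open>det\<close>.
\<close>

lemma basis_criterion_sufficient:
  assumes b: "zbasis r b L" and L: "zmod.subspace L" and v: "\<And>e. e \<in> E \<Longrightarrow> v e \<in> L"
    and s: "bij_betw s {..<r} E" and det: "int_det r (\<lambda>i j. zcoord r b i (v (s j))) \<noteq> 0"
  shows "zindep E v" "x \<in> L \<Longrightarrow> \<exists>N>0. N *s x \<in> int_span E v"
proof -
  let ?\<kappa> = "zcoord r b" and ?C = "\<lambda>i j. zcoord r b i (v (s j))"
  let ?d = "int_det r ?C"
  interpret coordinates r ?\<kappa> L by (rule zbasis_coordinates[OF b L])
  have sE: "s j \<in> E" if "j < r" for j using s that by (auto simp: bij_betw_def)
  have w: "(v \<circ> s) j = (\<Sum>i<r. ?C i j *s b i)" if "j < r" for j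
    using zcoord_expand[OF b v[OF sE[OF that]]] by simp
  show "\<exists>N>0. N *s x \<in> int_span E v" if x: "x \<in> L" for x
  proof -
    have "?d *s x = ?d *s (\<Sum>i<r. ?\<kappa> i x *s b i)" using zcoord_expand[OF b x] by simp
    also have "\<dots> = (\<Sum>i<r. ?\<kappa> i x *s (?d *s b i))"
      by (simp add: zmod.scale_sum_right vector_smult_assoc mult.commute)
    also have "\<dots> \<in> int_span {..<r} (v \<circ> s)"
      by (rule zmod.subspace_sum[OF int_span_subspace], rule zmod.subspace_scale[OF int_span_subspace],
          rule det_scale_in_span[OF w]) auto
    finally have "?d *s x \<in> int_span E v" unfolding int_span_reindex[OF s] .
    from abs_scale_in[OF int_span_subspace this] det show ?thesis
      by (intro exI[of _ "\<bar>?d\<bar>"]) simp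
  qed
  show "zindep E v"
    unfolding zindep_def
  proof (intro allI impI ballI)
    fix a e assume a: "(\<Sum>e\<in>E. a e *s v e) = 0" and e: "e \<in> E"
    obtain k where k: "k < r" "e = s k" using s e by (auto simp: bij_betw_def)
    have E: "finite E" using s bij_betw_finite by blast
    have Ca: "(\<Sum>j<r. ?C i j * a (s j)) = 0" for i
    proof -
      have "?\<kappa> i (\<Sum>e\<in>E. a e *s v e) = (\<Sum>e\<in>E. a e * ?\<kappa> i (v e))" using E v by (rule sum)
      also have "\<dots> = (\<Sum>j<r. a (s j) * ?C i j)" by (rule sum.reindex_bij_betw[OF s, symmetric])
      finally show ?thesis using a zero by (simp add: mult.commute)
    qed
    let ?M = "Matrix.mat r r (\<lambda>(i, j). ?C i j)"
    note adj = adj_mat[of ?M r]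
    have A: "(\<Sum>i<r. adj_mat ?M $$ (k, i) * ?C i j) = (if k = j then ?d else 0)" if "j < r" for j
      using arg_cong[OF adj(3), of "\<lambda>m. m $$ (k, j)"] that k adj(1)
      by (simp add: scalar_prod_def lessThan_atLeast0 int_det_def)
    have "0 = (\<Sum>i<r. adj_mat ?M $$ (k, i) * (\<Sum>j<r. ?C i j * a (s j)))" by (simp add: Ca)
    also have "\<dots> = (\<Sum>j<r. (\<Sum>i<r. adj_mat ?M $$ (k, i) * ?C i j) * a (s j))"
      by (simp add: sum_distrib_left sum_distrib_right mult.assoc) (rule sum.swap)
    also have "\<dots> = (\<Sum>j<r. if k = j then ?d * a (s j) else 0)"
      by (intro sum.cong refl) (simp add: A)
    also have "\<dots> = ?d * a (s k)" using k by simp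
    finally show "a e = 0" using det k by simp
  qed
qed

section \<open>Quotients of lattices: torsion and rank\<close>

text \<open>
  If there were more vectors than coordinates, the matrix of the vectors could be padded with zero
  rows to a square matrix. It would be singular, and a kernel vector over the integers would be a
  relation.
\<close>

lemma zindep_card_le:
  fixes T :: "(int ^ 'c::finite) set"
  assumes T: "finite T" and indep: "zindep T (\<lambda>x. x)"
  shows "card T \<le> CARD('c)"
proof (rule ccontr)
  assume "\<not> card T \<le> CARD('c)"
  then have m: "CARD('c) < card T" by simp
  let ?m = "card T" and ?n = "CARD('c)"
  obtain h :: "nat \<Rightarrow> 'c" where h: "bij_betw h {0..<?n} UNIV"
    using ex_bij_betw_nat_finite[of "UNIV :: 'c set"] by auto
  obtain s where s: "bij_betw s {0..<?m} T" using ex_bij_betw_nat_finite[OF T] by blast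
  let ?A = "Matrix.mat ?m ?m (\<lambda>(i, j). if i < ?n then s j $ h i else 0)"
  have A: "?A \<in> carrier_mat ?m ?m" by simp
  have "Determinant.det (transpose_mat ?A) = 0"
  proof (subst det_0_iff_vec_prod_zero[of _ ?m])
    show "\<exists>v. v \<in> carrier_vec ?m \<and> v \<noteq> 0\<^sub>v ?m \<and> transpose_mat ?A *\<^sub>v v = 0\<^sub>v ?m"
    proof (intro exI conjI)
      show "unit_vec ?m ?n \<in> carrier_vec ?m" by simp
      show "unit_vec ?m ?n \<noteq> (0\<^sub>v ?m :: int Matrix.vec)" using m by simp
      show "transpose_mat ?A *\<^sub>v unit_vec ?m ?n = 0\<^sub>v ?m"
      proof (rule eq_vecI)
        fix i assume i: "i < dim_vec (0\<^sub>v ?m :: int Matrix.vec)"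
        then show "vec_index (transpose_mat ?A *\<^sub>v unit_vec ?m ?n) i = vec_index (0\<^sub>v ?m) i"
          using m by (simp add: scalar_prod_right_unit[of ?n ?m])
      qed simp
    qed
  qed auto
  then have "Determinant.det ?A = 0" by (simp add: Determinant.det_transpose[OF A])
  then obtain v where v: "v \<in> carrier_vec ?m" "v \<noteq> 0\<^sub>v ?m" "?A *\<^sub>v v = 0\<^sub>v ?m"
    using det_0_iff_vec_prod_zero[OF A] by auto
  define a where "a x = vec_index v (inv_into {0..<?m} s x)" for x
  have as: "a (s j) = vec_index v j" if "j < ?m" for j
    using s that unfolding a_def by (subst inv_into_f_f) (auto simp: bij_betw_def)
  have "(\<Sum>x\<in>T. a x *s x) $ c = 0" for c
  proof -
    have "c \<in> h ` {0..<?n}" using h by (simp add: bij_betw_def)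
    then obtain i where i: "i < ?n" "c = h i" by auto
    have "(\<Sum>x\<in>T. a x *s x) $ c = (\<Sum>x\<in>T. a x * x $ h i)" using i by simp
    also have "\<dots> = (\<Sum>j = 0..<?m. a (s j) * s j $ h i)" by (rule sum.reindex_bij_betw[OF s, symmetric])
    also have "\<dots> = (\<Sum>j = 0..<?m. s j $ h i * vec_index v j)" by (rule sum.cong) (auto simp: as mult.commute)
    also have "\<dots> = vec_index (?A *\<^sub>v v) i"
      using i m v(1) by (simp add: scalar_prod_def)
    also have "\<dots> = 0" using v(3) i m by simp
    finally show ?thesis .
  qed
  then have "(\<Sum>x\<in>T. a x *s x) = 0" by (simp add: Finite_Cartesian_Product.vec_eq_iff)
  then have a0: "a x = 0" if "x \<in> T" for x using indep that by (auto simp: zindep_def)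
  have "v = 0\<^sub>v ?m"
  proof (rule eq_vecI)
    fix j assume "j < dim_vec (0\<^sub>v ?m :: int Matrix.vec)"
    then have j: "j < ?m" by simp
    then have "s j \<in> T" using s by (auto simp: bij_betw_def)
    then show "vec_index v j = vec_index (0\<^sub>v ?m) j" using a0[of "s j"] as[OF j] j by simp
  qed (use v in simp)
  then show False using v by simp
qed

abbreviation add_group :: "(int ^ 'c::finite) set \<Rightarrow> (int ^ 'c) monoid" where
  "add_group Z \<equiv> \<lparr>carrier = Z, monoid.mult = (+), one = 0\<rparr>"

lemma add_group_comm_group:
  assumes Z: "zmod.subspace Z" shows "comm_group (add_group Z)"
proof (rule comm_groupI)
  show "\<exists>y\<in>carrier (add_group Z). y \<otimes>\<^bsub>add_group Z\<^esub> x = \<one>\<^bsub>add_group Z\<^esub>" if "x \<in> carrier (add_group Z)" for x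
    using that zmod.subspace_neg[OF Z, of x] by (intro bexI[of _ "- x"]) auto
qed (use Z in \<open>auto simp: zmod.subspace_0 zmod.subspace_add\<close>)

locale lattice_quotient =
  fixes Z B :: "(int ^ 'c::finite) set"
  assumes Z: "zmod.subspace Z" and B: "zmod.subspace B" and BZ: "B \<subseteq> Z"
begin

abbreviation "G \<equiv> add_group Z"
abbreviation "H \<equiv> G Mod B"

sublocale G: comm_group G by (rule add_group_comm_group[OF Z])

lemma inv_G: "x \<in> Z \<Longrightarrow> inv\<^bsub>G\<^esub> x = - x"
  using zmod.subspace_neg[OF Z, of x] by (intro G.inv_equality) auto

lemma subgroup: "subgroup B G"
proof (rule G.subgroupI)
  show "B \<subseteq> carrier G" using BZ by simp
  show "B \<noteq> {}" using zmod.subspace_0[OF B] by blast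
  show "inv\<^bsub>G\<^esub> x \<in> B" if "x \<in> B" for x
    using that BZ zmod.subspace_neg[OF B that] by (simp add: inv_G subset_iff)
  show "x \<otimes>\<^bsub>G\<^esub> y \<in> B" if "x \<in> B" "y \<in> B" for x y
    using zmod.subspace_add[OF B that] by simp
qed

sublocale N: normal B G
  by (rule G.normal_iff_subgroup[THEN iffD2, OF subgroup])

sublocale H: comm_group H
  by (rule G.abelian_FactGroup[OF subgroup])

abbreviation coset :: "int ^ 'c \<Rightarrow> (int ^ 'c) set" where
  "coset x \<equiv> (\<lambda>g. g + x) ` B"

lemma r_coset_eq: "B #>\<^bsub>G\<^esub> x = coset x"
  by (auto simp: r_coset_def)

lemma carrier_H: "carrier H = coset ` Z"
  by (auto simp: FactGroup_def RCOSETS_def r_coset_eq)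

lemma one_H: "\<one>\<^bsub>H\<^esub> = B" by (simp add: FactGroup_def)

lemma coset_eq_one: "coset x = \<one>\<^bsub>H\<^esub> \<longleftrightarrow> x \<in> B"
  using coset_eq_iff[OF B, of x 0] by (simp add: one_H)

lemma coset_hom: "coset \<in> hom G H"
  using N.r_coset_hom_Mod by (simp add: r_coset_eq)

lemma nat_pow_G: "x \<in> Z \<Longrightarrow> x [^]\<^bsub>G\<^esub> (n::nat) = int n *s x"
proof (induction n)
  case 0
  then show ?case by simp
next
  case (Suc n)
  have "x [^]\<^bsub>G\<^esub> Suc n = int n *s x + x" using Suc by simp
  also have "\<dots> = int (Suc n) *s x" by (simp add: Finite_Cartesian_Product.vec_eq_iff algebra_simps)
  finally show ?case .
qed

lemma int_pow_G:
  assumes x: "x \<in> Z" shows "x [^]\<^bsub>G\<^esub> (k::int) = k *s x"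
proof (cases "k < 0")
  case True
  have "x [^]\<^bsub>G\<^esub> k = inv\<^bsub>G\<^esub> (x [^]\<^bsub>G\<^esub> nat (- k))" using True by (simp only: int_pow_def2 if_True)
  also have "\<dots> = - ((- k) *s x)"
    unfolding nat_pow_G[OF x] using True by (subst inv_G) (simp_all add: zmod.subspace_scale[OF Z x] zmod.subspace_neg[OF Z])
  also have "\<dots> = k *s x" by simp
  finally show ?thesis .
next
  case False
  then have "x [^]\<^bsub>G\<^esub> k = x [^]\<^bsub>G\<^esub> nat k" by (simp only: int_pow_def2 if_False)
  then show ?thesis unfolding nat_pow_G[OF x] using False by simp
qed

lemma int_comb_G:
  assumes "finite S" "\<And>x. x \<in> S \<Longrightarrow> c x \<in> Z"
  shows "int_comb G c a S = (\<Sum>x\<in>S. a x *s c x)"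
  using assms
proof (induction S)
  case (insert x S)
  then have "int_comb G c a (insert x S) = c x [^]\<^bsub>G\<^esub> a x \<otimes>\<^bsub>G\<^esub> int_comb G c a S"
    by (intro G.int_comb_insert) auto
  then show ?case using insert by (simp add: int_pow_G)
qed simp

text \<open>The \<open>n\<close>-th power of the coset of \<open>z\<close> is the coset of \<open>n z\<close>, which is trivial iff \<open>n z \<in> B\<close>.\<close>

lemma torsion_elements:
  "{x \<in> carrier H. \<exists>n::nat. n > 0 \<and> x [^]\<^bsub>H\<^esub> n = \<one>\<^bsub>H\<^esub>} = coset ` sat Z B"
proof -
  have pow: "coset z [^]\<^bsub>H\<^esub> (n::nat) = coset (int n *s z)" if "z \<in> Z" for z n
    using N.FactGroup_int_pow[of z "int n"] that by (simp add: r_coset_eq int_pow_int int_pow_G nat_pow_G)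
  have "(\<exists>n::nat. n > 0 \<and> coset z [^]\<^bsub>H\<^esub> n = \<one>\<^bsub>H\<^esub>) \<longleftrightarrow> (\<exists>N>0. N *s z \<in> B)" if z: "z \<in> Z" for z
  proof
    assume "\<exists>n::nat. n > 0 \<and> coset z [^]\<^bsub>H\<^esub> n = \<one>\<^bsub>H\<^esub>"
    then obtain n :: nat where "n > 0" "coset (int n *s z) = \<one>\<^bsub>H\<^esub>" using pow[OF z] by auto
    then show "\<exists>N>0. N *s z \<in> B" using coset_eq_one by (intro exI[of _ "int n"]) auto
  next
    assume "\<exists>N>0. N *s z \<in> B"
    then obtain N where N: "N > 0" "N *s z \<in> B" by blast
    then have "coset (int (nat N) *s z) = \<one>\<^bsub>H\<^esub>" using coset_eq_one by simp
    then show "\<exists>n::nat. n > 0 \<and> coset z [^]\<^bsub>H\<^esub> n = \<one>\<^bsub>H\<^esub>"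
      using N pow[OF z, of "nat N"] by (intro exI[of _ "nat N"]) simp
  qed
  then show ?thesis unfolding carrier_H sat_def by blast
qed

text \<open>Independence of the cosets, expressed by vectors instead of elements of the quotient group.\<close>

definition indep_mod :: "(int ^ 'c) set \<Rightarrow> bool" where
  "indep_mod T \<longleftrightarrow> finite T \<and> T \<subseteq> Z \<and> (\<forall>a. (\<Sum>z\<in>T. a z *s z) \<in> B \<longrightarrow> (\<forall>z\<in>T. a z = 0))"

text \<open>
  Independent sets in \<open>Z / B\<close> and sets of vectors that are independent modulo \<open>B\<close> have the same
  cardinalities: choose representatives, and conversely take cosets. The latter is injective, since
  two vectors in the same coset satisfy the relation \<open>x - y \<in> B\<close>.
\<close>

lemma abelian_rank_eq: "abelian_rank H = Sup {card T | T. indep_mod T}"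
proof -
  define I where "I S \<longleftrightarrow> finite S \<and> S \<subseteq> carrier H \<and>
       (\<forall>a :: _ \<Rightarrow> int. finprod H (\<lambda>x. x [^]\<^bsub>H\<^esub> a x) S = \<one>\<^bsub>H\<^esub> \<longrightarrow> (\<forall>x \<in> S. a x = 0))" for S
  have comb: "finprod H (\<lambda>x. coset (\<rho> x) [^]\<^bsub>H\<^esub> a x) S = coset (\<Sum>x\<in>S. a x *s \<rho> x)"
    if "finite S" "\<And>x. x \<in> S \<Longrightarrow> \<rho> x \<in> Z" for S and \<rho> :: "'x \<Rightarrow> int ^ 'c" and a
  proof -
    have "coset (int_comb G \<rho> a S) = int_comb H (coset \<circ> \<rho>) a S"
      by (rule hom_int_comb[OF coset_hom G.comm_group_axioms H.comm_group_axioms]) (use that in auto)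
    then show ?thesis using int_comb_G[of S \<rho> a] that by (simp add: int_comb_def)
  qed
  have 1: "\<exists>T. indep_mod T \<and> card T = card S" if S: "I S" for S
  proof -
    have fin: "finite S" and sub: "S \<subseteq> carrier H" using S by (auto simp: I_def)
    have "\<forall>x\<in>S. \<exists>z\<in>Z. coset z = x" using sub unfolding carrier_H by blast
    then obtain \<rho> where \<rho>: "\<And>x. x \<in> S \<Longrightarrow> \<rho> x \<in> Z" "\<And>x. x \<in> S \<Longrightarrow> coset (\<rho> x) = x" by metis
    have inj: "inj_on \<rho> S" by (rule inj_onI) (metis \<rho>(2))
    have "indep_mod (\<rho> ` S)"
      unfolding indep_mod_def
    proof (intro conjI allI impI)
      show "finite (\<rho> ` S)" using fin by simp
      show "\<rho> ` S \<subseteq> Z" using \<rho> by blast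
      fix a assume "(\<Sum>z\<in>\<rho> ` S. a z *s z) \<in> B"
      then have sB: "(\<Sum>x\<in>S. a (\<rho> x) *s \<rho> x) \<in> B" by (simp add: sum.reindex[OF inj])
      have "finprod H (\<lambda>x. x [^]\<^bsub>H\<^esub> a (\<rho> x)) S = finprod H (\<lambda>x. coset (\<rho> x) [^]\<^bsub>H\<^esub> a (\<rho> x)) S"
        by (rule H.finprod_cong'[OF refl]) (use sub \<rho>(2) in auto)
      also have "\<dots> = coset (\<Sum>x\<in>S. a (\<rho> x) *s \<rho> x)" by (rule comb) (use fin \<rho> in auto)
      also have "\<dots> = \<one>\<^bsub>H\<^esub>" using sB unfolding coset_eq_one .
      finally have "\<forall>x\<in>S. a (\<rho> x) = 0" using S[unfolded I_def, THEN conjunct2, THEN conjunct2, THEN spec[of _ "\<lambda>x. a (\<rho> x)"]] by simp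
      then show "\<forall>z\<in>\<rho> ` S. a z = 0" by blast
    qed
    then show ?thesis using card_image[OF inj] by blast
  qed
  have 2: "\<exists>S. I S \<and> card S = card T" if T: "indep_mod T" for T
  proof -
    have TZ: "finite T" "T \<subseteq> Z" using T by (auto simp: indep_mod_def)
    have inj: "inj_on coset T"
    proof (rule inj_onI, rule ccontr)
      fix x y assume xy: "x \<in> T" "y \<in> T" "coset x = coset y" "x \<noteq> y"
      let ?a = "\<lambda>z. if z = x then 1 else if z = y then - 1 else (0::int)"
      have "(\<Sum>z\<in>T. ?a z *s z) = (\<Sum>z\<in>T. (if z = x then z else 0) - (if z = y then z else 0))"
        using xy(4) by (intro sum.cong) auto
      also have "\<dots> = x - y" using xy TZ by (simp add: sum_subtractf)
      also have "\<dots> \<in> B" using xy(3) unfolding coset_eq_iff[OF B] .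
      finally show False
        using T[unfolded indep_mod_def, THEN conjunct2, THEN conjunct2, THEN spec[of _ ?a]] xy(1) by auto
    qed
    have "I (coset ` T)"
      unfolding I_def
    proof (intro conjI allI impI)
      show "finite (coset ` T)" using TZ by simp
      show sub: "coset ` T \<subseteq> carrier H" unfolding carrier_H using TZ(2) by (rule image_mono)
      fix a :: "(int ^ 'c) set \<Rightarrow> int"
      assume 1: "finprod H (\<lambda>x. x [^]\<^bsub>H\<^esub> a x) (coset ` T) = \<one>\<^bsub>H\<^esub>"
      have "finprod H (\<lambda>x. x [^]\<^bsub>H\<^esub> a x) (coset ` T) = finprod H (\<lambda>z. coset z [^]\<^bsub>H\<^esub> a (coset z)) T"
        by (rule H.finprod_reindex[OF _ inj]) (use sub in auto)
      also have "\<dots> = coset (\<Sum>z\<in>T. a (coset z) *s z)" by (rule comb) (use TZ in auto)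
      finally have "coset (\<Sum>z\<in>T. a (coset z) *s z) = \<one>\<^bsub>H\<^esub>" using 1 by (simp only:)
      then have "(\<Sum>z\<in>T. a (coset z) *s z) \<in> B" unfolding coset_eq_one .
      then have "\<forall>z\<in>T. a (coset z) = 0"
        using T[unfolded indep_mod_def, THEN conjunct2, THEN conjunct2, THEN spec[of _ "\<lambda>z. a (coset z)"]] by simp
      then show "\<forall>x\<in>coset ` T. a x = 0" by blast
    qed
    then show ?thesis using card_image[OF inj] by blast
  qed
  have "{card S | S. I S} = {card T | T. indep_mod T}"
    using 1 2 by (auto; metis)
  then show ?thesis unfolding abelian_rank_def I_def by (rule arg_cong)
qed

lemma indep_mod_card_le: "indep_mod T \<Longrightarrow> card T \<le> CARD('c)"
proof (rule zindep_card_le)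
  assume T: "indep_mod T"
  show "finite T" using T by (simp add: indep_mod_def)
  show "zindep T (\<lambda>x. x)"
    unfolding zindep_def
  proof (intro allI impI)
    fix a assume "(\<Sum>e\<in>T. a e *s e) = 0"
    then have "(\<Sum>e\<in>T. a e *s e) \<in> B" using zmod.subspace_0[OF B] by simp
    then show "\<forall>e\<in>T. a e = 0" using T[unfolded indep_mod_def, THEN conjunct2, THEN conjunct2, THEN spec[of _ a]] by simp
  qed
qed

end

text \<open>
  If every element of \<open>B\<close> has a positive multiple in \<open>B'\<close>, clearing denominators shows that the same sets are
  independent modulo \<open>B\<close> and modulo \<open>B'\<close>. Otherwise some \<open>x \<in> B\<close> has no multiple in \<open>B'\<close>, and adding
  it to a maximal set that is independent modulo \<open>B\<close> gives a larger set independent modulo \<open>B'\<close>.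
  The maximum exists because independent sets are bounded in size by the number of coordinates.
\<close>

lemma abelian_rank_eq_iff:
  fixes Z :: "(int ^ 'c::finite) set"
  assumes B: "lattice_quotient Z B" and B': "lattice_quotient Z B'" and sub: "B' \<subseteq> B"
  shows "abelian_rank (add_group Z Mod B') = abelian_rank (add_group Z Mod B) \<longleftrightarrow> (\<forall>x\<in>B. \<exists>N>0. N *s x \<in> B')"
proof -
  interpret B: lattice_quotient Z B by fact
  interpret B': lattice_quotient Z B' by fact
  have mono: "B'.indep_mod T" if "B.indep_mod T" for T
    using that sub by (auto simp: B.indep_mod_def B'.indep_mod_def)
  show ?thesis
  proof
    assume R: "\<forall>x\<in>B. \<exists>N>0. N *s x \<in> B'"
    have "B.indep_mod T" if T: "B'.indep_mod T" for T
      unfolding B.indep_mod_def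
    proof (intro conjI allI impI)
      show "finite T" "T \<subseteq> Z" using T by (auto simp: B'.indep_mod_def)
      fix a assume "(\<Sum>z\<in>T. a z *s z) \<in> B"
      then obtain N where N: "N > 0" "N *s (\<Sum>z\<in>T. a z *s z) \<in> B'" using R by blast
      then have "(\<Sum>z\<in>T. (N * a z) *s z) \<in> B'" by (simp add: zmod.scale_sum_right vector_smult_assoc)
      then have "\<forall>z\<in>T. N * a z = 0"
        using T[unfolded B'.indep_mod_def, THEN conjunct2, THEN conjunct2, THEN spec[of _ "\<lambda>z. N * a z"]] by simp
      then show "\<forall>z\<in>T. a z = 0" using N(1) by simp
    qed
    then show "abelian_rank (add_group Z Mod B') = abelian_rank (add_group Z Mod B)"
      unfolding B.abelian_rank_eq B'.abelian_rank_eq using mono by metis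
  next
    assume eq: "abelian_rank (add_group Z Mod B') = abelian_rank (add_group Z Mod B)"
    show "\<forall>x\<in>B. \<exists>N>0. N *s x \<in> B'"
    proof (rule ccontr)
      assume "\<not> (\<forall>x\<in>B. \<exists>N>0. N *s x \<in> B')"
      then obtain x where x: "x \<in> B" "\<And>N. N > 0 \<Longrightarrow> N *s x \<notin> B'" by blast
      let ?K = "{card T | T. B.indep_mod T}" and ?K' = "{card T | T. B'.indep_mod T}"
      have fin: "finite ?K" "finite ?K'"
        using B.indep_mod_card_le B'.indep_mod_card_le by (auto intro!: finite_subset[of _ "{..CARD('c)}"])
      have "B.indep_mod {}" by (simp add: B.indep_mod_def)
      then have "?K \<noteq> {}" by blast
      have "Sup ?K \<in> ?K"
        using Max_in[OF fin(1) \<open>?K \<noteq> {}\<close>] cSup_eq_Max[OF fin(1) \<open>?K \<noteq> {}\<close>] by simp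
      then obtain T where T: "B.indep_mod T" "card T = Sup ?K" by auto
      have TT: "finite T" "T \<subseteq> Z" using T(1) by (auto simp: B.indep_mod_def)
      have indT: "a z = 0" if "(\<Sum>z\<in>T. a z *s z) \<in> B" "z \<in> T" for a z
        using T(1) that unfolding B.indep_mod_def by blast
      have "x \<notin> T"
      proof
        assume xT: "x \<in> T"
        have "(\<Sum>z\<in>T. (if z = x then 1 else 0) *s z) = (\<Sum>z\<in>T. if z = x then z else 0)"
          by (rule sum.cong) auto
        then have "(\<Sum>z\<in>T. (if z = x then 1 else 0) *s z) = x" using xT TT by simp
        then have "(if x = x then 1 else 0 :: int) = 0"
          using indT[of "\<lambda>z. if z = x then 1 else 0" x] x(1) xT by simp
        then show False by simp
      qed
      have "B'.indep_mod (insert x T)"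
        unfolding B'.indep_mod_def
      proof (intro conjI allI impI)
        show "finite (insert x T)" "insert x T \<subseteq> Z" using TT x(1) B.BZ by auto
        fix a assume s: "(\<Sum>z\<in>insert x T. a z *s z) \<in> B'"
        have sum: "(\<Sum>z\<in>insert x T. a z *s z) = a x *s x + (\<Sum>z\<in>T. a z *s z)" using TT \<open>x \<notin> T\<close> by simp
        then have "(\<Sum>z\<in>T. a z *s z) = (\<Sum>z\<in>insert x T. a z *s z) - a x *s x" by simp
        also have "\<dots> \<in> B" using s sub by (intro zmod.subspace_diff[OF B.B] zmod.subspace_scale[OF B.B] x(1)) auto
        finally have T0: "\<forall>z\<in>T. a z = 0" using indT by blast
        then have "a x *s x \<in> B'" using s unfolding sum by simp
        then have "\<bar>a x\<bar> *s x \<in> B'" by (rule abs_scale_in[OF B'.B])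
        then have "a x = 0" using x(2)[of "\<bar>a x\<bar>"] by auto
        then show "\<forall>z\<in>insert x T. a z = 0" using T0 by simp
      qed
      then have "card (insert x T) \<le> Sup ?K'" by (intro cSup_upper bdd_above_finite fin) blast
      then show False using eq T(2) TT \<open>x \<notin> T\<close> unfolding B.abelian_rank_eq B'.abelian_rank_eq by simp
    qed
  qed
qed

section \<open>The Cauchy--Binet formula for \<open>A A\<^sup>T\<close>\<close>

text \<open>
  The columns are selected by an enumeration \<open>s\<close> rather than a set, because the expansion of the
  determinant runs over all functions \<open>s\<close>, in any order and with repetitions.
\<close>

definition minor :: "nat \<Rightarrow> (nat \<Rightarrow> 'e \<Rightarrow> 'a::comm_ring_1) \<Rightarrow> (nat \<Rightarrow> 'e) \<Rightarrow> 'a" where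
  "minor r A s = Determinant.det (Matrix.mat r r (\<lambda>(i, j). A i (s j)))"

lemma minor_cong: "(\<And>i j. i < r \<Longrightarrow> j < r \<Longrightarrow> A i (s j) = A' i (s' j)) \<Longrightarrow> minor r A s = minor r A' s'"
  unfolding minor_def by (rule arg_cong[where f = Determinant.det]) (auto intro!: eq_matI)

lemma minor_permute:
  assumes p: "p permutes {0..<r}"
  shows "minor r A (s \<circ> p) = signof p * minor r A s"
proof -
  let ?M = "Matrix.mat r r (\<lambda>(i, j). A j (s i))"
  have T: "minor r A t = Determinant.det (Matrix.mat r r (\<lambda>(i, j). A j (t i)))" for t
  proof -
    have "Matrix.mat r r (\<lambda>(i, j). A i (t j)) = transpose_mat (Matrix.mat r r (\<lambda>(i, j). A j (t i)))"
      by (auto intro!: eq_matI)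
    then show ?thesis unfolding minor_def by (simp add: det_transpose[of _ r])
  qed
  have "minor r A (s \<circ> p) = Determinant.det (Matrix.mat r r (\<lambda>(i, j). ?M $$ (p i, j)))"
    unfolding T using permutes_in_image[OF p]
    by (intro arg_cong[where f = Determinant.det] eq_matI) auto
  also have "\<dots> = signof p * Determinant.det ?M"
    by (rule det_permute_rows[OF _ p]) simp
  finally show ?thesis unfolding T .
qed

lemma minor_not_inj:
  fixes A :: "nat \<Rightarrow> 'e \<Rightarrow> 'a::comm_ring_1"
  assumes "\<not> inj_on s {0..<r}"
  shows "minor r A s = 0"
proof -
  obtain i j where ij: "i < r" "j < r" "i \<noteq> j" "s i = s j"
    using assms by (auto simp: inj_on_def)
  have "minor r A s = Determinant.det (transpose_mat (Matrix.mat r r (\<lambda>(i, j). A i (s j))))"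
    unfolding minor_def by (simp add: det_transpose[of _ r])
  also have "\<dots> = 0"
    by (rule det_identical_rows[of _ r i j]) (use ij in \<open>auto intro!: eq_vecI\<close>)
  finally show ?thesis .
qed

text \<open>
  Leibniz formula for \<open>A A\<^sup>T\<close>, with the product of sums expanded into a sum over the functions that
  pick one column for each row.
\<close>

lemma det_expand_columns:
  fixes A :: "nat \<Rightarrow> 'e \<Rightarrow> 'a::comm_ring_1"
  assumes D: "finite D"
  shows "Determinant.det (Matrix.mat r r (\<lambda>(i, k). \<Sum>e\<in>D. A i e * A k e)) =
    (\<Sum>s \<in> PiE {0..<r} (\<lambda>_. D). (\<Prod>i<r. A i (s i)) * minor r A s)"
proof -
  have "Determinant.det (Matrix.mat r r (\<lambda>(i, k). \<Sum>e\<in>D. A i e * A k e))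
      = (\<Sum>p | p permutes {0..<r}. signof p * (\<Prod>i = 0..<r. \<Sum>e\<in>D. A i e * A (p i) e))"
    by (subst det_def'[of _ r]) (auto intro!: sum.cong prod.cong arg_cong2[where f = "(*)"] dest: permutes_in_image)
  also have "\<dots> = (\<Sum>p | p permutes {0..<r}. \<Sum>s \<in> PiE {0..<r} (\<lambda>_. D). (\<Prod>i = 0..<r. A i (s i)) * (signof p * (\<Prod>i = 0..<r. A (p i) (s i))))"
    using D by (intro sum.cong refl) (simp add: prod_sum_PiE sum_distrib_left prod.distrib mult_ac)
  also have "\<dots> = (\<Sum>s \<in> PiE {0..<r} (\<lambda>_. D). (\<Prod>i = 0..<r. A i (s i)) * (\<Sum>p | p permutes {0..<r}. signof p * (\<Prod>i = 0..<r. A (p i) (s i))))"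
    by (subst sum.swap) (simp add: sum_distrib_left)
  also have "\<dots> = (\<Sum>s \<in> PiE {0..<r} (\<lambda>_. D). (\<Prod>i<r. A i (s i)) * minor r A s)"
  proof (intro sum.cong refl arg_cong2[where f = "(*)"])
    fix s
    have "minor r A s = Determinant.det (transpose_mat (Matrix.mat r r (\<lambda>(i, j). A i (s j))))"
      unfolding minor_def by (simp add: det_transpose[of _ r])
    also have "\<dots> = (\<Sum>p | p permutes {0..<r}. signof p * (\<Prod>i = 0..<r. A (p i) (s i)))"
      by (subst det_def'[of _ r]) (auto intro!: sum.cong prod.cong arg_cong2[where f = "(*)"] dest: permutes_in_image)
    finally show "(\<Sum>p | p permutes {0..<r}. signof p * (\<Prod>i = 0..<r. A (p i) (s i))) = minor r A s" ..
  qed (simp add: lessThan_atLeast0)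
  finally show ?thesis .
qed

text \<open>
  The injective functions with image \<open>E\<close> are the permutations of one fixed enumeration of \<open>E\<close>. The
  restriction gives them the undefined value outside of the index range that the elements of the
  function space must have.
\<close>

lemma bij_betw_permutes_enumerations:
  assumes b: "bij_betw t {0..<r} E" and ED: "E \<subseteq> D"
  shows "bij_betw (\<lambda>p. restrict (t \<circ> p) {0..<r}) {p. p permutes {0..<r}}
    {s \<in> {s \<in> PiE {0..<r} (\<lambda>_. D). inj_on s {0..<r}}. s ` {0..<r} = E}"
    (is "bij_betw ?g ?P ?S")
proof (rule bij_betw_byWitness[where f' = "\<lambda>s x. if x \<in> {0..<r} then inv_into {0..<r} t (s x) else x"])
  let ?h = "\<lambda>s x. if x \<in> {0..<r} then inv_into {0..<r} t (s x) else x"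
  show "\<forall>p\<in>?P. ?h (?g p) = p"
  proof (intro ballI ext)
    fix p x assume "p \<in> ?P"
    then have p: "p permutes {0..<r}" by simp
    show "?h (?g p) x = p x"
    proof (cases "x \<in> {0..<r}")
      case True
      then have "p x \<in> {0..<r}" by (simp only: permutes_in_image[OF p])
      then have "inv_into {0..<r} t (t (p x)) = p x"
        by (rule inv_into_f_f[OF bij_betw_imp_inj_on[OF b]])
      then show ?thesis using True by simp
    next
      case False
      show ?thesis unfolding if_not_P[OF False] using permutes_not_in[OF p False] by (rule sym)
    qed
  qed
  show "\<forall>s\<in>?S. ?g (?h s) = s"
  proof (intro ballI ext)
    fix s x assume s: "s \<in> ?S"
    show "?g (?h s) x = s x"
    proof (cases "x \<in> {0..<r}")
      case True
      then have "s x \<in> t ` {0..<r}" using s b by (auto simp: bij_betw_def)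
      then have "t (inv_into {0..<r} t (s x)) = s x" by (rule f_inv_into_f)
      then show ?thesis using True by simp
    next
      case False
      then show ?thesis using s by (auto simp: PiE_iff extensional_def)
    qed
  qed
  show "?g ` ?P \<subseteq> ?S"
  proof (rule image_subsetI)
    fix p assume "p \<in> ?P"
    then have bp: "bij_betw (t \<circ> p) {0..<r} E"
      using bij_betw_trans[OF permutes_imp_bij b] by simp
    have "bij_betw (?g p) {0..<r} E"
      using bp by (subst bij_betw_cong[of _ _ "t \<circ> p"]) auto
    then show "?g p \<in> ?S" using ED by (auto simp: bij_betw_def PiE_iff)
  qed
  show "?h ` ?S \<subseteq> ?P"
  proof (rule image_subsetI)
    fix s assume "s \<in> ?S"
    then have bs: "bij_betw s {0..<r} E" by (simp add: bij_betw_def)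
    have "bij_betw (inv_into {0..<r} t \<circ> s) {0..<r} {0..<r}"
      using bij_betw_trans[OF bs bij_betw_inv_into[OF b]] .
    then have "bij_betw (?h s) {0..<r} {0..<r}"
      by (subst bij_betw_cong[of _ _ "inv_into {0..<r} t \<circ> s"]) auto
    then have "?h s permutes {0..<r}" by (rule bij_imp_permutes) (rule if_not_P)
    then show "?h s \<in> ?P" by simp
  qed
qed

text \<open>
  In the expansion over all functions \<open>s\<close> those that repeat a column contribute 0. The others are
  grouped by their image \<open>E\<close>: the permutations of an enumeration of \<open>E\<close> change the minor by their
  signs, and the signed sum of the products is the minor again.
\<close>

lemma cauchy_binet_square:
  fixes A :: "nat \<Rightarrow> 'e \<Rightarrow> 'a::comm_ring_1"
  assumes D: "finite D"
    and enum: "\<And>E. E \<subseteq> D \<Longrightarrow> card E = r \<Longrightarrow> bij_betw (enum E) {0..<r} E"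
  shows "Determinant.det (Matrix.mat r r (\<lambda>(i, k). \<Sum>e\<in>D. A i e * A k e)) =
    (\<Sum>E | E \<subseteq> D \<and> card E = r. (minor r A (enum E))\<^sup>2)"
proof -
  let ?F = "PiE {0..<r} (\<lambda>_. D)"
  let ?I = "{s \<in> ?F. inj_on s {0..<r}}"
  let ?f = "\<lambda>s. (\<Prod>i<r. A i (s i)) * minor r A s"
  have fin: "finite ?F" using D by (intro finite_PiE) auto
  have "Determinant.det (Matrix.mat r r (\<lambda>(i, k). \<Sum>e\<in>D. A i e * A k e)) = (\<Sum>s\<in>?F. ?f s)"
    by (rule det_expand_columns[OF D])
  also have "\<dots> = (\<Sum>s\<in>?I. ?f s)"
    using fin by (intro sum.mono_neutral_right) (auto simp: minor_not_inj)
  also have "\<dots> = (\<Sum>E | E \<subseteq> D \<and> card E = r. \<Sum>s | s \<in> ?I \<and> s ` {0..<r} = E. ?f s)"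
  proof (rule sum.group[symmetric])
    show "finite ?I" using fin by simp
    show "finite {E. E \<subseteq> D \<and> card E = r}" using D by simp
    show "(\<lambda>s. s ` {0..<r}) ` ?I \<subseteq> {E. E \<subseteq> D \<and> card E = r}"
      by (auto simp: card_image PiE_iff)
  qed
  also have "\<dots> = (\<Sum>E | E \<subseteq> D \<and> card E = r. (minor r A (enum E))\<^sup>2)"
  proof (rule sum.cong[OF refl])
    fix E assume "E \<in> {E. E \<subseteq> D \<and> card E = r}"
    then have E: "E \<subseteq> D" "card E = r" by auto
    note b = enum[OF E]
    let ?P = "{p. p permutes {0..<r}}"
    let ?g = "\<lambda>p. restrict (enum E \<circ> p) {0..<r}"
    have "(\<Sum>s | s \<in> ?I \<and> s ` {0..<r} = E. ?f s) = (\<Sum>p\<in>?P. ?f (?g p))"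
      by (rule sum.reindex_bij_betw[OF bij_betw_permutes_enumerations[OF b E(1)], symmetric])
    also have "\<dots> = (\<Sum>p\<in>?P. minor r A (enum E) * (signof p * (\<Prod>i = 0..<r. A i (enum E (p i)))))"
    proof (rule sum.cong[OF refl])
      fix p assume "p \<in> ?P"
      then have p: "p permutes {0..<r}" by simp
      have "minor r A (?g p) = minor r A (enum E \<circ> p)" by (rule minor_cong) auto
      also have "\<dots> = signof p * minor r A (enum E)" by (rule minor_permute[OF p])
      finally have "minor r A (?g p) = signof p * minor r A (enum E)" .
      moreover have "(\<Prod>i<r. A i (?g p i)) = (\<Prod>i = 0..<r. A i (enum E (p i)))"
        by (rule prod.cong) auto
      ultimately show "?f (?g p) = minor r A (enum E) * (signof p * (\<Prod>i = 0..<r. A i (enum E (p i))))"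
        by (simp add: mult_ac)
    qed
    also have "\<dots> = minor r A (enum E) * minor r A (enum E)"
      unfolding sum_distrib_left[symmetric] minor_def
      by (subst (3) det_def'[of _ r])
         (auto intro!: arg_cong2[where f = "(*)"] sum.cong prod.cong dest: permutes_in_image)
    finally show "(\<Sum>s | s \<in> ?I \<and> s ` {0..<r} = E. ?f s) = (minor r A (enum E))\<^sup>2"
      by (simp add: power2_eq_square)
  qed
  finally show ?thesis .
qed

section \<open>The volume of a parallelotope\<close>

text \<open>
  Comparison of the determinant of a matrix indexed by a finite type with that of a matrix indexed by
  numbers. Conjugation by the enumeration \<open>h\<close> identifies the two permutation groups and preserves
  signs.
\<close>

lemma det_reindex:
  fixes M :: "'a::comm_ring_1 ^ 'n ^ 'n"
  assumes h: "bij_betw h {0..<n} (UNIV :: 'n set)"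
  shows "Determinants.det M = Determinant.det (Matrix.mat n n (\<lambda>(i, j). M $ h i $ h j))"
proof -
  let ?S = "{0..<n}"
  have inj: "inj_on h ?S" and im: "h ` ?S = UNIV" using h by (auto simp: bij_betw_def)
  let ?\<Phi> = "map_permutation ?S h"
  have app: "?\<Phi> p (h i) = h (p i)" if "i < n" "p permutes ?S" for p i
    using map_permutation_apply[OF inj, of i p] that by simp
  have bij: "bij_betw ?\<Phi> {p. p permutes ?S} {p. p permutes (UNIV :: 'n set)}"
  proof (rule bij_betw_imageI)
    show "inj_on ?\<Phi> {p. p permutes ?S}"
    proof (rule inj_onI, rule ext)
      fix p q x assume pq: "p \<in> {p. p permutes ?S}" "q \<in> {p. p permutes ?S}" and eq: "?\<Phi> p = ?\<Phi> q"
      show "p x = q x"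
      proof (cases "x < n")
        case True
        then have "h (p x) = h (q x)" using app pq eq by (metis mem_Collect_eq)
        moreover have "p x \<in> ?S" "q x \<in> ?S" using True pq permutes_in_image[of _ ?S x] by auto
        ultimately show ?thesis using inj by (meson inj_onD)
      next
        case False
        then show ?thesis using pq by (metis atLeastLessThan_iff mem_Collect_eq permutes_not_in)
      qed
    qed
    show "?\<Phi> ` {p. p permutes ?S} = {p. p permutes (UNIV :: 'n set)}"
    proof (rule card_subset_eq[symmetric, THEN sym])
      show "finite {p. p permutes (UNIV :: 'n set)}" by (rule finite_permutations) simp
      show "?\<Phi> ` {p. p permutes ?S} \<subseteq> {p. p permutes (UNIV :: 'n set)}"
        using map_permutation_permutes[OF h] by auto
      have "card (?\<Phi> ` {p. p permutes ?S}) = card {p. p permutes ?S}"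
        by (rule card_image) fact
      also have "\<dots> = fact n" by (subst card_permutations[of _ n]) auto
      also have "\<dots> = card {p. p permutes (UNIV :: 'n set)}"
        using bij_betw_same_card[OF h] by (subst card_permutations[of _ n]) auto
      finally show "card (?\<Phi> ` {p. p permutes ?S}) = card {p. p permutes (UNIV :: 'n set)}" .
    qed
  qed
  have "Determinants.det M = (\<Sum>p | p permutes (UNIV :: 'n set). of_int (sign p) * (\<Prod>i\<in>UNIV. M $ i $ p i))"
    by (simp add: Determinants.det_def)
  also have "\<dots> = (\<Sum>p | p permutes ?S. of_int (sign (?\<Phi> p)) * (\<Prod>i\<in>UNIV. M $ i $ ?\<Phi> p i))"
    by (rule sum.reindex_bij_betw[OF bij, symmetric])
  also have "\<dots> = (\<Sum>p | p permutes ?S. of_int (sign p) * (\<Prod>i = 0..<n. M $ h i $ h (p i)))"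
  proof (rule sum.cong[OF refl])
    fix p assume "p \<in> {p. p permutes ?S}"
    then have p: "p permutes ?S" by simp
    have "(\<Prod>i\<in>UNIV. M $ i $ ?\<Phi> p i) = (\<Prod>i = 0..<n. M $ h i $ ?\<Phi> p (h i))"
      by (rule prod.reindex_bij_betw[OF h, symmetric])
    also have "\<dots> = (\<Prod>i = 0..<n. M $ h i $ h (p i))"
      using app p by (intro prod.cong) auto
    finally show "of_int (sign (?\<Phi> p)) * (\<Prod>i\<in>UNIV. M $ i $ ?\<Phi> p i) = of_int (sign p) * (\<Prod>i = 0..<n. M $ h i $ h (p i))"
      by (simp add: sign_map_permutation[OF inj p])
  qed
  also have "\<dots> = Determinant.det (Matrix.mat n n (\<lambda>(i, j). M $ h i $ h j))"
    by (subst Determinant.det_def'[of _ n])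
       (auto intro!: sum.cong prod.cong arg_cong2[where f = "(*)"] dest: permutes_in_image)
  finally show ?thesis .
qed

lemma emeasure_lborel_box:
  fixes B :: "'n::finite \<Rightarrow> real set"
  assumes [measurable]: "\<And>k. B k \<in> sets borel"
  shows "emeasure lborel {x :: real ^ 'n. \<forall>k. x $ k \<in> B k} = (\<Prod>k\<in>UNIV. emeasure lborel (B k))"
    and "{x :: real ^ 'n. \<forall>k. x $ k \<in> B k} \<in> sets borel"
proof -
  let ?S = "{x :: real ^ 'n. \<forall>k. x $ k \<in> B k}"
  have S: "?S = (\<Inter>k. (\<lambda>x. x $ k) -` B k)" by auto
  have "(\<lambda>x :: real ^ 'n. x $ k) -` B k \<in> sets borel" for k
    by (rule measurable_sets_borel[OF borel_measurable_continuous_onI]) (auto intro!: continuous_intros)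
  then show [measurable]: "?S \<in> sets borel" unfolding S by (intro sets.countable_INT') auto
  let ?a = "\<lambda>k. axis k 1 :: real ^ 'n"
  have inj: "inj ?a" by (auto simp: inj_def axis_eq_axis)
  have Basis: "(Basis :: (real ^ 'n) set) = range ?a" by (auto simp: Basis_vec_def)
  define f where "f = (\<lambda>b x. indicator (B (inv_into UNIV ?a b)) x :: ennreal)"
  have fa: "f (?a k) = indicator (B k)" for k
    unfolding f_def inv_into_f_f[OF inj UNIV_I] by (rule refl)
  have "emeasure lborel ?S = (\<integral>\<^sup>+x. indicator ?S x \<partial>lborel)" by simp
  also have "\<dots> = (\<integral>\<^sup>+x. (\<Prod>b\<in>Basis. f b (x \<bullet> b)) \<partial>lborel)"
  proof (rule nn_integral_cong)
    fix x :: "real ^ 'n"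
    have "(\<Prod>b\<in>Basis. f b (x \<bullet> b)) = (\<Prod>k\<in>UNIV. indicator (B k) (x $ k))"
      unfolding Basis using inj by (simp add: prod.reindex fa inner_axis)
    also have "\<dots> = indicator ?S x"
    proof (cases "x \<in> ?S")
      case False
      then obtain k where "x $ k \<notin> B k" by auto
      then have "(\<Prod>k\<in>UNIV. indicator (B k) (x $ k) :: ennreal) = 0"
        by (intro prod_zero bexI[of _ k]) auto
      then show ?thesis using False by simp
    qed auto
    finally show "indicator ?S x = (\<Prod>b\<in>Basis. f b (x \<bullet> b))" ..
  qed
  also have "\<dots> = (\<Prod>b\<in>Basis. (\<integral>\<^sup>+x. f b x \<partial>lborel))"
    by (rule nn_integral_lborel_prod) (auto simp: f_def)
  also have "\<dots> = (\<Prod>k\<in>UNIV. emeasure lborel (B k))"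
    unfolding Basis using inj by (simp add: prod.reindex fa)
  finally show "emeasure lborel ?S = (\<Prod>k\<in>UNIV. emeasure lborel (B k))" .
qed

text \<open>
  Lebesgue measure on \<open>\<real>\<^sup>r\<close> is the image of Lebesgue measure on \<open>\<real>\<^sup>r \<times> [0,1)\<^sup>n\<^sup>-\<^sup>r\<close> under the projection.
  The measure of a set of \<open>r\<close>-tuples is thus that of a slab in a space indexed by a type, where
  the behaviour of volumes under linear maps is available. The proof compares the two measures on boxes.
\<close>

lemma emeasure_PiM_slab:
  fixes h :: "nat \<Rightarrow> 'n::finite"
  assumes h: "bij_betw h {..<n} UNIV" and rn: "r \<le> n"
    and Q: "Q \<in> sets (\<Pi>\<^sub>M i\<in>{..<r}. lborel :: real measure)"
  shows "emeasure (\<Pi>\<^sub>M i\<in>{..<r}. lborel) Q = 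
    emeasure lborel {x :: real ^ 'n. (\<forall>i. r \<le> i \<and> i < n \<longrightarrow> 0 \<le> x $ h i \<and> x $ h i < 1) \<and> (\<lambda>i\<in>{..<r}. x $ h i) \<in> Q}"
proof -
  let ?P = "\<Pi>\<^sub>M i\<in>{..<r}. lborel :: real measure"
  let ?\<pi> = "\<lambda>x :: real ^ 'n. \<lambda>i\<in>{..<r}. x $ h i"
  let ?C = "{x :: real ^ 'n. \<forall>i. r \<le> i \<and> i < n \<longrightarrow> 0 \<le> x $ h i \<and> x $ h i < 1}"
  define k where "k = inv_into {..<n} h"
  have kh: "k (h i) = i" if "i < n" for i
    using h that by (auto simp: k_def bij_betw_def)
  have hk: "h (k c) = c" "k c < n" for c
    using h by (auto simp: k_def bij_betw_def f_inv_into_f) (metis UNIV_I inv_into_into lessThan_iff)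
  interpret product_sigma_finite "\<lambda>_::nat. lborel :: real measure" ..
  have [measurable]: "?C \<in> sets borel"
  proof -
    have "?C = {x :: real ^ 'n. \<forall>c. x $ c \<in> (if r \<le> k c then {0..<1} else UNIV)}"
      using kh hk by (auto split: if_splits)
    also have "\<dots> \<in> sets borel" by (rule emeasure_lborel_box(2)) auto
    finally show ?thesis .
  qed
  have nth[measurable]: "(\<lambda>x :: real ^ 'n. x $ c) \<in> borel_measurable borel" for c
    by (rule borel_measurable_continuous_onI) (auto intro!: continuous_intros)
  have \<pi>: "?\<pi> \<in> measurable lborel ?P"
    by (rule measurable_restrict) simp
  let ?\<nu> = "distr (restrict_space lborel ?C) ?P ?\<pi>"
  have em: "emeasure ?\<nu> R = emeasure lborel {x \<in> ?C. ?\<pi> x \<in> R}" if R: "R \<in> sets ?P" for R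
  proof -
    have "emeasure ?\<nu> R = emeasure (restrict_space lborel ?C) (?\<pi> -` R \<inter> space (restrict_space lborel ?C))"
      by (rule emeasure_distr[OF measurable_restrict_space1[OF \<pi>] R])
    also have "?\<pi> -` R \<inter> space (restrict_space lborel ?C) = {x \<in> ?C. ?\<pi> x \<in> R}"
      by (auto simp: space_restrict_space)
    also have "emeasure (restrict_space lborel ?C) \<dots> = emeasure lborel {x \<in> ?C. ?\<pi> x \<in> R}"
      by (rule emeasure_restrict_space) auto
    finally show ?thesis .
  qed
  have "?\<nu> = ?P"
  proof (rule PiM_eqI)
    fix A :: "nat \<Rightarrow> real set" assume A: "\<And>i. i \<in> {..<r} \<Longrightarrow> A i \<in> sets lborel"
    define B where "B = (\<lambda>c. if r \<le> k c then {0..<1} else A (k c))"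
    have B: "B c \<in> sets borel" for c using A[of "k c"] by (simp add: B_def)
    have "{x \<in> ?C. ?\<pi> x \<in> Pi\<^sub>E {..<r} A} = {x. \<forall>c. x $ c \<in> B c}"
    proof (rule Set.set_eqI, rule iffI)
      fix x :: "real ^ 'n" assume x: "x \<in> {x \<in> ?C. ?\<pi> x \<in> Pi\<^sub>E {..<r} A}"
      have "x $ h (k c) \<in> B c" for c
        using x hk(2)[of c] by (auto simp: B_def PiE_iff)
      then show "x \<in> {x. \<forall>c. x $ c \<in> B c}" by (simp add: hk)
    next
      fix x :: "real ^ 'n" assume x: "x \<in> {x. \<forall>c. x $ c \<in> B c}"
      then have "x $ h i \<in> B (h i)" for i by simp
      then show "x \<in> {x \<in> ?C. ?\<pi> x \<in> Pi\<^sub>E {..<r} A}"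
        using rn by (auto simp: B_def kh PiE_iff split: if_splits) (metis kh atLeastLessThan_iff less_le_trans not_le)+
    qed
    then have "emeasure ?\<nu> (Pi\<^sub>E {..<r} A) = (\<Prod>c\<in>UNIV. emeasure lborel (B c))"
      using emeasure_lborel_box[OF B] A by (subst em) (auto intro!: sets_PiM_I_finite)
    also have "\<dots> = (\<Prod>i<n. emeasure lborel (B (h i)))"
      by (rule prod.reindex_bij_betw[OF h, symmetric])
    also have "\<dots> = (\<Prod>i<n. if i < r then emeasure lborel (A i) else 1)"
      by (rule prod.cong) (auto simp: B_def kh)
    also have "\<dots> = (\<Prod>i<r. emeasure lborel (A i))"
      using rn by (intro prod.mono_neutral_cong_right) auto
    finally show "emeasure ?\<nu> (Pi\<^sub>E {..<r} A) = (\<Prod>i<r. emeasure lborel (A i))" .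
  qed auto
  then show ?thesis using em[OF Q] by (simp add: conj_commute)
qed

text \<open>
  The slab over the parallelotope is the image of the unit cube under the matrix \<open>A\<close> extended by an
  identity block, and a linear map scales volumes by the absolute value of its determinant.
\<close>

lemma measure_parallelotope_aux:
  fixes A :: "nat \<Rightarrow> nat \<Rightarrow> real"
  assumes rn: "r \<le> CARD('n::{finite,wellorder})" and det: "Determinant.det (Matrix.mat r r (\<lambda>(i, j). A i j)) \<noteq> 0"
  shows "measure (\<Pi>\<^sub>M i\<in>{..<r}. lborel) 
    ((\<lambda>t. \<lambda>i\<in>{..<r}. \<Sum>j<r. A i j * t j) ` {t. \<forall>j. 0 \<le> t j \<and> t j < 1})
    = \<bar>Determinant.det (Matrix.mat r r (\<lambda>(i, j). A i j))\<bar>"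
proof -
  let ?n = "CARD('n)" and ?M = "Matrix.mat r r (\<lambda>(i, j). A i j)"
  let ?P = "\<Pi>\<^sub>M i\<in>{..<r}. lborel :: real measure"
  let ?Q = "(\<lambda>t. \<lambda>i\<in>{..<r}. \<Sum>j<r. A i j * t j) ` {t. \<forall>j. 0 \<le> t j \<and> t j < 1}"
  obtain h :: "nat \<Rightarrow> 'n" where h: "bij_betw h {0..<?n} UNIV"
    using ex_bij_betw_nat_finite[of "UNIV :: 'n set"] by auto
  then have h': "bij_betw h {..<?n} UNIV" by (simp add: lessThan_atLeast0)
  define k where "k = inv_into {..<?n} h"
  have kh: "k (h i) = i" if "i < ?n" for i
    using h' that by (auto simp: k_def bij_betw_def)
  have hk: "h (k c) = c" "k c < ?n" for c
    using h' by (auto simp: k_def bij_betw_def f_inv_into_f) (metis UNIV_I inv_into_into lessThan_iff)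
  \<comment> \<open>With the inverse \<open>N\<close> the parallelotope is described by inequalities, which shows that it is
    measurable.\<close>
  obtain N where N: "N \<in> carrier_mat r r" "N * ?M = 1\<^sub>m r" "?M * N = 1\<^sub>m r"
    using det_non_zero_imp_unit[OF _ det, of r "()"] unfolding Units_def ring_mat_def by auto
  have NA: "(\<Sum>j<r. N $$ (i, j) * A j l) = (if i = l then 1 else 0)" if "i < r" "l < r" for i l
    using arg_cong[OF N(2), of "\<lambda>m. m $$ (i, l)"] that N(1)
    by (simp add: scalar_prod_def lessThan_atLeast0)
  have AN: "(\<Sum>j<r. A i j * N $$ (j, l)) = (if i = l then 1 else 0)" if "i < r" "l < r" for i l
    using arg_cong[OF N(3), of "\<lambda>m. m $$ (i, l)"] that N(1)
    by (simp add: scalar_prod_def lessThan_atLeast0)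
  have NAt: "(\<Sum>i<r. N $$ (l, i) * (\<Sum>j<r. A i j * t j)) = t l" if "l < r" for t l
  proof -
    have "(\<Sum>i<r. N $$ (l, i) * (\<Sum>j<r. A i j * t j)) = (\<Sum>j<r. (\<Sum>i<r. N $$ (l, i) * A i j) * t j)"
      by (simp add: sum_distrib_left sum_distrib_right mult.assoc) (rule sum.swap)
    also have "\<dots> = (\<Sum>j<r. if l = j then t j else 0)"
      using that by (intro sum.cong) (auto simp: NA)
    finally show ?thesis using that by simp
  qed
  have ANy: "(\<Sum>j<r. A l j * (\<Sum>i<r. N $$ (j, i) * y i)) = y l" if "l < r" for y l
  proof -
    have "(\<Sum>j<r. A l j * (\<Sum>i<r. N $$ (j, i) * y i)) = (\<Sum>i<r. (\<Sum>j<r. A l j * N $$ (j, i)) * y i)"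
      by (simp add: sum_distrib_left sum_distrib_right mult.assoc) (rule sum.swap)
    also have "\<dots> = (\<Sum>j<r. if l = j then y j else 0)"
      using that by (intro sum.cong) (auto simp: AN)
    finally show ?thesis using that by simp
  qed
  have Q: "?Q = {y \<in> space ?P. \<forall>j\<in>{..<r}. 0 \<le> (\<Sum>i<r. N $$ (j, i) * y i) \<and> (\<Sum>i<r. N $$ (j, i) * y i) < 1}" (is "_ = ?Q'")
  proof
    show "?Q \<subseteq> ?Q'"
    proof (rule image_subsetI)
      fix t :: "nat \<Rightarrow> real" assume t: "t \<in> {t. \<forall>j. 0 \<le> t j \<and> t j < 1}"
      let ?y = "\<lambda>i\<in>{..<r}. \<Sum>j<r. A i j * t j"
      have "(\<Sum>i<r. N $$ (l, i) * ?y i) = t l" if "l < r" for l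
        using NAt[OF that, of t] by simp
      moreover have "?y \<in> space ?P" by (simp add: space_PiM)
      ultimately show "?y \<in> ?Q'" using t by simp
    qed
    show "?Q' \<subseteq> ?Q"
    proof
      fix y assume y: "y \<in> ?Q'"
      let ?t = "\<lambda>j. if j < r then \<Sum>i<r. N $$ (j, i) * y i else 0"
      have "y = (\<lambda>i\<in>{..<r}. \<Sum>j<r. A i j * ?t j)"
      proof
        fix i
        show "y i = (\<lambda>i\<in>{..<r}. \<Sum>j<r. A i j * ?t j) i"
        proof (cases "i < r")
          case True
          then show ?thesis using ANy[OF True, of y] by simp
        next
          case False
          then show ?thesis using y by (auto simp: space_PiM PiE_iff extensional_def)
        qed
      qed
      moreover have "?t \<in> {t. \<forall>j. 0 \<le> t j \<and> t j < 1}" using y by auto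
      ultimately show "y \<in> ?Q" by (rule image_eqI)
    qed
  qed
  have Qm: "?Q \<in> sets ?P" unfolding Q by measurable
  define E where "E = (\<lambda>i j. if i < r \<and> j < r then A i j else if i = j then 1 else 0)"
  define M :: "((real, 'n) Finite_Cartesian_Product.vec, 'n) Finite_Cartesian_Product.vec" where "M = (\<chi> a b. E (k a) (k b))"
  let ?cube = "{x :: (real, 'n) Finite_Cartesian_Product.vec. \<forall>c. x $ c \<in> {0..<1}}"
  have cube: "emeasure lborel ?cube = 1" "?cube \<in> sets lborel"
    using emeasure_lborel_box[of "\<lambda>_. {0..<1}"] by auto
  have Mx: "(M *v x) $ h i = (\<Sum>j<?n. E i j * x $ h j)" if "i < ?n" for x i
  proof -
    have "(M *v x) $ h i = (\<Sum>b\<in>UNIV. E i (k b) * x $ b)"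
      using that by (simp add: M_def matrix_vector_mult_def kh)
    also have "\<dots> = (\<Sum>j<?n. E i (k (h j)) * x $ h j)"
      by (rule sum.reindex_bij_betw[OF h', symmetric])
    also have "\<dots> = (\<Sum>j<?n. E i j * x $ h j)" by (intro sum.cong) (auto simp: kh)
    finally show ?thesis .
  qed
  have Mlow: "(M *v x) $ h i = (\<Sum>j<r. A i j * x $ h j)" if "i < r" for x i
    using that rn by (subst Mx) (auto simp: E_def split: if_splits intro!: sum.mono_neutral_cong_right)
  have Mhigh: "(M *v x) $ h i = x $ h i" if "r \<le> i" "i < ?n" for x i
  proof -
    have "(\<Sum>j<?n. E i j * x $ h j) = (\<Sum>j<?n. if i = j then x $ h j else 0)"
      using that by (intro sum.cong) (auto simp: E_def)
    then show ?thesis using that by (simp add: Mx)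
  qed
  have image: "{x :: (real, 'n) Finite_Cartesian_Product.vec. (\<forall>i. r \<le> i \<and> i < ?n \<longrightarrow> 0 \<le> x $ h i \<and> x $ h i < 1) \<and> (\<lambda>i\<in>{..<r}. x $ h i) \<in> ?Q}
      = (*v) M ` ?cube" (is "?L = _")
  proof
    show "(*v) M ` ?cube \<subseteq> ?L"
    proof (rule image_subsetI)
      fix x assume x: "x \<in> ?cube"
      let ?t = "\<lambda>j. x $ h j"
      have "(\<lambda>i\<in>{..<r}. (M *v x) $ h i) = (\<lambda>i\<in>{..<r}. \<Sum>j<r. A i j * ?t j)"
        by (auto simp: Mlow)
      moreover have "?t \<in> {t. \<forall>j. 0 \<le> t j \<and> t j < 1}" using x by auto
      ultimately show "M *v x \<in> ?L" using x Mhigh by auto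
    qed
    show "?L \<subseteq> (*v) M ` ?cube"
    proof
      fix y assume y: "y \<in> ?L"
      then obtain t where t: "(\<lambda>i\<in>{..<r}. y $ h i) = (\<lambda>i\<in>{..<r}. \<Sum>j<r. A i j * t j)" "\<forall>j. 0 \<le> t j \<and> t j < 1"
        by auto
      define x :: "(real, 'n) Finite_Cartesian_Product.vec" where "x = (\<chi> c. if k c < r then t (k c) else y $ c)"
      have "y $ h i = (M *v x) $ h i" if "i < ?n" for i
      proof (cases "i < r")
        case True
        have "y $ h i = (\<Sum>j<r. A i j * t j)" using fun_cong[OF t(1), of i] True by simp
        also have "\<dots> = (M *v x) $ h i" 
          unfolding Mlow[OF True] using rn by (intro sum.cong) (auto simp: x_def kh)
        finally show ?thesis .
      qed (use that in \<open>simp add: Mhigh x_def kh\<close>)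
      then have "y $ c = (M *v x) $ c" for c using hk[of c] by metis
      then have "y = M *v x" by (simp add: Finite_Cartesian_Product.vec_eq_iff)
      moreover have "x \<in> ?cube"
      proof -
        have "x $ c \<in> {0..<1}" for c
        proof (cases "k c < r")
          case False
          then have "0 \<le> y $ h (k c) \<and> y $ h (k c) < 1" using y hk(2)[of c] by auto
          then show ?thesis using False by (simp add: x_def hk)
        qed (use t in \<open>simp add: x_def\<close>)
        then show ?thesis by simp
      qed
      ultimately show "y \<in> (*v) M ` ?cube" by blast
    qed
  qed
  have detM: "Determinants.det M = Determinant.det ?M"
  proof -
    have "Determinants.det M = Determinant.det (Matrix.mat ?n ?n (\<lambda>(i, j). M $ h i $ h j))"
      by (rule det_reindex[OF h])
    also have "Matrix.mat ?n ?n (\<lambda>(i, j). M $ h i $ h j) = four_block_mat ?M (0\<^sub>m r (?n - r)) (0\<^sub>m (?n - r) r) (1\<^sub>m (?n - r))"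
      using rn by (intro eq_matI) (auto simp: M_def kh E_def)
    also have "Determinant.det \<dots> = Determinant.det ?M * Determinant.det (1\<^sub>m (?n - r))"
      by (rule det_four_block_mat_lower_left_zero) auto
    finally show ?thesis by simp
  qed
  have lm: "?cube \<in> lmeasurable"
    using cube by (intro fmeasurableI) (auto simp: fmeasurable_def)
  have "measure ?P ?Q = measure lborel ((*v) M ` ?cube)"
    unfolding measure_def emeasure_PiM_slab[OF h' rn Qm] image ..
  also have "\<dots> = measure lebesgue ((*v) M ` ?cube)"
  proof -
    have "(\<lambda>x :: (real, 'n) Finite_Cartesian_Product.vec. \<lambda>i\<in>{..<r}. x $ h i) \<in> measurable lborel ?P"
      by (rule measurable_restrict) (auto intro!: borel_measurable_continuous_onI continuous_intros)
    then have *: "(\<lambda>x :: (real, 'n) Finite_Cartesian_Product.vec. \<lambda>i\<in>{..<r}. x $ h i) -` ?Q \<inter> space lborel \<in> sets lborel"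
      using Qm by (rule measurable_sets)
    have "?L = {x. \<forall>c. x $ c \<in> (if r \<le> k c then {0..<1} else UNIV)} \<inter> ((\<lambda>x :: (real, 'n) Finite_Cartesian_Product.vec. \<lambda>i\<in>{..<r}. x $ h i) -` ?Q \<inter> space lborel)"
      using kh hk by (auto split: if_splits)
    also have "\<dots> \<in> sets lborel"
      using * emeasure_lborel_box(2)[of "\<lambda>c. if r \<le> k c then {0..<1} else UNIV"] by (intro sets.Int) auto
    finally have "(*v) M ` ?cube \<in> sets lborel" unfolding image .
    then show ?thesis by simp
  qed
  also have "\<dots> = \<bar>Determinants.det (matrix ((*v) M))\<bar> * measure lebesgue ?cube"
    by (rule measure_linear_image[OF matrix_vector_mul_linear lm])
  also have "measure lebesgue ?cube = 1"
    using cube by (simp add: measure_def)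
  finally show ?thesis unfolding detM matrix_of_matrix_vector_mul mult_1_right .
qed

text \<open>
  The formula does not mention the type of indices of the ambient space, so this type may be replaced:
  \<open>'n bit0\<close> is at least as large as \<open>'n\<close> and, other than \<open>'n\<close>, comes with a well-order.
\<close>

lemma measure_parallelotope:
  fixes A :: "nat \<Rightarrow> nat \<Rightarrow> real"
  assumes rn: "r \<le> CARD('n::finite)" and det: "Determinant.det (Matrix.mat r r (\<lambda>(i, j). A i j)) \<noteq> 0"
  shows "measure (\<Pi>\<^sub>M i\<in>{..<r}. lborel) 
    ((\<lambda>t. \<lambda>i\<in>{..<r}. \<Sum>j<r. A i j * t j) ` {t. \<forall>j. 0 \<le> t j \<and> t j < 1})
    = \<bar>Determinant.det (Matrix.mat r r (\<lambda>(i, j). A i j))\<bar>"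
proof (rule measure_parallelotope_aux)
  show "r \<le> CARD('n bit0)" using rn by simp
qed fact

section \<open>Determinants and bases of a subspace\<close>

text \<open>Bases as families indexed by numbers, as needed for matrices with respect to a basis.\<close>

definition family_basis :: "nat \<Rightarrow> (nat \<Rightarrow> 'v::real_vector) \<Rightarrow> 'v set \<Rightarrow> bool" where
  "family_basis r b V \<longleftrightarrow> (\<forall>i<r. b i \<in> V) \<and> (\<forall>x\<in>V. \<exists>a. x = (\<Sum>i<r. a i *\<^sub>R b i)) \<and>
     (\<forall>a. (\<Sum>i<r. a i *\<^sub>R b i) = 0 \<longrightarrow> (\<forall>i<r. a i = 0))"

lemma family_basisD:
  assumes "family_basis r b V"
  shows "i < r \<Longrightarrow> b i \<in> V" "x \<in> V \<Longrightarrow> \<exists>a. x = (\<Sum>i<r. a i *\<^sub>R b i)"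
    "(\<Sum>i<r. a i *\<^sub>R b i) = 0 \<Longrightarrow> i < r \<Longrightarrow> a i = 0"
  using assms by (auto simp: family_basis_def)

lemma family_basis_unique:
  assumes b: "family_basis r b V" and eq: "(\<Sum>i<r. a i *\<^sub>R b i) = (\<Sum>i<r. a' i *\<^sub>R b i)" and i: "i < r"
  shows "a i = a' i"
proof -
  have "(\<Sum>i<r. (a i - a' i) *\<^sub>R b i) = 0"
    using eq by (simp add: scaleR_diff_left sum_subtractf)
  from family_basisD(3)[OF b this i] show ?thesis by simp
qed

lemma sum_set_nth: "distinct bs \<Longrightarrow> (\<Sum>v\<in>set bs. f v) = (\<Sum>i<length bs. f (bs ! i))"
  by (rule sum.reindex_bij_betw[OF bij_betw_nth, symmetric]) auto

lemma subspace_basis_family_basis: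
  assumes "subspace_basis V bs" shows "family_basis (length bs) ((!) bs) V"
  unfolding family_basis_def
proof (intro conjI allI impI ballI)
  have d: "distinct bs" and i: "independent (set bs)" and s: "span (set bs) = V"
    using assms by (auto simp: subspace_basis_def)
  show "bs ! i \<in> V" if "i < length bs" for i
    using that s span_superset by fastforce
  show "\<exists>a. x = (\<Sum>i<length bs. a i *\<^sub>R bs ! i)" if "x \<in> V" for x
  proof -
    have "x \<in> range (\<lambda>u. \<Sum>v\<in>set bs. u v *\<^sub>R v)"
      using that span_finite[of "set bs"] s by simp
    then obtain u where "x = (\<Sum>v\<in>set bs. u v *\<^sub>R v)" by (rule rangeE)
    then show ?thesis unfolding sum_set_nth[OF d] by (intro exI[of _ "\<lambda>i. u (bs ! i)"])
  qed
  show "a i = 0" if "(\<Sum>i<length bs. a i *\<^sub>R bs ! i) = 0" "i < length bs" for a i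
  proof -
    define c where "c v = a (inv_into {..<length bs} ((!) bs) v)" for v
    have bij: "bij_betw ((!) bs) {..<length bs} (set bs)" using d by (intro bij_betw_nth) auto
    have c: "c (bs ! j) = a j" if "j < length bs" for j
      using bij that unfolding c_def by (subst inv_into_f_f) (auto simp: bij_betw_def)
    have "(\<Sum>v\<in>set bs. c v *\<^sub>R v) = 0"
      unfolding sum_set_nth[OF d] using that(1) c by (metis (no_types, lifting) lessThan_iff sum.cong)
    then have "c (bs ! i) = 0"
      using i that(2) unfolding independent_explicit by (metis nth_mem)
    then show ?thesis using c that(2) by simp
  qed
qed

lemma family_basis_subspace_basis:
  assumes b: "family_basis r b V" and V: "subspace V"
  shows "subspace_basis V (map b [0..<r])"
proof -
  have inj: "inj_on b {..<r}"
  proof (rule inj_onI, rule ccontr)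
    fix i j assume ij: "i \<in> {..<r}" "j \<in> {..<r}" "b i = b j" "i \<noteq> j"
    have "(\<Sum>k<r. (if k = i then 1 else 0) *\<^sub>R b k) = (\<Sum>k<r. (if k = j then 1 else 0) *\<^sub>R b k)"
      using ij by (simp add: if_distrib[of "\<lambda>c. c *\<^sub>R _"] cong: if_cong)
    from family_basis_unique[OF b this, of i] ij show False by simp
  qed
  have sum: "(\<Sum>v\<in>b ` {..<r}. f v) = (\<Sum>i<r. f (b i))" for f :: "'a \<Rightarrow> 'a"
    by (simp add: sum.reindex[OF inj])
  have "independent (b ` {..<r})"
    unfolding independent_explicit sum using family_basisD(3)[OF b] by auto
  moreover have "span (b ` {..<r}) = V"
  proof
    show "span (b ` {..<r}) \<subseteq> V"
      using family_basisD(1)[OF b] V by (intro span_minimal) auto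
    show "V \<subseteq> span (b ` {..<r})"
    proof
      fix x assume "x \<in> V"
      then obtain a where x: "x = (\<Sum>i<r. a i *\<^sub>R b i)" using family_basisD(2)[OF b] by blast
      show "x \<in> span (b ` {..<r})" unfolding x by (intro span_sum span_scale span_base) auto
    qed
  qed
  ultimately show ?thesis
    using inj by (simp add: subspace_basis_def distinct_map lessThan_atLeast0)
qed

lemma family_basis_card:
  fixes V :: "'v::euclidean_space set"
  assumes b: "family_basis r b V" and V: "subspace V" shows "r = dim V"
proof -
  have "subspace_basis V (map b [0..<r])" by (rule family_basis_subspace_basis[OF assms])
  then have "independent (set (map b [0..<r]))" "span (set (map b [0..<r])) = V" "card (set (map b [0..<r])) = r"
    using distinct_card[of "map b [0..<r]"] by (auto simp: subspace_basis_def)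
  then show ?thesis by (metis dim_span_eq_card_independent)
qed

text \<open>The matrices of the two changes of basis are inverse to each other.\<close>

lemma change_of_basis:
  fixes V :: "'v::euclidean_space set"
  assumes b: "family_basis r b V" and c: "family_basis s c V" and V: "subspace V"
    and P: "\<And>j. j < r \<Longrightarrow> b j = (\<Sum>i<s. P i j *\<^sub>R c i)"
  shows "s = r" "Determinant.det (Matrix.mat r r (\<lambda>(i, j). P i j)) \<noteq> 0"
proof -
  show sr: "s = r" using family_basis_card[OF b V] family_basis_card[OF c V] by simp
  have "\<exists>Q. \<forall>j<r. c j = (\<Sum>i<r. Q i j *\<^sub>R b i)"
  proof -
    have "\<forall>j. \<exists>q. j < r \<longrightarrow> c j = (\<Sum>i<r. q i *\<^sub>R b i)"
      using family_basisD(1)[OF c] family_basisD(2)[OF b] sr by blast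
    then obtain q where "\<forall>j. j < r \<longrightarrow> c j = (\<Sum>i<r. q j i *\<^sub>R b i)" by metis
    then show ?thesis by (intro exI[of _ "\<lambda>i j. q j i"]) simp
  qed
  then obtain Q where Q: "\<And>j. j < r \<Longrightarrow> c j = (\<Sum>i<r. Q i j *\<^sub>R b i)" by blast
  let ?P = "Matrix.mat r r (\<lambda>(i, j). P i j)" and ?Q = "Matrix.mat r r (\<lambda>(i, j). Q i j)"
  have "?P * ?Q = 1\<^sub>m r"
  proof (rule eq_matI)
    fix i j assume ij: "i < dim_row (1\<^sub>m r)" "j < dim_col (1\<^sub>m r)"
    have "(\<Sum>i<s. (\<Sum>k<r. P i k * Q k j) *\<^sub>R c i) = (\<Sum>k<r. Q k j *\<^sub>R (\<Sum>i<s. P i k *\<^sub>R c i))"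
      by (simp add: scaleR_sum_right scaleR_sum_left mult.commute) (rule sum.swap)
    also have "\<dots> = c j" using Q[of j] P ij by simp
    also have "\<dots> = (\<Sum>i<s. (if i = j then 1 else 0) *\<^sub>R c i)"
      using ij sr by (simp add: if_distrib[of "\<lambda>c. c *\<^sub>R _"] cong: if_cong)
    finally have "(\<Sum>k<r. P i k * Q k j) = (if i = j then 1 else 0)"
      by (rule family_basis_unique[OF c]) (use ij sr in simp)
    then show "(?P * ?Q) $$ (i, j) = 1\<^sub>m r $$ (i, j)"
      using ij by (simp add: scalar_prod_def lessThan_atLeast0)
  qed auto
  then have "Determinant.det ?P * Determinant.det ?Q = 1"
    by (simp add: Determinant.det_mult[of _ r, symmetric])
  then show "Determinant.det ?P \<noteq> 0" by auto
qed

text \<open>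
  Passing from the chosen basis to any other one conjugates the matrix by an invertible matrix, which
  does not change its determinant.
\<close>

lemma endo_det_eq:
  fixes V :: "'v::euclidean_space set" and f :: "'v \<Rightarrow> 'v"
  assumes V: "subspace V" and f: "linear f" and c: "family_basis r c V"
    and M: "\<And>j. j < r \<Longrightarrow> f (c j) = (\<Sum>i<r. M i j *\<^sub>R c i)"
  shows "endo_det V f = Determinant.det (Matrix.mat r r (\<lambda>(i, j). M i j))"
proof -
  define bs where "bs = (SOME bs. subspace_basis V bs)"
  have sb: "subspace_basis V bs"
    unfolding bs_def using family_basis_subspace_basis[OF c V] by (rule someI)
  have b: "family_basis (length bs) ((!) bs) V" by (rule subspace_basis_family_basis[OF sb])
  have len: "length bs = r" using family_basis_card[OF b V] family_basis_card[OF c V] by simp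
  have fV: "f x \<in> V" if "x \<in> V" for x
  proof -
    obtain a where x: "x = (\<Sum>i<r. a i *\<^sub>R c i)" using family_basisD(2)[OF c \<open>x \<in> V\<close>] by blast
    have "f x = (\<Sum>i<r. a i *\<^sub>R f (c i))"
      unfolding x by (simp add: linear_sum[OF f] linear_scale[OF f])
    also have "\<dots> \<in> V"
      using M family_basisD(1)[OF c] V by (auto intro!: subspace_sum subspace_scale)
    finally show ?thesis .
  qed
  let ?F = "\<lambda>i j. representation (set bs) (f (bs ! j)) (bs ! i)"
  have F: "f (bs ! j) = (\<Sum>i<r. ?F i j *\<^sub>R bs ! i)" if "j < r" for j
  proof -
    have "f (bs ! j) \<in> span (set bs)"
      using fV family_basisD(1)[OF b] that len sb by (auto simp: subspace_basis_def)
    then have "(\<Sum>v\<in>set bs. representation (set bs) (f (bs ! j)) v *\<^sub>R v) = f (bs ! j)"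
      using sb by (intro sum_representation_eq) (auto simp: subspace_basis_def)
    then show ?thesis using sb len by (simp add: sum_set_nth subspace_basis_def)
  qed
  have "\<exists>P. \<forall>j<r. bs ! j = (\<Sum>i<r. P i j *\<^sub>R c i)"
  proof -
    have "\<forall>j. \<exists>q. j < r \<longrightarrow> bs ! j = (\<Sum>i<r. q i *\<^sub>R c i)"
      using family_basisD(1)[OF b] family_basisD(2)[OF c] len by blast
    then obtain q where "\<forall>j. j < r \<longrightarrow> bs ! j = (\<Sum>i<r. q j i *\<^sub>R c i)" by metis
    then show ?thesis by (intro exI[of _ "\<lambda>i j. q j i"]) simp
  qed
  then obtain P where P: "\<And>j. j < r \<Longrightarrow> bs ! j = (\<Sum>i<r. P i j *\<^sub>R c i)" by blast
  let ?P = "Matrix.mat r r (\<lambda>(i, j). P i j)" and ?M = "Matrix.mat r r (\<lambda>(i, j). M i j)"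
    and ?FF = "Matrix.mat r r (\<lambda>(i, j). ?F i j)"
  have nz: "Determinant.det ?P \<noteq> 0"
    using change_of_basis(2)[OF b[unfolded len] c V P] by simp
  have "?P * ?FF = ?M * ?P"
  proof (rule eq_matI)
    fix i j assume ij: "i < dim_row (?M * ?P)" "j < dim_col (?M * ?P)"
    have "(\<Sum>i<r. (\<Sum>k<r. P i k * ?F k j) *\<^sub>R c i) = (\<Sum>k<r. ?F k j *\<^sub>R (\<Sum>i<r. P i k *\<^sub>R c i))"
      by (simp add: scaleR_sum_right scaleR_sum_left mult.commute) (rule sum.swap)
    also have "\<dots> = f (bs ! j)" using F[of j] P ij by simp
    also have "\<dots> = (\<Sum>k<r. P k j *\<^sub>R f (c k))"
      using P[of j] ij by (simp add: linear_sum[OF f] linear_scale[OF f])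
    also have "\<dots> = (\<Sum>k<r. P k j *\<^sub>R (\<Sum>i<r. M i k *\<^sub>R c i))" by (simp add: M)
    also have "\<dots> = (\<Sum>i<r. (\<Sum>k<r. M i k * P k j) *\<^sub>R c i)"
      by (simp add: scaleR_sum_right scaleR_sum_left mult.commute) (rule sum.swap)
    finally have "(\<Sum>k<r. P i k * ?F k j) = (\<Sum>k<r. M i k * P k j)"
      by (rule family_basis_unique[OF c]) (use ij in simp)
    then show "(?P * ?FF) $$ (i, j) = (?M * ?P) $$ (i, j)"
      using ij by (simp add: scalar_prod_def lessThan_atLeast0)
  qed auto
  then have "Determinant.det ?P * Determinant.det ?FF = Determinant.det ?M * Determinant.det ?P"
  proof -
    have "Determinant.det (?P * ?FF) = Determinant.det ?P * Determinant.det ?FF"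
      "Determinant.det (?M * ?P) = Determinant.det ?M * Determinant.det ?P"
      by (rule Determinant.det_mult[of _ r]; simp)+
    then show ?thesis using \<open>?P * ?FF = ?M * ?P\<close> by (simp only:)
  qed
  then have "Determinant.det ?FF = Determinant.det ?M" using nz by simp
  then show ?thesis unfolding endo_det_def Let_def bs_def[symmetric] len .
qed

definition gram :: "nat \<Rightarrow> (nat \<Rightarrow> 'v::real_inner) \<Rightarrow> real" where
  "gram r b = Determinant.det (Matrix.mat r r (\<lambda>(i, j). (b i \<bullet> b j)))"

text \<open>The Gram matrices are related by \<open>P\<^sup>T G P\<close>.\<close>

lemma gram_change:
  fixes b c :: "nat \<Rightarrow> 'v::real_inner"
  assumes P: "\<And>j. j < r \<Longrightarrow> b j = (\<Sum>i<r. P i j *\<^sub>R c i)"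
  shows "gram r b = (Determinant.det (Matrix.mat r r (\<lambda>(i, j). P i j)))\<^sup>2 * gram r c"
proof -
  let ?P = "Matrix.mat r r (\<lambda>(i, j). P i j)"
  let ?G = "Matrix.mat r r (\<lambda>(i, j). (c i \<bullet> c j))"
  have "Matrix.mat r r (\<lambda>(i, j). (b i \<bullet> b j)) = transpose_mat ?P * (?G * ?P)"
  proof (rule eq_matI)
    fix i j assume "i < dim_row (transpose_mat ?P * (?G * ?P))" "j < dim_col (transpose_mat ?P * (?G * ?P))"
    then have ij: "i < r" "j < r" by auto
    have "(b i \<bullet> b j) = (\<Sum>k<r. P k i * (\<Sum>l<r. (c k \<bullet> c l) * P l j))"
    proof -
      have "(b i \<bullet> b j) = (\<Sum>k<r. P k i * (c k \<bullet> b j))"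
        by (subst P[OF ij(1)]) (simp add: inner_sum_left)
      moreover have "(c k \<bullet> b j) = (\<Sum>l<r. (c k \<bullet> c l) * P l j)" for k
        by (subst P[OF ij(2)]) (simp add: inner_sum_right mult.commute)
      ultimately show ?thesis by simp
    qed
    then show "Matrix.mat r r (\<lambda>(i, j). (b i \<bullet> b j)) $$ (i, j) = (transpose_mat ?P * (?G * ?P)) $$ (i, j)"
      using ij by (simp add: scalar_prod_def lessThan_atLeast0)
  qed auto
  then have "gram r b = Determinant.det (transpose_mat ?P) * Determinant.det (?G * ?P)"
    unfolding gram_def by (simp only:) (rule Determinant.det_mult[of _ r], auto)
  also have "\<dots> = Determinant.det ?P * (Determinant.det ?G * Determinant.det ?P)"
  proof -
    have "Determinant.det (?G * ?P) = Determinant.det ?G * Determinant.det ?P"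
      by (rule Determinant.det_mult[of _ r]) auto
    moreover have "Determinant.det (transpose_mat ?P) = Determinant.det ?P"
      by (rule Determinant.det_transpose[of _ r]) auto
    ultimately show ?thesis by (simp only:)
  qed
  finally show ?thesis by (simp add: gram_def power2_eq_square)
qed

lemma gram_eq_det_square:
  fixes b u :: "nat \<Rightarrow> 'v::real_inner"
  assumes A: "\<And>j. j < r \<Longrightarrow> b j = (\<Sum>i<r. A i j *\<^sub>R u i)"
    and u: "\<And>i j. i < r \<Longrightarrow> j < r \<Longrightarrow> (u i \<bullet> u j) = (if i = j then 1 else 0)"
  shows "gram r b = (Determinant.det (Matrix.mat r r (\<lambda>(i, j). A i j)))\<^sup>2"
proof -
  have "Matrix.mat r r (\<lambda>(i, j). (u i \<bullet> u j)) = 1\<^sub>m r"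
    by (rule eq_matI) (auto simp: u)
  then have "gram r u = 1" by (simp add: gram_def)
  then show ?thesis using gram_change[OF A] by simp
qed

text \<open>
  In an orthonormal basis of \<open>V\<close> the volume is the absolute value of the determinant of the coordinate
  matrix \<open>A\<close> of \<open>b\<close>, and the Gram matrix of \<open>b\<close> is \<open>A\<^sup>T A\<close>.
\<close>

lemma subspace_volume_parallelotope:
  fixes V :: "(real ^ 'c::finite) set"
  assumes V: "subspace V" and b: "family_basis r b V"
  shows "(subspace_volume V {\<Sum>i<r. t i *\<^sub>R b i | t. \<forall>i. 0 \<le> t i \<and> t i < 1})\<^sup>2 = gram r b"
proof -
  let ?on = "\<lambda>us. subspace_basis V us \<and> pairwise real_inner_class.orthogonal (set us) \<and> (\<forall>u \<in> set us. norm u = 1)"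
  define us where "us = (SOME us. ?on us)"
  have "\<exists>us. ?on us"
  proof -
    obtain U where U: "pairwise real_inner_class.orthogonal U" "\<And>x. x \<in> U \<Longrightarrow> norm x = 1"
      "independent U" "card U = dim V" "span U = V"
      using orthonormal_basis_subspace[OF V] by metis
    then have "finite U" using independent_imp_finite by blast
    then obtain us where "set us = U" "distinct us" using finite_distinct_list by blast
    then show ?thesis using U by (auto simp: subspace_basis_def)
  qed
  then have us: "?on us" unfolding us_def by (rule someI_ex)
  let ?u = "\<lambda>i. us ! i"
  have u: "family_basis (length us) ?u V" using us by (intro subspace_basis_family_basis) auto
  have len: "length us = r" using family_basis_card[OF u V] family_basis_card[OF b V] by simp
  have on: "(?u i \<bullet> ?u j) = (if i = j then 1 else 0)" if "i < r" "j < r" for i j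
  proof (cases "i = j")
    case True
    have "norm (?u i) = 1" using us that len by auto
    then show ?thesis using True by (simp add: dot_square_norm)
  next
    case False
    then have "?u i \<noteq> ?u j" using us that len by (auto simp: subspace_basis_def nth_eq_iff_index_eq)
    then show ?thesis using us that len False by (auto simp: pairwise_def real_inner_class.orthogonal_def)
  qed
  define A where "A i j = (b j \<bullet> ?u i)" for i j
  have A: "b j = (\<Sum>i<r. A i j *\<^sub>R ?u i)" if j: "j < r" for j
  proof -
    obtain a where a: "b j = (\<Sum>i<r. a i *\<^sub>R ?u i)"
      using family_basisD(2)[OF u family_basisD(1)[OF b j]] len by auto
    have "A i j = a i" if "i < r" for i
    proof -
      have "A i j = (\<Sum>k<r. a k * (if k = i then 1 else 0))"
        unfolding A_def a inner_sum_left using that on by (intro sum.cong) auto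
      also have "\<dots> = (\<Sum>k<r. if k = i then a k else 0)" by (rule sum.cong) auto
      finally show ?thesis using that by simp
    qed
    then show ?thesis using a by simp
  qed
  have det: "Determinant.det (Matrix.mat r r (\<lambda>(i, j). A i j)) \<noteq> 0"
    by (rule change_of_basis(2)[OF b u[unfolded len] V A])
  have rn: "r \<le> CARD('c)"
    using family_basis_card[OF b V] dim_subset_UNIV[of V] by simp
  let ?P = "{\<Sum>i<r. t i *\<^sub>R b i | t. \<forall>i. 0 \<le> t i \<and> t i < 1}"
  have "(\<lambda>x. \<lambda>i\<in>{..<r}. (x \<bullet> ?u i)) ` ?P
      = (\<lambda>t. \<lambda>i\<in>{..<r}. \<Sum>j<r. A i j * t j) ` {t. \<forall>j. 0 \<le> t j \<and> t j < 1}"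
  proof -
    have "?P = (\<lambda>t. \<Sum>i<r. t i *\<^sub>R b i) ` {t. \<forall>j. 0 \<le> t j \<and> t j < 1}" by auto
    then show ?thesis
      by (simp add: image_image inner_sum_left A_def mult.commute)
  qed
  then have "subspace_volume V ?P = \<bar>Determinant.det (Matrix.mat r r (\<lambda>(i, j). A i j))\<bar>"
    unfolding subspace_volume_def Let_def us_def[symmetric] len
    using measure_parallelotope[OF rn det] by simp
  then show ?thesis
    using gram_eq_det_square[of r b A ?u, OF A on] by simp
qed

section \<open>The top boundary as a family of integer vectors\<close>

lemma bdry_linear:
  "bdry Y k (x + y) = bdry Y k x + bdry Y k y" "bdry Y k (a *s x) = a *s bdry Y k x" "bdry Y k 0 = 0"
  by (simp_all add: Finite_Cartesian_Product.vec_eq_iff bdry_def distrib_left sum.distrib sum_distrib_left mult.left_commute)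

lemma cycles_subspace: "zmod.subspace (cycles Y k)"
  unfolding zmod.subspace_def cycles_def chains_def by (simp add: bdry_linear)

locale top_dimensional = finite_CW X for X :: "('a, 'c::finite) cw_data" +
  fixes d :: nat
  assumes dim_le: "e \<in> cw_cells X \<Longrightarrow> cw_dim X e \<le> d"
begin

abbreviation "D \<equiv> k_cells X (int d)"

text \<open>The boundary of the \<open>d\<close>-cell \<open>e\<close>, as a chain: a column of the matrix of \<open>\<partial>\<close>.\<close>

definition col :: "'c \<Rightarrow> int ^ 'c" where
  "col e = (\<chi> f. incidence X e f)"

definition Z :: "(int ^ 'c) set" where
  "Z = cycles X (int d - 1)"

definition low :: "'c set" where
  "low = {e \<in> cw_cells X. cw_dim X e < d}"

lemma D_eq: "D = {e \<in> cw_cells X. cw_dim X e = d}" by (auto simp: k_cells_def)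

lemma cells_split: "cw_cells X = low \<union> D" "low \<inter> D = {}"
  using dim_le by (auto simp: low_def D_eq le_less)

lemma top_cells_removed_if_lower: "low \<subseteq> S \<Longrightarrow> S \<subseteq> cw_cells X \<Longrightarrow> top_cells_removed X d S"
  using dim_le finite_CW_axioms
  by (auto simp: top_cells_removed_def top_cells_removed_axioms_def low_def)

lemma bdry_top_component:
  "(bdry X (int d) x :: 'r::comm_ring_1 ^ 'c) $ f = (\<Sum>e\<in>D. of_int (incidence X e f) * x $ e)"
  using incidence_outside[of _ "int d" f] by (simp add: bdry_def)

lemma bdry_subcomplex_top_component:
  assumes "low \<subseteq> S" "S \<subseteq> cw_cells X"
  shows "(bdry (subcomplex X S) (int d) x :: 'r::comm_ring_1 ^ 'c) $ f = (\<Sum>e\<in>S \<inter> D. of_int (incidence X e f) * x $ e)"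
proof -
  interpret S: top_cells_removed X d S using assms by (rule top_cells_removed_if_lower)
  have "(\<Sum>e\<in>S \<inter> D. of_int (incidence (subcomplex X S) e f) * x $ e)
      = (\<Sum>e\<in>S \<inter> D. of_int (incidence X e f) * x $ e)"
    by (rule sum.cong) (simp_all add: S.incidence_subcomplex)
  then show ?thesis
    using incidence_outside[of _ "int d" f] by (simp add: bdry_def S.k_cells_top S.k_cells_lower)
qed

text \<open>
  Stated for a general complex \<open>Y\<close> and coefficient ring, to cover the integral boundaries of \<open>X\<close> and of
  its subcomplexes as well as the real boundaries of \<open>X\<close>.
\<close>

lemma boundaries_top_eq:
  assumes comp: "\<And>(x :: 'r::comm_ring_1 ^ 'c) f. bdry Y (int d) x $ f = (\<Sum>e\<in>E. of_int (incidence X e f) * x $ e)"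
    and E: "k_cells Y (int d) = E"
  shows "(boundaries Y (int d - 1) :: ('r ^ 'c) set) = {\<Sum>e\<in>E. a e *s (\<chi> f. of_int (incidence X e f)) | a. True}"
proof
  have eq: "bdry Y (int d) x = (\<Sum>e\<in>E. x $ e *s (\<chi> f. of_int (incidence X e f)))" for x :: "'r ^ 'c"
    by (simp add: Finite_Cartesian_Product.vec_eq_iff comp mult.commute)
  show "(boundaries Y (int d - 1) :: ('r ^ 'c) set) \<subseteq> {\<Sum>e\<in>E. a e *s (\<chi> f. of_int (incidence X e f)) | a. True}"
  proof
    fix y :: "'r ^ 'c" assume "y \<in> boundaries Y (int d - 1)"
    then obtain x where "y = bdry Y (int d) x" unfolding boundaries_def by auto
    then show "y \<in> {\<Sum>e\<in>E. a e *s (\<chi> f. of_int (incidence X e f)) | a. True}"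
      unfolding eq by (intro CollectI exI[of _ "\<lambda>e. x $ e"]) simp
  qed
  show "{\<Sum>e\<in>E. a e *s (\<chi> f. of_int (incidence X e f)) | a. True} \<subseteq> (boundaries Y (int d - 1) :: ('r ^ 'c) set)"
  proof
    fix y :: "'r ^ 'c" assume "y \<in> {\<Sum>e\<in>E. a e *s (\<chi> f. of_int (incidence X e f)) | a. True}"
    then obtain a where y: "y = (\<Sum>e\<in>E. a e *s (\<chi> f. of_int (incidence X e f)))" by blast
    let ?x = "(\<chi> e. if e \<in> E then a e else 0) :: 'r ^ 'c"
    have "?x \<in> chains Y (int d)" by (simp add: chains_def E)
    moreover have "bdry Y (int d) ?x = y" unfolding eq y by (rule sum.cong) auto
    ultimately show "y \<in> boundaries Y (int d - 1)" unfolding boundaries_def by auto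
  qed
qed

lemma boundaries_int: "(boundaries X (int d - 1) :: (int ^ 'c) set) = int_span D col"
  using boundaries_top_eq[OF bdry_top_component refl, where 'r = int] by (simp add: int_span_def col_def)

lemma boundaries_subcomplex_int:
  assumes "low \<subseteq> S" "S \<subseteq> cw_cells X"
  shows "(boundaries (subcomplex X S) (int d - 1) :: (int ^ 'c) set) = int_span (S \<inter> D) col"
proof -
  interpret S: top_cells_removed X d S using assms by (rule top_cells_removed_if_lower)
  show ?thesis
    using boundaries_top_eq[OF bdry_subcomplex_top_component[OF assms] S.k_cells_top, where 'r = int] by (simp add: int_span_def col_def)
qed

lemma boundaries_real: "(boundaries X (int d - 1) :: (real ^ 'c) set) = {\<Sum>e\<in>D. a e *\<^sub>R real_vec (col e) | a. True}"
proof -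
  have "a *s (\<chi> f. of_int (incidence X e f)) = a *\<^sub>R real_vec (col e)" for a e
    by (simp add: Finite_Cartesian_Product.vec_eq_iff col_def)
  then show ?thesis using boundaries_top_eq[OF bdry_top_component refl, where 'r = real] by simp
qed

lemma Z_subspace: "zmod.subspace Z"
  unfolding Z_def by (rule cycles_subspace)

lemma col_in_Z: "e \<in> D \<Longrightarrow> col e \<in> Z"
proof -
  assume e: "e \<in> D"
  have "bdry X (int d - 1) (col e) $ g = 0" for g
    using incidence_square_zero[OF e, of g] by (simp add: bdry_def col_def)
  then show ?thesis
    using incidence_outside[OF e] by (simp add: Z_def cycles_def chains_def col_def Finite_Cartesian_Product.vec_eq_iff)
qed

text \<open>The cycles in degree \<open>d - 1\<close> depend only on the cells of dimension below \<open>d\<close>.\<close>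

lemma cycles_subcomplex:
  assumes "low \<subseteq> S" "S \<subseteq> cw_cells X"
  shows "cycles (subcomplex X S) (int d - 1) = Z"
proof -
  interpret S: top_cells_removed X d S using assms by (rule top_cells_removed_if_lower)
  have "incidence (subcomplex X S) e = incidence X e" if "e \<in> k_cells X (int d - 1)" for e
    using that assms by (intro S.incidence_subcomplex) (auto simp: k_cells_def low_def)
  then have "(\<Sum>e\<in>k_cells X (int d - 1). of_int (incidence (subcomplex X S) e f) * x $ e)
      = (\<Sum>e\<in>k_cells X (int d - 1). of_int (incidence X e f) * x $ e)" for x :: "int ^ 'c" and f
    by (intro sum.cong) simp_all
  then have "bdry (subcomplex X S) (int d - 1) x = bdry X (int d - 1) x" for x :: "int ^ 'c"
    by (simp add: bdry_def S.k_cells_lower cong: if_cong)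
  then show ?thesis by (simp add: Z_def cycles_def chains_def S.k_cells_lower)
qed

lemma span_in_Z: "E \<subseteq> D \<Longrightarrow> int_span E col \<subseteq> Z"
  using col_in_Z by (intro int_span_minimal Z_subspace) auto

lemma quotient: "E \<subseteq> D \<Longrightarrow> lattice_quotient Z (int_span E col)"
  by (intro lattice_quotient.intro Z_subspace int_span_subspace span_in_Z)

text \<open>
  There are no \<open>(d+1)\<close>-cells, so the homology in degree \<open>d\<close> is the group of relations between the
  boundaries of the \<open>d\<close>-cells of the subcomplex.
\<close>

lemma top_homology_trivial_iff:
  assumes "low \<subseteq> S" "S \<subseteq> cw_cells X"
  shows "trivial_group (cellular_homology (subcomplex X S) (int d)) \<longleftrightarrow> zindep (S \<inter> D) col"
proof -
  interpret S: top_cells_removed X d S using assms by (rule top_cells_removed_if_lower)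
  let ?T = "subcomplex X S"
  have "k_cells ?T (int d + 1) = {}" using assms dim_le by (fastforce simp: k_cells_def)
  then have "(chains ?T (int d + 1) :: (int ^ 'c) set) = {0}"
    by (auto simp: chains_def Finite_Cartesian_Product.vec_eq_iff)
  then have B: "(boundaries ?T (int d) :: (int ^ 'c) set) = {0}"
    by (auto simp: boundaries_def bdry_def Finite_Cartesian_Product.vec_eq_iff)
  have bd: "bdry ?T (int d) x = (\<Sum>e\<in>S \<inter> D. x $ e *s col e)" for x :: "int ^ 'c"
    by (simp add: Finite_Cartesian_Product.vec_eq_iff bdry_subcomplex_top_component[OF assms] col_def mult.commute)
  let ?C = "cycles ?T (int d) :: (int ^ 'c) set"
  have C: "?C = {x. (\<forall>e. e \<notin> S \<inter> D \<longrightarrow> x $ e = 0) \<and> (\<Sum>e\<in>S \<inter> D. x $ e *s col e) = 0}"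
    by (auto simp: cycles_def chains_def bd S.k_cells_top)
  interpret Q: lattice_quotient ?C "{0}"
  proof
    show "zmod.subspace ?C" by (rule cycles_subspace)
    show "zmod.subspace {0 :: int ^ 'c}" by (auto simp: zmod.subspace_def)
    show "{0} \<subseteq> ?C" unfolding C by simp
  qed
  have "trivial_group (cellular_homology ?T (int d)) \<longleftrightarrow> Q.coset ` ?C \<subseteq> {\<one>\<^bsub>Q.H\<^esub>}"
    unfolding cellular_homology_def B using Q.H.trivial_group_subset Q.carrier_H by simp
  also have "\<dots> \<longleftrightarrow> (\<forall>x\<in>?C. Q.coset x = \<one>\<^bsub>Q.H\<^esub>)" by blast
  also have "\<dots> \<longleftrightarrow> (\<forall>x\<in>?C. x = 0)" unfolding Q.coset_eq_one by blast
  also have "\<dots> \<longleftrightarrow> zindep (S \<inter> D) col"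
  proof
    assume *: "\<forall>x\<in>?C. x = 0"
    show "zindep (S \<inter> D) col"
      unfolding zindep_def
    proof (intro allI impI ballI)
      fix a e assume a: "(\<Sum>e\<in>S \<inter> D. a e *s col e) = 0" and e: "e \<in> S \<inter> D"
      let ?x = "(\<chi> e. if e \<in> S \<inter> D then a e else 0) :: int ^ 'c"
      have "(\<Sum>e\<in>S \<inter> D. ?x $ e *s col e) = (\<Sum>e\<in>S \<inter> D. a e *s col e)" by (rule sum.cong) auto
      then have "?x \<in> ?C" unfolding C using a by simp
      then have "?x = 0" using * by blast
      then have "?x $ e = (0 :: int ^ 'c) $ e" by (rule arg_cong)
      then show "a e = 0" using e by simp
    qed
  next
    assume *: "zindep (S \<inter> D) col"
    show "\<forall>x\<in>?C. x = 0"
    proof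
      fix x assume x: "x \<in> ?C"
      then have "\<forall>e\<in>S \<inter> D. x $ e = 0"
        using *[unfolded zindep_def, THEN spec[of _ "\<lambda>e. x $ e"]] unfolding C by simp
      then have "x $ e = 0" for e using x unfolding C by (cases "e \<in> S \<inter> D") auto
      then show "x = 0" by (simp add: Finite_Cartesian_Product.vec_eq_iff)
    qed
  qed
  finally show ?thesis .
qed

text \<open>
  The integral cycles that are boundaries up to a positive multiple. This lattice is common to \<open>X\<close> and
  all its spanning trees, and all torsion groups are quotients of it.
\<close>

definition L :: "(int ^ 'c) set" where
  "L = sat Z (int_span D col)"

lemma L_subspace: "zmod.subspace L"
  unfolding L_def by (rule sat_subspace[OF Z_subspace int_span_subspace])

lemma span_subset_L: "int_span D col \<subseteq> L"
  using span_in_Z[OF order_refl] unfolding L_def sat_def by (auto intro!: exI[of _ 1])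

lemma col_in_L: "e \<in> D \<Longrightarrow> col e \<in> L"
  using int_span_base[of D e col] span_subset_L by auto

text \<open>
  The Betti numbers agree iff every boundary of \<open>X\<close> has a multiple that is a boundary of the subcomplex.
  The same is then true for the elements of \<open>L\<close>, which have multiples that are boundaries of \<open>X\<close>.
\<close>

lemma spanning_tree_iff_lattice:
  "spanning_tree X d S \<longleftrightarrow> low \<subseteq> S \<and> S \<subseteq> cw_cells X \<and> zindep (S \<inter> D) col \<and>
     (\<forall>x\<in>L. \<exists>N>0. N *s x \<in> int_span (S \<inter> D) col)"
proof -
  have sk: "subcomplex_cells X S \<and> skeleton X (int d - 1) \<subseteq> topspace (cw_space (subcomplex X S))
     \<longleftrightarrow> low \<subseteq> S \<and> S \<subseteq> cw_cells X"
  proof -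
    have "subcomplex_cells X S \<and> skeleton X (int d - 1) \<subseteq> topspace (cw_space (subcomplex X S))
        \<longleftrightarrow> S \<subseteq> cw_cells X \<and> (\<forall>e\<in>cw_cells X. cw_dim X e < d \<longrightarrow> e \<in> S)"
      by (rule subcomplex_contains_skeleton_iff[OF dim_le])
    also have "\<dots> \<longleftrightarrow> low \<subseteq> S \<and> S \<subseteq> cw_cells X" by (auto simp: low_def)
    finally show ?thesis .
  qed
  have betti: "betti (subcomplex X S) (int d - 1) = betti X (int d - 1) \<longleftrightarrow>
      (\<forall>x\<in>L. \<exists>N>0. N *s x \<in> int_span (S \<inter> D) col)" if S: "low \<subseteq> S" "S \<subseteq> cw_cells X"
  proof -
    have sub: "int_span (S \<inter> D) col \<subseteq> int_span D col"
      by (rule int_span_minimal[OF int_span_subspace]) (simp add: int_span_base)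
    have "betti (subcomplex X S) (int d - 1) = betti X (int d - 1) \<longleftrightarrow>
        (\<forall>x\<in>int_span D col. \<exists>N>0. N *s x \<in> int_span (S \<inter> D) col)"
      unfolding betti_def cellular_homology_def boundaries_int boundaries_subcomplex_int[OF S]
        cycles_subcomplex[OF S] Z_def[symmetric]
      by (rule abelian_rank_eq_iff[OF quotient quotient sub]) auto
    also have "\<dots> \<longleftrightarrow> (\<forall>x\<in>L. \<exists>N>0. N *s x \<in> int_span (S \<inter> D) col)"
    proof
      assume *: "\<forall>x\<in>int_span D col. \<exists>N>0. N *s x \<in> int_span (S \<inter> D) col"
      show "\<forall>x\<in>L. \<exists>N>0. N *s x \<in> int_span (S \<inter> D) col"
      proof
        fix x assume "x \<in> L"
        then obtain N where N: "N > 0" "N *s x \<in> int_span D col" by (auto simp: L_def sat_def)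
        then obtain M where M: "M > 0" "M *s (N *s x) \<in> int_span (S \<inter> D) col" using * by blast
        then show "\<exists>N>0. N *s x \<in> int_span (S \<inter> D) col"
          using N by (intro exI[of _ "M * N"]) (simp add: vector_smult_assoc)
      qed
    qed (use span_subset_L in blast)
    finally show ?thesis .
  qed
  show ?thesis
    unfolding spanning_tree_def using sk betti top_homology_trivial_iff[of S] by metis
qed

lemma torsion_order_eq:
  assumes "low \<subseteq> S" "S \<subseteq> cw_cells X"
  shows "\<theta> (subcomplex X S) d = card ((\<lambda>x. (\<lambda>g. g + x) ` int_span (S \<inter> D) col) ` sat Z (int_span (S \<inter> D) col))"
proof -
  interpret Q: lattice_quotient Z "int_span (S \<inter> D) col" by (rule quotient) simp
  show ?thesis
    unfolding \<theta>_def torsion_order_def Let_def cellular_homology_def boundaries_subcomplex_int[OF assms]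
      cycles_subcomplex[OF assms] Q.torsion_elements ..
qed

lemma torsion_order_eq_whole:
  "\<theta> X d = card ((\<lambda>x. (\<lambda>g. g + x) ` int_span D col) ` L)"
proof -
  interpret Q: lattice_quotient Z "int_span D col" by (rule quotient) simp
  show ?thesis
    unfolding \<theta>_def torsion_order_def Let_def cellular_homology_def boundaries_int Z_def[symmetric] Q.torsion_elements L_def ..
qed

abbreviation V :: "(real ^ 'c) set" where
  "V \<equiv> boundaries X (int d - 1)"

lemma V_subspace: "subspace V"
  unfolding subspace_def
proof (intro conjI ballI allI)
  show "0 \<in> V" unfolding boundaries_real by (auto intro!: exI[of _ "\<lambda>_. 0"])
  fix x assume "x \<in> V"
  then obtain a where x: "x = (\<Sum>e\<in>D. a e *\<^sub>R real_vec (col e))" unfolding boundaries_real by blast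
  show "x + y \<in> V" if "y \<in> V" for y
  proof -
    obtain a' where y: "y = (\<Sum>e\<in>D. a' e *\<^sub>R real_vec (col e))" using \<open>y \<in> V\<close> unfolding boundaries_real by blast
    have "x + y = (\<Sum>e\<in>D. (a e + a' e) *\<^sub>R real_vec (col e))"
      unfolding x y by (simp add: scaleR_add_left sum.distrib)
    then show ?thesis unfolding boundaries_real by (intro CollectI exI[of _ "\<lambda>e. a e + a' e"]) simp
  qed
  show "c *\<^sub>R x \<in> V" for c
    unfolding x boundaries_real by (intro CollectI exI[of _ "\<lambda>e. c * a e"]) (simp add: scaleR_sum_right)
qed

lemma real_vec_L_in_V:
  assumes "x \<in> L" shows "real_vec x \<in> V"
proof -
  obtain N where N: "N > 0" "N *s x \<in> int_span D col" using assms by (auto simp: L_def sat_def)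
  then obtain a where "N *s x = (\<Sum>e\<in>D. a e *s col e)" by (auto simp: int_span_def)
  then have "real_vec (N *s x) = real_vec (\<Sum>e\<in>D. a e *s col e)" by (rule arg_cong)
  then have eq: "of_int N *\<^sub>R real_vec x = (\<Sum>e\<in>D. of_int (a e) *\<^sub>R real_vec (col e))"
    by (simp add: real_vec_sum)
  have "of_int N *\<^sub>R real_vec x \<in> V"
    unfolding eq boundaries_real by (intro CollectI exI[of _ "\<lambda>e. of_int (a e)"]) simp
  then have "(1 / of_int N) *\<^sub>R (of_int N *\<^sub>R real_vec x) \<in> V" by (rule subspace_scale[OF V_subspace])
  then show ?thesis using N by simp
qed

text \<open>
  Every lattice between \<open>B\<close> and \<open>L\<close> spans the real space of boundaries, and its \<open>\<int>\<close>-bases are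
  independent over the reals. This is used for both ends, \<open>B\<close> and \<open>L\<close>.
\<close>

lemma zbasis_family_basis:
  assumes b: "zbasis r b M" and M: "int_span D col \<subseteq> M" "M \<subseteq> L"
  shows "family_basis r (\<lambda>i. real_vec (b i)) V"
  unfolding family_basis_def
proof (intro conjI allI impI ballI)
  show "real_vec (b i) \<in> V" if "i < r" for i
    using b that M(2) real_vec_L_in_V by (auto simp: zbasis_def)
  show "\<exists>t. x = (\<Sum>i<r. t i *\<^sub>R real_vec (b i))" if xV: "x \<in> V" for x
  proof -
    obtain a where x: "x = (\<Sum>e\<in>D. a e *\<^sub>R real_vec (col e))" using xV unfolding boundaries_real by blast
    have col: "real_vec (col e) = (\<Sum>i<r. of_int (zcoord r b i (col e)) *\<^sub>R real_vec (b i))" if "e \<in> D" for e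
    proof -
      have "col e \<in> M" using int_span_base[of D e col] that M(1) by auto
      from arg_cong[OF zcoord_expand[OF b this], of real_vec] show ?thesis by (simp add: real_vec_sum)
    qed
    have "x = (\<Sum>e\<in>D. \<Sum>i<r. (a e * of_int (zcoord r b i (col e))) *\<^sub>R real_vec (b i))"
      unfolding x by (rule sum.cong[OF refl]) (subst col, simp_all add: scaleR_sum_right)
    also have "\<dots> = (\<Sum>i<r. (\<Sum>e\<in>D. a e * of_int (zcoord r b i (col e))) *\<^sub>R real_vec (b i))"
      by (subst sum.swap) (simp add: scaleR_sum_left)
    finally show ?thesis by (intro exI[of _ "\<lambda>i. \<Sum>e\<in>D. a e * of_int (zcoord r b i (col e))"])
  qed
  show "t i = 0" if "(\<Sum>i<r. t i *\<^sub>R real_vec (b i)) = 0" "i < r" for t i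
    using b[unfolded zbasis_def, THEN conjunct2, THEN conjunct2, THEN spec[of _ t]] that by simp
qed

section \<open>The Laplacian and its determinant\<close>

lemma bdry_real_linear: "linear (bdry X (int d) :: real ^ 'c \<Rightarrow> real ^ 'c)"
  by (rule linearI) (simp_all add: bdry_linear scalar_mult_eq_scaleR[symmetric])

text \<open>The adjoint of the boundary has the component \<open>\<langle>\<partial>e, x\<rangle>\<close> at \<open>e\<close>.\<close>

lemma laplacian_eq: "laplacian X d x = (\<Sum>e\<in>D. (real_vec (col e) \<bullet> x) *\<^sub>R real_vec (col e))"
proof -
  let ?f = "bdry X (int d) :: real ^ 'c \<Rightarrow> real ^ 'c"
  have f: "?f y = (\<Sum>e\<in>D. y $ e *\<^sub>R real_vec (col e))" for y
    by (simp add: Finite_Cartesian_Product.vec_eq_iff bdry_top_component col_def mult.commute)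
  have adj: "adjoint ?f x $ e = (real_vec (col e) \<bullet> x)" if e: "e \<in> D" for e
  proof -
    have "adjoint ?f x $ e = (axis e 1 \<bullet> adjoint ?f x)"
      by (simp add: inner_axis')
    also have "\<dots> = (?f (axis e 1) \<bullet> x)"
      by (rule adjoint_works[OF bdry_real_linear])
    also have "?f (axis e 1) = (\<Sum>e'\<in>D. if e' = e then real_vec (col e') else 0)"
      unfolding f by (rule sum.cong) (auto simp: axis_def)
    also have "\<dots> = real_vec (col e)" using e by simp
    finally show ?thesis .
  qed
  show ?thesis unfolding laplacian_def f[of "adjoint ?f x"] by (rule sum.cong) (simp_all only: adj)
qed

lemma laplacian_linear: "linear (laplacian X d)"
  unfolding laplacian_eq
  by (rule linearI) (simp_all add: inner_add_right scaleR_add_left sum.distrib scaleR_sum_right)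

lemma laplacian_in_V: "laplacian X d x \<in> V"
  unfolding laplacian_eq boundaries_real
  by (intro CollectI exI[of _ "\<lambda>e. (real_vec (col e) \<bullet> x)"]) simp

text \<open>
  If \<open>\<partial>\<partial>\<^sup>* x = 0\<close>, then \<open>0 = \<langle>\<partial>\<partial>\<^sup>* x, x\<rangle>\<close> is the sum of the squares of the numbers \<open>\<langle>\<partial>e, x\<rangle>\<close>. So \<open>x\<close> is
  orthogonal to all \<open>\<partial>e\<close>, and being a combination of them it vanishes.
\<close>

lemma laplacian_kernel:
  assumes x: "x \<in> V" and 0: "laplacian X d x = 0" shows "x = 0"
proof -
  have "0 = (laplacian X d x \<bullet> x)" by (simp add: 0)
  also have "\<dots> = (\<Sum>e\<in>D. (real_vec (col e) \<bullet> x)\<^sup>2)"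
    unfolding laplacian_eq inner_sum_left by (simp add: power2_eq_square)
  finally have "\<forall>e\<in>D. (real_vec (col e) \<bullet> x)\<^sup>2 = 0"
    by (subst sum_nonneg_eq_0_iff[symmetric]) simp_all
  then have orth: "(real_vec (col e) \<bullet> x) = 0" if "e \<in> D" for e using that by simp
  obtain a where xa: "x = (\<Sum>e\<in>D. a e *\<^sub>R real_vec (col e))" using x unfolding boundaries_real by blast
  have "(x \<bullet> x) = (\<Sum>e\<in>D. a e * (real_vec (col e) \<bullet> x))"
    by (subst xa) (simp add: inner_sum_left)
  also have "\<dots> = 0" by (simp add: orth)
  finally show ?thesis by simp
qed

text \<open>An injective endomorphism of a finite-dimensional space is bijective.\<close>

lemma laplacian_bij: "bij_betw (laplacian X d) V V"
proof -
  have inj: "inj_on (laplacian X d) V"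
  proof (rule inj_onI)
    fix x y assume xy: "x \<in> V" "y \<in> V" "laplacian X d x = laplacian X d y"
    have "laplacian X d (x - y) = 0" using xy(3) by (simp add: linear_diff[OF laplacian_linear])
    then have "x - y = 0" by (rule laplacian_kernel[OF subspace_diff[OF V_subspace xy(1,2)]])
    then show "x = y" by simp
  qed
  have "laplacian X d ` V = V"
  proof (rule subspace_dim_equal)
    show "subspace (laplacian X d ` V)" by (rule linear_subspace_image[OF laplacian_linear V_subspace])
    show "subspace V" by (rule V_subspace)
    show "laplacian X d ` V \<subseteq> V" using laplacian_in_V by blast
    have "span V = V" using V_subspace by (simp only: span_eq_iff)
    then have "dim (laplacian X d ` V) = dim V"
      using inj by (intro dim_image_eq[OF laplacian_linear]) (simp only:)
    then show "dim V \<le> dim (laplacian X d ` V)" by simp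
  qed
  then show ?thesis using inj by (simp add: bij_betw_def)
qed

lemma boundary_lattice_eq: "boundary_lattice X (int d - 1) = real_vec ` int_span D col"
proof -
  have "(\<lambda>b :: int ^ 'c. \<chi> e. of_int (b $ e)) = real_vec" by (rule ext) (simp add: real_vec_def)
  then show ?thesis
    unfolding boundary_lattice_def boundaries_int by (rule arg_cong[where f = "\<lambda>f. f ` int_span D col"])
qed

lemma int_span_eq_zbasis: "zbasis r b G \<Longrightarrow> zmod.subspace G \<Longrightarrow> G = int_span {..<r} b"
proof
  assume b: "zbasis r b G" and G: "zmod.subspace G"
  show "G \<subseteq> int_span {..<r} b" using b by (auto simp: zbasis_def int_span_def)
  show "int_span {..<r} b \<subseteq> G" using b by (intro int_span_minimal[OF G]) (auto simp: zbasis_def)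
qed

lemma lattice_basis_exists: "\<exists>bs. lattice_basis V (boundary_lattice X (int d - 1)) bs"
proof -
  obtain r b where b: "zbasis r b (int_span D col)" using zbasis_exists[OF int_span_subspace] .
  let ?bs = "map (\<lambda>i. real_vec (b i)) [0..<r]"
  have "subspace_basis V ?bs"
    using zbasis_family_basis[OF b order_refl span_subset_L] V_subspace by (rule family_basis_subspace_basis)
  moreover have "boundary_lattice X (int d - 1) = {\<Sum>i<length ?bs. of_int (a i) *\<^sub>R ?bs ! i | a :: nat \<Rightarrow> int. True}"
  proof -
    have "boundary_lattice X (int d - 1) = real_vec ` {\<Sum>i<r. a i *s b i | a. True}"
      unfolding boundary_lattice_eq using int_span_eq_zbasis[OF b int_span_subspace] by (simp only: int_span_def)
    also have "\<dots> = {real_vec (\<Sum>i<r. a i *s b i) | a. True}" by blast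
    also have "\<dots> = {\<Sum>i<length ?bs. of_int (a i) *\<^sub>R ?bs ! i | a :: nat \<Rightarrow> int. True}"
      by (simp add: real_vec_sum)
    finally show ?thesis .
  qed
  ultimately show ?thesis unfolding lattice_basis_def by blast
qed

lemma real_int_det: "real_of_int (int_det r C) = Determinant.det (Matrix.mat r r (\<lambda>(i, j). real_of_int (C i j)))"
proof -
  have "real_of_int (int_det r C) = Determinant.det (map_mat real_of_int (Matrix.mat r r (\<lambda>(i, j). C i j)))"
    unfolding int_det_def by (rule of_int_hom.hom_det[symmetric])
  also have "map_mat real_of_int (Matrix.mat r r (\<lambda>(i, j). C i j)) = Matrix.mat r r (\<lambda>(i, j). real_of_int (C i j))"
    by (rule eq_matI) auto
  finally show ?thesis .
qed

text \<open>
  The covolume is the volume spanned by a \<open>\<int>\<close>-basis \<open>w\<close> of the boundary lattice. Changing from the basis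
  \<open>b\<close> of \<open>L\<close> to \<open>w\<close> multiplies the Gram determinant by the square of the determinant of the
  coordinates, which is the index of the boundary lattice in \<open>L\<close>, that is, the order of the torsion.
\<close>

lemma gram_eq_\<gamma>:
  assumes b: "zbasis r b L"
  shows "gram r (\<lambda>i. real_vec (b i)) = \<gamma> X d"
proof -
  let ?c = "\<lambda>i. real_vec (b i)"
  have c: "family_basis r ?c V" by (rule zbasis_family_basis[OF b span_subset_L order_refl])
  define bs where "bs = (SOME bs. lattice_basis V (boundary_lattice X (int d - 1)) bs)"
  have bs: "lattice_basis V (boundary_lattice X (int d - 1)) bs"
    unfolding bs_def by (rule someI_ex[OF lattice_basis_exists])
  have fb: "family_basis (length bs) ((!) bs) V"
    using bs by (intro subspace_basis_family_basis) (simp add: lattice_basis_def)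
  have len: "length bs = r" using family_basis_card[OF fb V_subspace] family_basis_card[OF c V_subspace] by simp
  have lat: "real_vec ` int_span D col = {\<Sum>i<r. of_int (a i) *\<^sub>R bs ! i | a :: nat \<Rightarrow> int. True}"
    using bs unfolding lattice_basis_def boundary_lattice_eq len by blast
  have "\<exists>w. \<forall>j<r. w j \<in> int_span D col \<and> bs ! j = real_vec (w j)"
  proof -
    have "bs ! j \<in> real_vec ` int_span D col" if "j < r" for j
    proof -
      have "(\<Sum>i<r. of_int (if i = j then 1 else 0) *\<^sub>R bs ! i) = (\<Sum>i<r. if i = j then bs ! i else 0)"
        by (rule sum.cong) auto
      also have "\<dots> = bs ! j" using that by simp
      finally show ?thesis unfolding lat by (intro CollectI exI[of _ "\<lambda>i. if i = j then 1 else 0"]) simp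
    qed
    then have "\<forall>j. \<exists>x. j < r \<longrightarrow> x \<in> int_span D col \<and> bs ! j = real_vec x" by blast
    then show ?thesis by metis
  qed
  then obtain w where w: "\<And>j. j < r \<Longrightarrow> w j \<in> int_span D col" "\<And>j. j < r \<Longrightarrow> bs ! j = real_vec (w j)" by blast
  have span_w: "int_span {..<r} w = int_span D col"
  proof
    show "int_span {..<r} w \<subseteq> int_span D col" using w(1) by (intro int_span_minimal[OF int_span_subspace]) auto
    show "int_span D col \<subseteq> int_span {..<r} w"
    proof
      fix x assume "x \<in> int_span D col"
      then have "real_vec x \<in> real_vec ` int_span D col" by (rule imageI)
      then obtain a where "real_vec x = (\<Sum>i<r. of_int (a i) *\<^sub>R bs ! i)" unfolding lat by blast
      also have "\<dots> = real_vec (\<Sum>i<r. a i *s w i)" unfolding real_vec_sum by (rule sum.cong) (simp_all add: w)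
      finally have "x = (\<Sum>i<r. a i *s w i)" by simp
      then show "x \<in> int_span {..<r} w" by (simp only: int_spanI)
    qed
  qed
  define C where "C i j = zcoord r b i (w j)" for i j
  have wC: "w j = (\<Sum>i<r. C i j *s b i)" if "j < r" for j
    unfolding C_def using zcoord_expand[OF b, of "w j"] w(1)[OF that] span_subset_L by auto
  have bsC: "bs ! j = (\<Sum>i<r. of_int (C i j) *\<^sub>R ?c i)" if "j < r" for j
    using arg_cong[OF wC[OF that], of real_vec] w(2)[OF that] by (simp add: real_vec_sum)
  have "Determinant.det (Matrix.mat r r (\<lambda>(i, j). real_of_int (C i j))) \<noteq> 0"
    by (rule change_of_basis(2)[OF fb[unfolded len] c V_subspace bsC])
  then have nz: "int_det r C \<noteq> 0" unfolding real_int_det[symmetric] by simp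
  have theta: "real (\<theta> X d) = \<bar>of_int (int_det r C)\<bar>"
    unfolding torsion_order_eq_whole span_w[symmetric] using index_eq_abs_det[OF b L_subspace wC nz] by simp
  have "\<mu> X d = gram r ((!) bs)"
    unfolding \<mu>_def covolume_def Let_def bs_def[symmetric] len
    by (rule subspace_volume_parallelotope[OF V_subspace fb[unfolded len]])
  also have "\<dots> = (of_int (int_det r C))\<^sup>2 * gram r ?c"
    unfolding real_int_det by (rule gram_change[OF bsC])
  finally show ?thesis
    unfolding \<gamma>_def theta using nz by simp
qed

text \<open>
  If the boundaries of the cells in \<open>E\<close> have a nonzero determinant, they generate a subgroup of finite
  index in \<open>L\<close>, so their saturation is \<open>L\<close> and the torsion has this index as its order.
\<close>

lemma spanning_tree_torsion:
  assumes b: "zbasis r b L" and E: "E \<subseteq> D" "card E = r" and s: "bij_betw s {0..<r} E"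
    and det: "int_det r (\<lambda>i j. zcoord r b i (col (s j))) \<noteq> 0"
  shows "spanning_tree X d (low \<union> E)"
    "real (\<theta> (subcomplex X (low \<union> E)) d) = \<bar>of_int (int_det r (\<lambda>i j. zcoord r b i (col (s j))))\<bar>"
proof -
  have S: "low \<subseteq> low \<union> E" "low \<union> E \<subseteq> cw_cells X" "(low \<union> E) \<inter> D = E"
    using E cells_split by auto
  have s': "bij_betw s {..<r} E" using s by (simp add: lessThan_atLeast0)
  have colL: "col e \<in> L" if "e \<in> E" for e using that E col_in_L by blast
  note suff = basis_criterion_sufficient[OF b L_subspace colL s' det]
  show "spanning_tree X d (low \<union> E)"
    unfolding spanning_tree_iff_lattice S(3) using S(1,2) suff by blast
  have "sat Z (int_span E col) = L"
  proof
    have "int_span E col \<subseteq> int_span D col"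
      using E by (intro int_span_minimal[OF int_span_subspace] int_span_base) auto
    then show "sat Z (int_span E col) \<subseteq> L" by (auto simp: L_def sat_def)
    show "L \<subseteq> sat Z (int_span E col)" using suff(2) by (auto simp: L_def sat_def)
  qed
  then have "\<theta> (subcomplex X (low \<union> E)) d = card ((\<lambda>x. (\<lambda>g. g + x) ` int_span {..<r} (col \<circ> s)) ` L)"
    unfolding torsion_order_eq[OF S(1,2)] S(3) int_span_reindex[OF s'] by simp
  also have "\<dots> = nat \<bar>int_det r (\<lambda>i j. zcoord r b i (col (s j)))\<bar>"
  proof (rule index_eq_abs_det[OF b L_subspace _ det])
    fix j assume "j < r"
    then have "col (s j) \<in> L" using colL s by (auto simp: bij_betw_def)
    from zcoord_expand[OF b this] show "(col \<circ> s) j = (\<Sum>i<r. zcoord r b i (col (s j)) *s b i)" by simp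
  qed
  finally show "real (\<theta> (subcomplex X (low \<union> E)) d) = \<bar>of_int (int_det r (\<lambda>i j. zcoord r b i (col (s j))))\<bar>" by simp
qed

lemma spanning_tree_cells:
  assumes b: "zbasis r b L" and T: "spanning_tree X d S"
    and s: "\<And>E. E \<subseteq> D \<Longrightarrow> card E = r \<Longrightarrow> bij_betw (s E) {0..<r} E"
  shows "S = low \<union> (S \<inter> D)" "card (S \<inter> D) = r" "int_det r (\<lambda>i j. zcoord r b i (col (s (S \<inter> D) j))) \<noteq> 0"
proof -
  have S: "low \<subseteq> S" "S \<subseteq> cw_cells X" "zindep (S \<inter> D) col"
    "\<And>x. x \<in> L \<Longrightarrow> \<exists>N>0. N *s x \<in> int_span (S \<inter> D) col"
    using T unfolding spanning_tree_iff_lattice by auto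
  show "S = low \<union> (S \<inter> D)" using S(1,2) cells_split(1) by blast
  have fin: "finite (S \<inter> D)" by simp
  have colL: "col e \<in> L" if "e \<in> S \<inter> D" for e using that col_in_L by blast
  obtain s' where s': "bij_betw s' {0..<card (S \<inter> D)} (S \<inter> D)" using ex_bij_betw_nat_finite[OF fin] by blast
  show card: "card (S \<inter> D) = r"
    by (rule basis_criterion_necessary(1)[OF b L_subspace fin colL s' S(3,4)])
  have sS: "bij_betw (s (S \<inter> D)) {0..<card (S \<inter> D)} (S \<inter> D)" unfolding card by (rule s) (use card in auto)
  show "int_det r (\<lambda>i j. zcoord r b i (col (s (S \<inter> D) j))) \<noteq> 0"
    by (rule basis_criterion_necessary(2)[OF b L_subspace fin colL sS S(3,4)])
qed

text \<open>
  In a \<open>\<int>\<close>-basis of \<open>L\<close> the Laplacian has the matrix \<open>A A\<^sup>T G\<close>. The Gram determinant is \<open>\<gamma>\<^sub>X\<close>, and the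
  nonzero terms of the Cauchy--Binet expansion of \<open>det (A A\<^sup>T)\<close> correspond to the spanning trees.
\<close>

theorem endo_det_laplacian:
  "endo_det V (laplacian X d) = \<gamma> X d * (\<Sum>T | spanning_tree X d T. (real (\<theta> (subcomplex X T) d))\<^sup>2)"
proof -
  obtain r b where b: "zbasis r b L" using zbasis_exists[OF L_subspace] .
  let ?c = "\<lambda>i. real_vec (b i)"
  let ?A = "\<lambda>i e. real_of_int (zcoord r b i (col e))"
  have c: "family_basis r ?c V" by (rule zbasis_family_basis[OF b span_subset_L order_refl])
  have col_c: "real_vec (col e) = (\<Sum>i<r. ?A i e *\<^sub>R ?c i)" if "e \<in> D" for e
    using arg_cong[OF zcoord_expand[OF b col_in_L[OF that]], of real_vec] by (simp add: real_vec_sum)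
  let ?AA = "\<lambda>j i. \<Sum>e\<in>D. ?A j e * ?A i e"
  let ?M = "\<lambda>j k. \<Sum>i<r. ?AA j i * (?c i \<bullet> ?c k)"
  have "laplacian X d (?c k) = (\<Sum>j<r. ?M j k *\<^sub>R ?c j)" for k
  proof -
    have "laplacian X d (?c k) = (\<Sum>e\<in>D. (\<Sum>i<r. ?A i e * (?c i \<bullet> ?c k)) *\<^sub>R (\<Sum>j<r. ?A j e *\<^sub>R ?c j))"
      unfolding laplacian_eq by (rule sum.cong[OF refl]) (simp add: col_c inner_sum_left)
    also have "\<dots> = (\<Sum>e\<in>D. \<Sum>j<r. (\<Sum>i<r. ?A j e * ?A i e * (?c i \<bullet> ?c k)) *\<^sub>R ?c j)"
      by (simp add: scaleR_sum_right sum_distrib_left sum_distrib_right mult_ac)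
    also have "\<dots> = (\<Sum>j<r. (\<Sum>e\<in>D. \<Sum>i<r. ?A j e * ?A i e * (?c i \<bullet> ?c k)) *\<^sub>R ?c j)"
      by (subst sum.swap) (simp add: scaleR_sum_left)
    also have "\<dots> = (\<Sum>j<r. ?M j k *\<^sub>R ?c j)"
      by (rule sum.cong[OF refl], subst sum.swap) (simp add: sum_distrib_right)
    finally show ?thesis .
  qed
  then have "endo_det V (laplacian X d) = Determinant.det (Matrix.mat r r (\<lambda>(j, k). ?M j k))"
    by (intro endo_det_eq[OF V_subspace laplacian_linear c])
  also have "Matrix.mat r r (\<lambda>(j, k). ?M j k) = Matrix.mat r r (\<lambda>(j, i). ?AA j i) *
      Matrix.mat r r (\<lambda>(i, k). (?c i \<bullet> ?c k))"
    by (rule eq_matI) (simp_all add: scalar_prod_def lessThan_atLeast0)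
  also have "Determinant.det \<dots> = Determinant.det (Matrix.mat r r (\<lambda>(j, i). ?AA j i)) * gram r ?c"
    unfolding gram_def by (rule Determinant.det_mult[of _ r]) auto
  finally have 1: "endo_det V (laplacian X d) = \<gamma> X d * Determinant.det (Matrix.mat r r (\<lambda>(j, i). ?AA j i))"
    by (simp add: gram_eq_\<gamma>[OF b])
  \<comment> \<open>The squares of the minors do not depend on the enumeration of \<open>E\<close>, so any choice will do.\<close>
  have "\<exists>s. \<forall>E. E \<subseteq> D \<and> card E = r \<longrightarrow> bij_betw (s E) {0..<r} E"
  proof -
    have "\<forall>E. \<exists>t. E \<subseteq> D \<and> card E = r \<longrightarrow> bij_betw t {0..<r} E"
      using ex_bij_betw_nat_finite[OF finite_subset[OF _ finite]] by (metis finite_code)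
    then show ?thesis by metis
  qed
  then obtain s where s: "\<And>E. E \<subseteq> D \<Longrightarrow> card E = r \<Longrightarrow> bij_betw (s E) {0..<r} E" by blast
  let ?C = "\<lambda>E. int_det r (\<lambda>i j. zcoord r b i (col (s E j)))"
  have minor: "minor r ?A (s E) = of_int (?C E)" for E
    unfolding minor_def real_int_det ..
  have "Determinant.det (Matrix.mat r r (\<lambda>(j, i). ?AA j i)) = (\<Sum>E | E \<subseteq> D \<and> card E = r. (of_int (?C E))\<^sup>2)"
    using cauchy_binet_square[OF finite s, where A = ?A] unfolding minor by simp
  also have "\<dots> = (\<Sum>E | E \<subseteq> D \<and> card E = r \<and> ?C E \<noteq> 0. (of_int (?C E))\<^sup>2)"
    by (rule sum.mono_neutral_right) auto
  also have "\<dots> = (\<Sum>T | spanning_tree X d T. (real (\<theta> (subcomplex X T) d))\<^sup>2)"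
  proof (rule sum.reindex_bij_witness[where i = "\<lambda>T. T \<inter> D" and j = "\<lambda>E. low \<union> E"])
    fix E assume "E \<in> {E. E \<subseteq> D \<and> card E = r \<and> ?C E \<noteq> 0}"
    then have E: "E \<subseteq> D" "card E = r" "?C E \<noteq> 0" by auto
    show "(low \<union> E) \<inter> D = E" using E(1) cells_split(2) by auto
    note tree = spanning_tree_torsion[OF b E(1,2) s[OF E(1,2)] E(3)]
    show "low \<union> E \<in> {T. spanning_tree X d T}" using tree(1) by simp
    show "(real (\<theta> (subcomplex X (low \<union> E)) d))\<^sup>2 = (of_int (?C E))\<^sup>2" unfolding tree(2) by simp
  next
    fix T assume "T \<in> {T. spanning_tree X d T}"
    then have T: "spanning_tree X d T" by simp
    note cells = spanning_tree_cells[OF b T s]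
    show "low \<union> (T \<inter> D) = T" by (rule cells(1)[symmetric])
    show "T \<inter> D \<in> {E. E \<subseteq> D \<and> card E = r \<and> ?C E \<noteq> 0}" using cells(2,3) by simp
  qed
  finally show ?thesis unfolding 1 by simp
qed

end

theorem corollary4:
  fixes X :: "('a, 'c::finite) cw_data" and d :: nat
  assumes "finite_CW_complex X"
    and "connected_space (cw_space X)"
    and "has_dimension X d"
    and "d \<ge> 1"
  shows "bij_betw (laplacian X d) (boundaries X (int d - 1)) (boundaries X (int d - 1)) \<and>
    endo_det (boundaries X (int d - 1)) (laplacian X d) =
      \<gamma> X d * (\<Sum>T | spanning_tree X d T. (real (\<theta> (subcomplex X T) d))\<^sup>2)"
proof -
  interpret top_dimensional X d
    using assms by unfold_locales (auto simp: has_dimension_def)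
  show ?thesis using laplacian_bij endo_det_laplacian by blast
qed

end
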